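(* Work in homotopy type theory, and let $\mathcal{U}$ be a univalent universe. Suppose that sets cover in $\mathcal{U}$, that the law of excluded middle holds for propositions, and that $L$ is an accessible reflective subuniverse of $\mathcal{U}$ such that the empty type is $L$-local. Then $L$ can merely be presented as localization with respect to a single map; that is, there merely exists a map $g : A \to B$ with $A, B : \mathcal{U}$ such that a type $X : \mathcal{U}$ is $L$-local if and only if precomposition with $g$ is an equivalence $X^B \to X^A$.
   Context: The setting is homotopy type theory as in the HoTT Book. "Merely exists" refers to the propositional truncation. Law of excluded middle: $P + \lnot P$ for every mere proposition $P$. Sets cover in $\mathcal{U}$: for every $X:\mathcal{U}$ there merely exist a $0$-type (set) $S:\mathcal{U}$ and a $(-1)$-connected (i.e. surjective) map $S\to X$. A reflective subuniverse $L$ of $\mathcal{U}$ consists of a predicate $\mathsf{is\text{-}local}_L : \mathcal{U}\to\mathsf{Prop}_{\mathcal{U}}$, a function $L:\mathcal{U}\to\mathcal{U}$, and for each $X:\mathcal{U}$ a map $\eta_X : X\to LX$ such that $LX$ is $L$-local and, for every $L$-local $Y:\mathcal{U}$, precomposition with $\eta_X$ is an equivalence $(LX\to Y)\to (X\to Y)$. Given a family $f:\prod_{i:I}(A_i\to B_i)$, a type $X$ is $f$-local if for each $i:I$ precomposition with $f_i$ is an equivalence $X^{B_i}\to X^{A_i}$. $L$ is accessible if it is presented by a family in $\mathcal{U}$: there is $f:\prod_{i:I}(A_i\to B_i)$ with $I:\mathcal{U}$ and all $A_i,B_i:\mathcal{U}$ such that the $L$-local types in $\mathcal{U}$ are exactly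 the $f$-local types in $\mathcal{U}$. *)

theory Defs
  imports Main
begin

text \<open>
  HOL cannot host homotopy type theory as its own ambient logic, so the type theory is
  represented as an object: raw terms, the judgments of the formal type theory of the HoTT Book
  (second presentation, Appendix A.2 and A.3), and the types that the theorem speaks about as terms.
  That a theorem holds in homotopy type theory means that its type has an inhabitant derivable
  in the empty context.

  The theory consists of a cumulative hierarchy of univalent universes, dependent functions
  (with eta), dependent pairs, coproducts, empty type, unit type, natural numbers, identity types,
  function extensionality and propositional truncation. No other higher inductive types are
  assumed, and no form of classical logic or choice.
\<close>

section \<open>Raw terms\<close>

text \<open>
  Variables are de Bruijn indices. As in the Book, eliminators carry their motive. The
  numbers of variables bound in the arguments are:
  \<^item> \<open>Pi\<close>, \<open>Lam\<close>, \<open>Sig\<close>: one in the second argument;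
  \<^item> \<open>IndSig C g p\<close>: one in \<open>C\<close>, two in \<open>g\<close>;
  \<^item> \<open>IndCoprod C c d p\<close>: one in each of \<open>C\<close>, \<open>c\<close>, \<open>d\<close>;
  \<^item> \<open>IndEmpty C p\<close> and \<open>IndUnit C c p\<close>: one in \<open>C\<close>;
  \<^item> \<open>IndNat C z s m\<close>: one in \<open>C\<close>, two in \<open>s\<close> (the predecessor is index 1, the recursive value index 0);
  \<^item> \<open>IndId C c a b p\<close>: three in \<open>C\<close> (the endpoints are indices 2 and 1, the path index 0), one in \<open>c\<close>.
\<close>

datatype tm =
    Var nat
  | Univ nat
  | Pi tm tm | Lam tm tm | App tm tm
  | Sig tm tm | Pair tm tm | IndSig tm tm tm
  | Coprod tm tm | InL tm | InR tm | IndCoprod tm tm tm tm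
  | Empty | IndEmpty tm tm
  | Unit | Star | IndUnit tm tm tm
  | NatT | Zero | Succ tm | IndNat tm tm tm tm
  | Id tm tm tm | Refl tm | IndId tm tm tm tm tm
  | Funext tm tm
  | Univalence nat tm tm
  | Trunc tm | TruncIn tm | TruncPath tm tm | TruncRec tm tm tm tm

definition upr :: "(nat \<Rightarrow> nat) \<Rightarrow> nat \<Rightarrow> nat" where
  "upr \<xi> k = (case k of 0 \<Rightarrow> 0 | Suc m \<Rightarrow> Suc (\<xi> m))"

primrec ren :: "(nat \<Rightarrow> nat) \<Rightarrow> tm \<Rightarrow> tm" where
  "ren \<xi> (Var k) = Var (\<xi> k)"
| "ren \<xi> (Univ i) = Univ i"
| "ren \<xi> (Pi A B) = Pi (ren \<xi> A) (ren (upr \<xi>) B)"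
| "ren \<xi> (Lam A b) = Lam (ren \<xi> A) (ren (upr \<xi>) b)"
| "ren \<xi> (App f a) = App (ren \<xi> f) (ren \<xi> a)"
| "ren \<xi> (Sig A B) = Sig (ren \<xi> A) (ren (upr \<xi>) B)"
| "ren \<xi> (Pair a b) = Pair (ren \<xi> a) (ren \<xi> b)"
| "ren \<xi> (IndSig C g p) = IndSig (ren (upr \<xi>) C) (ren (upr (upr \<xi>)) g) (ren \<xi> p)"
| "ren \<xi> (Coprod A B) = Coprod (ren \<xi> A) (ren \<xi> B)"
| "ren \<xi> (InL a) = InL (ren \<xi> a)"
| "ren \<xi> (InR b) = InR (ren \<xi> b)"
| "ren \<xi> (IndCoprod C c d p) =
     IndCoprod (ren (upr \<xi>) C) (ren (upr \<xi>) c) (ren (upr \<xi>) d) (ren \<xi> p)"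
| "ren \<xi> Empty = Empty"
| "ren \<xi> (IndEmpty C p) = IndEmpty (ren (upr \<xi>) C) (ren \<xi> p)"
| "ren \<xi> Unit = Unit"
| "ren \<xi> Star = Star"
| "ren \<xi> (IndUnit C c p) = IndUnit (ren (upr \<xi>) C) (ren \<xi> c) (ren \<xi> p)"
| "ren \<xi> NatT = NatT"
| "ren \<xi> Zero = Zero"
| "ren \<xi> (Succ m) = Succ (ren \<xi> m)"
| "ren \<xi> (IndNat C z s m) =
     IndNat (ren (upr \<xi>) C) (ren \<xi> z) (ren (upr (upr \<xi>)) s) (ren \<xi> m)"
| "ren \<xi> (Id A a b) = Id (ren \<xi> A) (ren \<xi> a) (ren \<xi> b)"
| "ren \<xi> (Refl a) = Refl (ren \<xi> a)"
| "ren \<xi> (IndId C c a b p) =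
     IndId (ren (upr (upr (upr \<xi>))) C) (ren (upr \<xi>) c) (ren \<xi> a) (ren \<xi> b) (ren \<xi> p)"
| "ren \<xi> (Funext f g) = Funext (ren \<xi> f) (ren \<xi> g)"
| "ren \<xi> (Univalence i A B) = Univalence i (ren \<xi> A) (ren \<xi> B)"
| "ren \<xi> (Trunc A) = Trunc (ren \<xi> A)"
| "ren \<xi> (TruncIn a) = TruncIn (ren \<xi> a)"
| "ren \<xi> (TruncPath a b) = TruncPath (ren \<xi> a) (ren \<xi> b)"
| "ren \<xi> (TruncRec B h f t) = TruncRec (ren \<xi> B) (ren \<xi> h) (ren \<xi> f) (ren \<xi> t)"

abbreviation shift :: "nat \<Rightarrow> tm \<Rightarrow> tm" where
  "shift n A \<equiv> ren (\<lambda>k. k + n) A"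

abbreviation lift :: "tm \<Rightarrow> tm" ("_\<up>" [1000] 1000) where
  "A\<up> \<equiv> ren Suc A"

definition scons :: "tm \<Rightarrow> (nat \<Rightarrow> tm) \<Rightarrow> nat \<Rightarrow> tm" (infixr "\<cdot>" 70) where
  "(a \<cdot> \<sigma>) k = (case k of 0 \<Rightarrow> a | Suc m \<Rightarrow> \<sigma> m)"

definition ups :: "(nat \<Rightarrow> tm) \<Rightarrow> nat \<Rightarrow> tm" where
  "ups \<sigma> = Var 0 \<cdot> (\<lambda>k. (\<sigma> k)\<up>)"

primrec subst :: "(nat \<Rightarrow> tm) \<Rightarrow> tm \<Rightarrow> tm" where
  "subst \<sigma> (Var k) = \<sigma> k"
| "subst \<sigma> (Univ i) = Univ i"
| "subst \<sigma> (Pi A B) = Pi (subst \<sigma> A) (subst (ups \<sigma>) B)"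
| "subst \<sigma> (Lam A b) = Lam (subst \<sigma> A) (subst (ups \<sigma>) b)"
| "subst \<sigma> (App f a) = App (subst \<sigma> f) (subst \<sigma> a)"
| "subst \<sigma> (Sig A B) = Sig (subst \<sigma> A) (subst (ups \<sigma>) B)"
| "subst \<sigma> (Pair a b) = Pair (subst \<sigma> a) (subst \<sigma> b)"
| "subst \<sigma> (IndSig C g p) =
     IndSig (subst (ups \<sigma>) C) (subst (ups (ups \<sigma>)) g) (subst \<sigma> p)"
| "subst \<sigma> (Coprod A B) = Coprod (subst \<sigma> A) (subst \<sigma> B)"
| "subst \<sigma> (InL a) = InL (subst \<sigma> a)"
| "subst \<sigma> (InR b) = InR (subst \<sigma> b)"
| "subst \<sigma> (IndCoprod C c d p) =
     IndCoprod (subst (ups \<sigma>) C) (subst (ups \<sigma>) c) (subst (ups \<sigma>) d) (subst \<sigma> p)"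
| "subst \<sigma> Empty = Empty"
| "subst \<sigma> (IndEmpty C p) = IndEmpty (subst (ups \<sigma>) C) (subst \<sigma> p)"
| "subst \<sigma> Unit = Unit"
| "subst \<sigma> Star = Star"
| "subst \<sigma> (IndUnit C c p) = IndUnit (subst (ups \<sigma>) C) (subst \<sigma> c) (subst \<sigma> p)"
| "subst \<sigma> NatT = NatT"
| "subst \<sigma> Zero = Zero"
| "subst \<sigma> (Succ m) = Succ (subst \<sigma> m)"
| "subst \<sigma> (IndNat C z s m) =
     IndNat (subst (ups \<sigma>) C) (subst \<sigma> z) (subst (ups (ups \<sigma>)) s) (subst \<sigma> m)"
| "subst \<sigma> (Id A a b) = Id (subst \<sigma> A) (subst \<sigma> a) (subst \<sigma> b)"
| "subst \<sigma> (Refl a) = Refl (subst \<sigma> a)"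
| "subst \<sigma> (IndId C c a b p) =
     IndId (subst (ups (ups (ups \<sigma>))) C) (subst (ups \<sigma>) c)
       (subst \<sigma> a) (subst \<sigma> b) (subst \<sigma> p)"
| "subst \<sigma> (Funext f g) = Funext (subst \<sigma> f) (subst \<sigma> g)"
| "subst \<sigma> (Univalence i A B) = Univalence i (subst \<sigma> A) (subst \<sigma> B)"
| "subst \<sigma> (Trunc A) = Trunc (subst \<sigma> A)"
| "subst \<sigma> (TruncIn a) = TruncIn (subst \<sigma> a)"
| "subst \<sigma> (TruncPath a b) = TruncPath (subst \<sigma> a) (subst \<sigma> b)"
| "subst \<sigma> (TruncRec B h f t) =
     TruncRec (subst \<sigma> B) (subst \<sigma> h) (subst \<sigma> f) (subst \<sigma> t)"

abbreviation inst :: "tm \<Rightarrow> tm \<Rightarrow> tm" ("_\<lbrakk>_\<rbrakk>" [1000, 0] 1000) where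
  "B\<lbrakk>a\<rbrakk> \<equiv> subst (a \<cdot> Var) B"

section \<open>Types occurring in the rules\<close>

text \<open>
  Throughout, an argument of a type-forming definition is a term in the ambient context, and
  the definition itself lifts it below the binders that it introduces.
\<close>

definition Fun :: "tm \<Rightarrow> tm \<Rightarrow> tm" (infixr "\<rightarrow>" 60) where
  "A \<rightarrow> B = Pi A B\<up>"

definition Prod :: "tm \<Rightarrow> tm \<Rightarrow> tm" (infixr "\<otimes>" 65) where
  "A \<otimes> B = Sig A B\<up>"

definition is_prop :: "tm \<Rightarrow> tm" where
  "is_prop A = Pi A (Pi A\<up> (Id A\<up>\<up> (Var 1) (Var 0)))"

text \<open>
  The bi-invertible form of equivalence:
  \<open>(\<Sigma>(g:B\<rightarrow>A). \<Pi>(y:B). f(g y) = y) \<times> (\<Sigma>(h:B\<rightarrow>A). \<Pi>(x:A). h(f x) = x)\<close>.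
\<close>

definition is_equiv :: "tm \<Rightarrow> tm \<Rightarrow> tm \<Rightarrow> tm" where
  "is_equiv A B f =
     Sig (B \<rightarrow> A) (Pi B\<up> (Id B\<up>\<up> (App f\<up>\<up> (App (Var 1) (Var 0))) (Var 0)))
     \<otimes> Sig (B \<rightarrow> A) (Pi A\<up> (Id A\<up>\<up> (App (Var 1) (App f\<up>\<up> (Var 0))) (Var 0)))"

definition Equiv :: "tm \<Rightarrow> tm \<Rightarrow> tm" where
  "Equiv A B = Sig (A \<rightarrow> B) (is_equiv A\<up> B\<up> (Var 0))"

definition id_equiv :: "tm \<Rightarrow> tm" where
  "id_equiv A =
     (let q = Pair (Lam A (Var 0)) (Lam A (Refl (Var 0)))
      in Pair (Lam A (Var 0)) (Pair q q))"

text \<open>The map \<open>(A = B) \<rightarrow> (A \<simeq> B)\<close> defined by path induction, sending \<open>refl\<close> to the identity equivalence.\<close>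

definition idtoeqv :: "nat \<Rightarrow> tm \<Rightarrow> tm \<Rightarrow> tm" where
  "idtoeqv i A B =
     Lam (Id (Univ i) A B)
       (IndId (Equiv (Var 2) (Var 1)) (id_equiv (Var 0)) A\<up> B\<up> (Var 0))"

text \<open>
  Pointwise equality, and the map from \<open>f = g\<close> to it, for \<open>f, g : \<Pi>(x:A). B\<close>. Here \<open>B\<close>
  lives in the context extended by \<open>A\<close>; \<open>upr\<close> keeps its variable \<open>x\<close> in place while the others
  are shifted.
\<close>

definition Homotopy :: "tm \<Rightarrow> tm \<Rightarrow> tm \<Rightarrow> tm \<Rightarrow> tm" where
  "Homotopy A B f g = Pi A (Id B (App f\<up> (Var 0)) (App g\<up> (Var 0)))"

definition happly :: "tm \<Rightarrow> tm \<Rightarrow> tm \<Rightarrow> tm \<Rightarrow> tm" where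
  "happly A B f g =
     Lam (Id (Pi A B) f g)
       (IndId (Homotopy (shift 4 A) (ren (upr (\<lambda>k. k + 4)) B) (Var 2) (Var 1))
              (Lam (shift 2 A) (Refl (App (Var 1) (Var 0))))
              f\<up> g\<up> (Var 0))"

section \<open>Judgments\<close>

text \<open>
  A context is a list of types with the most recent assumption first; each type lives in
  the context formed by the entries after it. There is no separate judgment for types: a type
  is an element of some universe. Weakening and substitution are not primitive, as in the Book.
  Propositional truncation is given by its constructors and recursion into mere propositions, with
  the judgmental computation rule on points.
\<close>

inductive
  wf_ctx :: "tm list \<Rightarrow> bool" ("\<turnstile> _ ctx" [50] 50) and
  has_type :: "tm list \<Rightarrow> tm \<Rightarrow> tm \<Rightarrow> bool" ("_ \<turnstile> _ \<Colon> _" [50, 50, 50] 50) and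
  eq_tm :: "tm list \<Rightarrow> tm \<Rightarrow> tm \<Rightarrow> tm \<Rightarrow> bool" ("_ \<turnstile> _ \<doteq> _ \<Colon> _" [50, 50, 50, 50] 50)
where
  ctx_emp: "\<turnstile> [] ctx"
| ctx_ext: "\<Gamma> \<turnstile> A \<Colon> Univ i \<Longrightarrow> \<turnstile> A # \<Gamma> ctx"

| vble: "\<turnstile> \<Gamma> ctx \<Longrightarrow> k < length \<Gamma> \<Longrightarrow> \<Gamma> \<turnstile> Var k \<Colon> shift (Suc k) (\<Gamma> ! k)"
| conv: "\<Gamma> \<turnstile> a \<Colon> A \<Longrightarrow> \<Gamma> \<turnstile> A \<doteq> B \<Colon> Univ i \<Longrightarrow> \<Gamma> \<turnstile> a \<Colon> B"

| eq_refl: "\<Gamma> \<turnstile> a \<Colon> A \<Longrightarrow> \<Gamma> \<turnstile> a \<doteq> a \<Colon> A"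
| eq_sym: "\<Gamma> \<turnstile> a \<doteq> b \<Colon> A \<Longrightarrow> \<Gamma> \<turnstile> b \<doteq> a \<Colon> A"
| eq_trans: "\<Gamma> \<turnstile> a \<doteq> b \<Colon> A \<Longrightarrow> \<Gamma> \<turnstile> b \<doteq> c \<Colon> A \<Longrightarrow> \<Gamma> \<turnstile> a \<doteq> c \<Colon> A"
| eq_conv: "\<Gamma> \<turnstile> a \<doteq> b \<Colon> A \<Longrightarrow> \<Gamma> \<turnstile> A \<doteq> B \<Colon> Univ i \<Longrightarrow> \<Gamma> \<turnstile> a \<doteq> b \<Colon> B"

| univ_intro: "\<turnstile> \<Gamma> ctx \<Longrightarrow> \<Gamma> \<turnstile> Univ i \<Colon> Univ (Suc i)"
| univ_cumul: "\<Gamma> \<turnstile> A \<Colon> Univ i \<Longrightarrow> \<Gamma> \<turnstile> A \<Colon> Univ (Suc i)"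
| univ_cumul_eq: "\<Gamma> \<turnstile> A \<doteq> B \<Colon> Univ i \<Longrightarrow> \<Gamma> \<turnstile> A \<doteq> B \<Colon> Univ (Suc i)"

| pi_form: "\<Gamma> \<turnstile> A \<Colon> Univ i \<Longrightarrow> A # \<Gamma> \<turnstile> B \<Colon> Univ i \<Longrightarrow> \<Gamma> \<turnstile> Pi A B \<Colon> Univ i"
| pi_form_eq: "\<Gamma> \<turnstile> A \<Colon> Univ i \<Longrightarrow> \<Gamma> \<turnstile> A \<doteq> A' \<Colon> Univ i \<Longrightarrow> A # \<Gamma> \<turnstile> B \<doteq> B' \<Colon> Univ i \<Longrightarrow>
    \<Gamma> \<turnstile> Pi A B \<doteq> Pi A' B' \<Colon> Univ i"
| pi_intro: "A # \<Gamma> \<turnstile> b \<Colon> B \<Longrightarrow> \<Gamma> \<turnstile> Lam A b \<Colon> Pi A B"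
| pi_intro_eq: "\<Gamma> \<turnstile> A \<Colon> Univ i \<Longrightarrow> \<Gamma> \<turnstile> A \<doteq> A' \<Colon> Univ i \<Longrightarrow> A # \<Gamma> \<turnstile> b \<doteq> b' \<Colon> B \<Longrightarrow>
    \<Gamma> \<turnstile> Lam A b \<doteq> Lam A' b' \<Colon> Pi A B"
| pi_elim: "\<Gamma> \<turnstile> f \<Colon> Pi A B \<Longrightarrow> \<Gamma> \<turnstile> a \<Colon> A \<Longrightarrow> \<Gamma> \<turnstile> App f a \<Colon> B\<lbrakk>a\<rbrakk>"
| pi_elim_eq: "\<Gamma> \<turnstile> f \<doteq> f' \<Colon> Pi A B \<Longrightarrow> \<Gamma> \<turnstile> a \<doteq> a' \<Colon> A \<Longrightarrow> \<Gamma> \<turnstile> App f a \<doteq> App f' a' \<Colon> B\<lbrakk>a\<rbrakk>"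
| pi_comp: "A # \<Gamma> \<turnstile> b \<Colon> B \<Longrightarrow> \<Gamma> \<turnstile> a \<Colon> A \<Longrightarrow> \<Gamma> \<turnstile> App (Lam A b) a \<doteq> b\<lbrakk>a\<rbrakk> \<Colon> B\<lbrakk>a\<rbrakk>"
| pi_uniq: "\<Gamma> \<turnstile> f \<Colon> Pi A B \<Longrightarrow> \<Gamma> \<turnstile> f \<doteq> Lam A (App f\<up> (Var 0)) \<Colon> Pi A B"

| sig_form: "\<Gamma> \<turnstile> A \<Colon> Univ i \<Longrightarrow> A # \<Gamma> \<turnstile> B \<Colon> Univ i \<Longrightarrow> \<Gamma> \<turnstile> Sig A B \<Colon> Univ i"
| sig_form_eq: "\<Gamma> \<turnstile> A \<Colon> Univ i \<Longrightarrow> \<Gamma> \<turnstile> A \<doteq> A' \<Colon> Univ i \<Longrightarrow> A # \<Gamma> \<turnstile> B \<doteq> B' \<Colon> Univ i \<Longrightarrow>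
    \<Gamma> \<turnstile> Sig A B \<doteq> Sig A' B' \<Colon> Univ i"
| sig_intro: "A # \<Gamma> \<turnstile> B \<Colon> Univ i \<Longrightarrow> \<Gamma> \<turnstile> a \<Colon> A \<Longrightarrow> \<Gamma> \<turnstile> b \<Colon> B\<lbrakk>a\<rbrakk> \<Longrightarrow> \<Gamma> \<turnstile> Pair a b \<Colon> Sig A B"
| sig_intro_eq: "A # \<Gamma> \<turnstile> B \<Colon> Univ i \<Longrightarrow> \<Gamma> \<turnstile> a \<doteq> a' \<Colon> A \<Longrightarrow> \<Gamma> \<turnstile> b \<doteq> b' \<Colon> B\<lbrakk>a\<rbrakk> \<Longrightarrow>
    \<Gamma> \<turnstile> Pair a b \<doteq> Pair a' b' \<Colon> Sig A B"
| sig_elim: "Sig A B # \<Gamma> \<turnstile> C \<Colon> Univ i \<Longrightarrow>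
    B # A # \<Gamma> \<turnstile> g \<Colon> subst (Pair (Var 1) (Var 0) \<cdot> (\<lambda>k. Var (k + 2))) C \<Longrightarrow>
    \<Gamma> \<turnstile> p \<Colon> Sig A B \<Longrightarrow>
    \<Gamma> \<turnstile> IndSig C g p \<Colon> C\<lbrakk>p\<rbrakk>"
| sig_elim_eq: "Sig A B # \<Gamma> \<turnstile> C \<doteq> C' \<Colon> Univ i \<Longrightarrow>
    B # A # \<Gamma> \<turnstile> g \<doteq> g' \<Colon> subst (Pair (Var 1) (Var 0) \<cdot> (\<lambda>k. Var (k + 2))) C \<Longrightarrow>
    \<Gamma> \<turnstile> p \<doteq> p' \<Colon> Sig A B \<Longrightarrow>
    \<Gamma> \<turnstile> IndSig C g p \<doteq> IndSig C' g' p' \<Colon> C\<lbrakk>p\<rbrakk>"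
| sig_comp: "Sig A B # \<Gamma> \<turnstile> C \<Colon> Univ i \<Longrightarrow>
    B # A # \<Gamma> \<turnstile> g \<Colon> subst (Pair (Var 1) (Var 0) \<cdot> (\<lambda>k. Var (k + 2))) C \<Longrightarrow>
    \<Gamma> \<turnstile> a \<Colon> A \<Longrightarrow> \<Gamma> \<turnstile> b \<Colon> B\<lbrakk>a\<rbrakk> \<Longrightarrow>
    \<Gamma> \<turnstile> IndSig C g (Pair a b) \<doteq> subst (b \<cdot> a \<cdot> Var) g \<Colon> C\<lbrakk>Pair a b\<rbrakk>"

| coprod_form: "\<Gamma> \<turnstile> A \<Colon> Univ i \<Longrightarrow> \<Gamma> \<turnstile> B \<Colon> Univ i \<Longrightarrow> \<Gamma> \<turnstile> Coprod A B \<Colon> Univ i"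
| coprod_form_eq: "\<Gamma> \<turnstile> A \<doteq> A' \<Colon> Univ i \<Longrightarrow> \<Gamma> \<turnstile> B \<doteq> B' \<Colon> Univ i \<Longrightarrow>
    \<Gamma> \<turnstile> Coprod A B \<doteq> Coprod A' B' \<Colon> Univ i"
| coprod_intro1: "\<Gamma> \<turnstile> A \<Colon> Univ i \<Longrightarrow> \<Gamma> \<turnstile> B \<Colon> Univ i \<Longrightarrow> \<Gamma> \<turnstile> a \<Colon> A \<Longrightarrow> \<Gamma> \<turnstile> InL a \<Colon> Coprod A B"
| coprod_intro1_eq: "\<Gamma> \<turnstile> A \<Colon> Univ i \<Longrightarrow> \<Gamma> \<turnstile> B \<Colon> Univ i \<Longrightarrow> \<Gamma> \<turnstile> a \<doteq> a' \<Colon> A \<Longrightarrow>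
    \<Gamma> \<turnstile> InL a \<doteq> InL a' \<Colon> Coprod A B"
| coprod_intro2: "\<Gamma> \<turnstile> A \<Colon> Univ i \<Longrightarrow> \<Gamma> \<turnstile> B \<Colon> Univ i \<Longrightarrow> \<Gamma> \<turnstile> b \<Colon> B \<Longrightarrow> \<Gamma> \<turnstile> InR b \<Colon> Coprod A B"
| coprod_intro2_eq: "\<Gamma> \<turnstile> A \<Colon> Univ i \<Longrightarrow> \<Gamma> \<turnstile> B \<Colon> Univ i \<Longrightarrow> \<Gamma> \<turnstile> b \<doteq> b' \<Colon> B \<Longrightarrow>
    \<Gamma> \<turnstile> InR b \<doteq> InR b' \<Colon> Coprod A B"
| coprod_elim: "Coprod A B # \<Gamma> \<turnstile> C \<Colon> Univ i \<Longrightarrow>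
    A # \<Gamma> \<turnstile> c \<Colon> subst (InL (Var 0) \<cdot> (\<lambda>k. Var (k + 1))) C \<Longrightarrow>
    B # \<Gamma> \<turnstile> d \<Colon> subst (InR (Var 0) \<cdot> (\<lambda>k. Var (k + 1))) C \<Longrightarrow>
    \<Gamma> \<turnstile> p \<Colon> Coprod A B \<Longrightarrow>
    \<Gamma> \<turnstile> IndCoprod C c d p \<Colon> C\<lbrakk>p\<rbrakk>"
| coprod_elim_eq: "Coprod A B # \<Gamma> \<turnstile> C \<doteq> C' \<Colon> Univ i \<Longrightarrow>
    A # \<Gamma> \<turnstile> c \<doteq> c' \<Colon> subst (InL (Var 0) \<cdot> (\<lambda>k. Var (k + 1))) C \<Longrightarrow>
    B # \<Gamma> \<turnstile> d \<doteq> d' \<Colon> subst (InR (Var 0) \<cdot> (\<lambda>k. Var (k + 1))) C \<Longrightarrow>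
    \<Gamma> \<turnstile> p \<doteq> p' \<Colon> Coprod A B \<Longrightarrow>
    \<Gamma> \<turnstile> IndCoprod C c d p \<doteq> IndCoprod C' c' d' p' \<Colon> C\<lbrakk>p\<rbrakk>"
| coprod_comp1: "Coprod A B # \<Gamma> \<turnstile> C \<Colon> Univ i \<Longrightarrow>
    A # \<Gamma> \<turnstile> c \<Colon> subst (InL (Var 0) \<cdot> (\<lambda>k. Var (k + 1))) C \<Longrightarrow>
    B # \<Gamma> \<turnstile> d \<Colon> subst (InR (Var 0) \<cdot> (\<lambda>k. Var (k + 1))) C \<Longrightarrow>
    \<Gamma> \<turnstile> a \<Colon> A \<Longrightarrow>
    \<Gamma> \<turnstile> IndCoprod C c d (InL a) \<doteq> c\<lbrakk>a\<rbrakk> \<Colon> C\<lbrakk>InL a\<rbrakk>"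
| coprod_comp2: "Coprod A B # \<Gamma> \<turnstile> C \<Colon> Univ i \<Longrightarrow>
    A # \<Gamma> \<turnstile> c \<Colon> subst (InL (Var 0) \<cdot> (\<lambda>k. Var (k + 1))) C \<Longrightarrow>
    B # \<Gamma> \<turnstile> d \<Colon> subst (InR (Var 0) \<cdot> (\<lambda>k. Var (k + 1))) C \<Longrightarrow>
    \<Gamma> \<turnstile> b \<Colon> B \<Longrightarrow>
    \<Gamma> \<turnstile> IndCoprod C c d (InR b) \<doteq> d\<lbrakk>b\<rbrakk> \<Colon> C\<lbrakk>InR b\<rbrakk>"

| empty_form: "\<turnstile> \<Gamma> ctx \<Longrightarrow> \<Gamma> \<turnstile> Empty \<Colon> Univ i"
| empty_elim: "Empty # \<Gamma> \<turnstile> C \<Colon> Univ i \<Longrightarrow> \<Gamma> \<turnstile> p \<Colon> Empty \<Longrightarrow> \<Gamma> \<turnstile> IndEmpty C p \<Colon> C\<lbrakk>p\<rbrakk>"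
| empty_elim_eq: "Empty # \<Gamma> \<turnstile> C \<doteq> C' \<Colon> Univ i \<Longrightarrow> \<Gamma> \<turnstile> p \<doteq> p' \<Colon> Empty \<Longrightarrow>
    \<Gamma> \<turnstile> IndEmpty C p \<doteq> IndEmpty C' p' \<Colon> C\<lbrakk>p\<rbrakk>"

| unit_form: "\<turnstile> \<Gamma> ctx \<Longrightarrow> \<Gamma> \<turnstile> Unit \<Colon> Univ i"
| unit_intro: "\<turnstile> \<Gamma> ctx \<Longrightarrow> \<Gamma> \<turnstile> Star \<Colon> Unit"
| unit_elim: "Unit # \<Gamma> \<turnstile> C \<Colon> Univ i \<Longrightarrow> \<Gamma> \<turnstile> c \<Colon> C\<lbrakk>Star\<rbrakk> \<Longrightarrow> \<Gamma> \<turnstile> p \<Colon> Unit \<Longrightarrow>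
    \<Gamma> \<turnstile> IndUnit C c p \<Colon> C\<lbrakk>p\<rbrakk>"
| unit_elim_eq: "Unit # \<Gamma> \<turnstile> C \<doteq> C' \<Colon> Univ i \<Longrightarrow> \<Gamma> \<turnstile> c \<doteq> c' \<Colon> C\<lbrakk>Star\<rbrakk> \<Longrightarrow> \<Gamma> \<turnstile> p \<doteq> p' \<Colon> Unit \<Longrightarrow>
    \<Gamma> \<turnstile> IndUnit C c p \<doteq> IndUnit C' c' p' \<Colon> C\<lbrakk>p\<rbrakk>"
| unit_comp: "Unit # \<Gamma> \<turnstile> C \<Colon> Univ i \<Longrightarrow> \<Gamma> \<turnstile> c \<Colon> C\<lbrakk>Star\<rbrakk> \<Longrightarrow>
    \<Gamma> \<turnstile> IndUnit C c Star \<doteq> c \<Colon> C\<lbrakk>Star\<rbrakk>"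

| nat_form: "\<turnstile> \<Gamma> ctx \<Longrightarrow> \<Gamma> \<turnstile> NatT \<Colon> Univ i"
| nat_intro1: "\<turnstile> \<Gamma> ctx \<Longrightarrow> \<Gamma> \<turnstile> Zero \<Colon> NatT"
| nat_intro2: "\<Gamma> \<turnstile> m \<Colon> NatT \<Longrightarrow> \<Gamma> \<turnstile> Succ m \<Colon> NatT"
| nat_intro2_eq: "\<Gamma> \<turnstile> m \<doteq> m' \<Colon> NatT \<Longrightarrow> \<Gamma> \<turnstile> Succ m \<doteq> Succ m' \<Colon> NatT"
| nat_elim: "NatT # \<Gamma> \<turnstile> C \<Colon> Univ i \<Longrightarrow> \<Gamma> \<turnstile> z \<Colon> C\<lbrakk>Zero\<rbrakk> \<Longrightarrow>
    C # NatT # \<Gamma> \<turnstile> s \<Colon> subst (Succ (Var 1) \<cdot> (\<lambda>k. Var (k + 2))) C \<Longrightarrow>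
    \<Gamma> \<turnstile> m \<Colon> NatT \<Longrightarrow>
    \<Gamma> \<turnstile> IndNat C z s m \<Colon> C\<lbrakk>m\<rbrakk>"
| nat_elim_eq: "NatT # \<Gamma> \<turnstile> C \<Colon> Univ i \<Longrightarrow> NatT # \<Gamma> \<turnstile> C \<doteq> C' \<Colon> Univ i \<Longrightarrow> \<Gamma> \<turnstile> z \<doteq> z' \<Colon> C\<lbrakk>Zero\<rbrakk> \<Longrightarrow>
    C # NatT # \<Gamma> \<turnstile> s \<doteq> s' \<Colon> subst (Succ (Var 1) \<cdot> (\<lambda>k. Var (k + 2))) C \<Longrightarrow>
    \<Gamma> \<turnstile> m \<doteq> m' \<Colon> NatT \<Longrightarrow>
    \<Gamma> \<turnstile> IndNat C z s m \<doteq> IndNat C' z' s' m' \<Colon> C\<lbrakk>m\<rbrakk>"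
| nat_comp1: "NatT # \<Gamma> \<turnstile> C \<Colon> Univ i \<Longrightarrow> \<Gamma> \<turnstile> z \<Colon> C\<lbrakk>Zero\<rbrakk> \<Longrightarrow>
    C # NatT # \<Gamma> \<turnstile> s \<Colon> subst (Succ (Var 1) \<cdot> (\<lambda>k. Var (k + 2))) C \<Longrightarrow>
    \<Gamma> \<turnstile> IndNat C z s Zero \<doteq> z \<Colon> C\<lbrakk>Zero\<rbrakk>"
| nat_comp2: "NatT # \<Gamma> \<turnstile> C \<Colon> Univ i \<Longrightarrow> \<Gamma> \<turnstile> z \<Colon> C\<lbrakk>Zero\<rbrakk> \<Longrightarrow>
    C # NatT # \<Gamma> \<turnstile> s \<Colon> subst (Succ (Var 1) \<cdot> (\<lambda>k. Var (k + 2))) C \<Longrightarrow>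
    \<Gamma> \<turnstile> m \<Colon> NatT \<Longrightarrow>
    \<Gamma> \<turnstile> IndNat C z s (Succ m) \<doteq> subst (IndNat C z s m \<cdot> m \<cdot> Var) s \<Colon> C\<lbrakk>Succ m\<rbrakk>"

| id_form: "\<Gamma> \<turnstile> A \<Colon> Univ i \<Longrightarrow> \<Gamma> \<turnstile> a \<Colon> A \<Longrightarrow> \<Gamma> \<turnstile> b \<Colon> A \<Longrightarrow> \<Gamma> \<turnstile> Id A a b \<Colon> Univ i"
| id_form_eq: "\<Gamma> \<turnstile> A \<doteq> A' \<Colon> Univ i \<Longrightarrow> \<Gamma> \<turnstile> a \<doteq> a' \<Colon> A \<Longrightarrow> \<Gamma> \<turnstile> b \<doteq> b' \<Colon> A \<Longrightarrow>
    \<Gamma> \<turnstile> Id A a b \<doteq> Id A' a' b' \<Colon> Univ i"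
| id_intro: "\<Gamma> \<turnstile> A \<Colon> Univ i \<Longrightarrow> \<Gamma> \<turnstile> a \<Colon> A \<Longrightarrow> \<Gamma> \<turnstile> Refl a \<Colon> Id A a a"
| id_intro_eq: "\<Gamma> \<turnstile> A \<Colon> Univ i \<Longrightarrow> \<Gamma> \<turnstile> a \<doteq> a' \<Colon> A \<Longrightarrow> \<Gamma> \<turnstile> Refl a \<doteq> Refl a' \<Colon> Id A a a"
| id_elim: "Id A\<up>\<up> (Var 1) (Var 0) # A\<up> # A # \<Gamma> \<turnstile> C \<Colon> Univ i \<Longrightarrow>
    A # \<Gamma> \<turnstile> c \<Colon> subst (Refl (Var 0) \<cdot> Var 0 \<cdot> Var 0 \<cdot> (\<lambda>k. Var (k + 1))) C \<Longrightarrow>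
    \<Gamma> \<turnstile> a \<Colon> A \<Longrightarrow> \<Gamma> \<turnstile> b \<Colon> A \<Longrightarrow> \<Gamma> \<turnstile> p \<Colon> Id A a b \<Longrightarrow>
    \<Gamma> \<turnstile> IndId C c a b p \<Colon> subst (p \<cdot> b \<cdot> a \<cdot> Var) C"
| id_elim_eq: "Id A\<up>\<up> (Var 1) (Var 0) # A\<up> # A # \<Gamma> \<turnstile> C \<doteq> C' \<Colon> Univ i \<Longrightarrow>
    A # \<Gamma> \<turnstile> c \<doteq> c' \<Colon> subst (Refl (Var 0) \<cdot> Var 0 \<cdot> Var 0 \<cdot> (\<lambda>k. Var (k + 1))) C \<Longrightarrow>
    \<Gamma> \<turnstile> a \<doteq> a' \<Colon> A \<Longrightarrow> \<Gamma> \<turnstile> b \<doteq> b' \<Colon> A \<Longrightarrow> \<Gamma> \<turnstile> p \<doteq> p' \<Colon> Id A a b \<Longrightarrow>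
    \<Gamma> \<turnstile> IndId C c a b p \<doteq> IndId C' c' a' b' p' \<Colon> subst (p \<cdot> b \<cdot> a \<cdot> Var) C"
| id_comp: "Id A\<up>\<up> (Var 1) (Var 0) # A\<up> # A # \<Gamma> \<turnstile> C \<Colon> Univ i \<Longrightarrow>
    A # \<Gamma> \<turnstile> c \<Colon> subst (Refl (Var 0) \<cdot> Var 0 \<cdot> Var 0 \<cdot> (\<lambda>k. Var (k + 1))) C \<Longrightarrow>
    \<Gamma> \<turnstile> a \<Colon> A \<Longrightarrow>
    \<Gamma> \<turnstile> IndId C c a a (Refl a) \<doteq> c\<lbrakk>a\<rbrakk> \<Colon> subst (Refl a \<cdot> a \<cdot> a \<cdot> Var) C"

| funext: "\<Gamma> \<turnstile> f \<Colon> Pi A B \<Longrightarrow> \<Gamma> \<turnstile> g \<Colon> Pi A B \<Longrightarrow>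
    \<Gamma> \<turnstile> Funext f g \<Colon> is_equiv (Id (Pi A B) f g) (Homotopy A B f g) (happly A B f g)"
| funext_eq: "\<Gamma> \<turnstile> f \<doteq> f' \<Colon> Pi A B \<Longrightarrow> \<Gamma> \<turnstile> g \<doteq> g' \<Colon> Pi A B \<Longrightarrow>
    \<Gamma> \<turnstile> Funext f g \<doteq> Funext f' g' \<Colon>
      is_equiv (Id (Pi A B) f g) (Homotopy A B f g) (happly A B f g)"

| univalence: "\<Gamma> \<turnstile> A \<Colon> Univ i \<Longrightarrow> \<Gamma> \<turnstile> B \<Colon> Univ i \<Longrightarrow>
    \<Gamma> \<turnstile> Univalence i A B \<Colon> is_equiv (Id (Univ i) A B) (Equiv A B) (idtoeqv i A B)"
| univalence_eq: "\<Gamma> \<turnstile> A \<doteq> A' \<Colon> Univ i \<Longrightarrow> \<Gamma> \<turnstile> B \<doteq> B' \<Colon> Univ i \<Longrightarrow>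
    \<Gamma> \<turnstile> Univalence i A B \<doteq> Univalence i A' B' \<Colon>
      is_equiv (Id (Univ i) A B) (Equiv A B) (idtoeqv i A B)"

| trunc_form: "\<Gamma> \<turnstile> A \<Colon> Univ i \<Longrightarrow> \<Gamma> \<turnstile> Trunc A \<Colon> Univ i"
| trunc_form_eq: "\<Gamma> \<turnstile> A \<doteq> A' \<Colon> Univ i \<Longrightarrow> \<Gamma> \<turnstile> Trunc A \<doteq> Trunc A' \<Colon> Univ i"
| trunc_intro: "\<Gamma> \<turnstile> a \<Colon> A \<Longrightarrow> \<Gamma> \<turnstile> TruncIn a \<Colon> Trunc A"
| trunc_intro_eq: "\<Gamma> \<turnstile> a \<doteq> a' \<Colon> A \<Longrightarrow> \<Gamma> \<turnstile> TruncIn a \<doteq> TruncIn a' \<Colon> Trunc A"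
| trunc_path: "\<Gamma> \<turnstile> a \<Colon> Trunc A \<Longrightarrow> \<Gamma> \<turnstile> b \<Colon> Trunc A \<Longrightarrow> \<Gamma> \<turnstile> TruncPath a b \<Colon> Id (Trunc A) a b"
| trunc_path_eq: "\<Gamma> \<turnstile> a \<doteq> a' \<Colon> Trunc A \<Longrightarrow> \<Gamma> \<turnstile> b \<doteq> b' \<Colon> Trunc A \<Longrightarrow>
    \<Gamma> \<turnstile> TruncPath a b \<doteq> TruncPath a' b' \<Colon> Id (Trunc A) a b"
| trunc_rec: "\<Gamma> \<turnstile> B \<Colon> Univ i \<Longrightarrow> \<Gamma> \<turnstile> h \<Colon> is_prop B \<Longrightarrow> \<Gamma> \<turnstile> f \<Colon> A \<rightarrow> B \<Longrightarrow> \<Gamma> \<turnstile> t \<Colon> Trunc A \<Longrightarrow>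
    \<Gamma> \<turnstile> TruncRec B h f t \<Colon> B"
| trunc_rec_eq: "\<Gamma> \<turnstile> B \<doteq> B' \<Colon> Univ i \<Longrightarrow> \<Gamma> \<turnstile> h \<doteq> h' \<Colon> is_prop B \<Longrightarrow> \<Gamma> \<turnstile> f \<doteq> f' \<Colon> A \<rightarrow> B \<Longrightarrow>
    \<Gamma> \<turnstile> t \<doteq> t' \<Colon> Trunc A \<Longrightarrow>
    \<Gamma> \<turnstile> TruncRec B h f t \<doteq> TruncRec B' h' f' t' \<Colon> B"
| trunc_comp: "\<Gamma> \<turnstile> B \<Colon> Univ i \<Longrightarrow> \<Gamma> \<turnstile> h \<Colon> is_prop B \<Longrightarrow> \<Gamma> \<turnstile> f \<Colon> A \<rightarrow> B \<Longrightarrow> \<Gamma> \<turnstile> a \<Colon> A \<Longrightarrow>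
    \<Gamma> \<turnstile> TruncRec B h f (TruncIn a) \<doteq> App f a \<Colon> B"

definition inhabited :: "tm \<Rightarrow> bool" where
  "inhabited T \<longleftrightarrow> (\<exists>t. [] \<turnstile> t \<Colon> T)"

section \<open>Sets cover, excluded middle\<close>

definition Iff :: "tm \<Rightarrow> tm \<Rightarrow> tm" where
  "Iff A B = (A \<rightarrow> B) \<otimes> (B \<rightarrow> A)"

definition is_contr :: "tm \<Rightarrow> tm" where
  "is_contr A = Sig A (Pi A\<up> (Id A\<up>\<up> (Var 1) (Var 0)))"

definition is_set :: "tm \<Rightarrow> tm" where
  "is_set A = Pi A (Pi A\<up> (is_prop (Id A\<up>\<up> (Var 1) (Var 0))))"

definition fibre :: "tm \<Rightarrow> tm \<Rightarrow> tm \<Rightarrow> tm \<Rightarrow> tm" where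
  "fibre A B f b = Sig A (Id B\<up> (App f\<up> (Var 0)) b\<up>)"

text \<open>\<open>f : A \<rightarrow> B\<close> is \<open>(-1)\<close>-connected: the \<open>(-1)\<close>-truncation of each fibre is contractible.\<close>

definition is_conn_map :: "tm \<Rightarrow> tm \<Rightarrow> tm \<Rightarrow> tm" where
  "is_conn_map A B f = Pi B (is_contr (Trunc (fibre A\<up> B\<up> f\<up> (Var 0))))"

text \<open>\<open>\<Pi>(X:U). \<parallel>\<Sigma>(S:U). is-set S \<times> \<Sigma>(f:S\<rightarrow>X). is-conn f\<parallel>\<close>\<close>

definition sets_cover :: "nat \<Rightarrow> tm" where
  "sets_cover n =
     Pi (Univ n)
       (Trunc (Sig (Univ n)
         (is_set (Var 0) \<otimes> Sig (Var 0 \<rightarrow> Var 1) (is_conn_map (Var 1) (Var 2) (Var 0)))))"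

definition LEM :: "nat \<Rightarrow> tm" where
  "LEM n = Pi (Univ n) (is_prop (Var 0) \<rightarrow> Coprod (Var 0) (Var 0 \<rightarrow> Empty))"

section \<open>Reflective subuniverses and localization\<close>

definition PropU :: "nat \<Rightarrow> tm" where
  "PropU n = Sig (Univ n) (is_prop (Var 0))"

definition fst_tm :: "tm \<Rightarrow> tm \<Rightarrow> tm" where
  "fst_tm A p = IndSig A\<up> (Var 1) p"

text \<open>The type underlying the mere proposition \<open>P X\<close>, for \<open>P : U \<rightarrow> Prop\<close>.\<close>

definition holds :: "nat \<Rightarrow> tm \<Rightarrow> tm \<Rightarrow> tm" where
  "holds n P X = fst_tm (Univ n) (App P X)"

text \<open>Precomposition \<open>(B \<rightarrow> X) \<rightarrow> (A \<rightarrow> X)\<close> with \<open>g : A \<rightarrow> B\<close>.\<close>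

definition precomp :: "tm \<Rightarrow> tm \<Rightarrow> tm \<Rightarrow> tm \<Rightarrow> tm" where
  "precomp A B g X = Lam (B \<rightarrow> X) (Lam A\<up> (App (Var 1) (App g\<up>\<up> (Var 0))))"

definition map_local :: "tm \<Rightarrow> tm \<Rightarrow> tm \<Rightarrow> tm \<Rightarrow> tm" where
  "map_local A B g X = is_equiv (B \<rightarrow> X) (A \<rightarrow> X) (precomp A B g X)"

text \<open>
  \<open>\<Sigma>(P : U\<rightarrow>Prop). \<Sigma>(L : U\<rightarrow>U). \<Sigma>(\<eta> : \<Pi>(X:U). X \<rightarrow> L X).\<close>
  \<open>(\<Pi>(X:U). P(L X)) \<times> (\<Pi>(X Y:U). P Y \<rightarrow> map-local (X, L X, \<eta> X) Y)\<close>
\<close>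

definition refl_subuniverse :: "nat \<Rightarrow> tm" where
  "refl_subuniverse n =
     Sig (Univ n \<rightarrow> PropU n)
      (Sig (Univ n \<rightarrow> Univ n)
        (Sig (Pi (Univ n) (Var 0 \<rightarrow> App (Var 1) (Var 0)))
          (Pi (Univ n) (holds n (Var 3) (App (Var 2) (Var 0)))
           \<otimes> Pi (Univ n) (Pi (Univ n)
               (holds n (Var 4) (Var 0) \<rightarrow>
                map_local (Var 1) (App (Var 3) (Var 1)) (App (Var 2) (Var 1)) (Var 0))))))"

definition is_local :: "nat \<Rightarrow> tm \<Rightarrow> tm \<Rightarrow> tm" where
  "is_local n L X = holds n (fst_tm (Univ n \<rightarrow> PropU n) L) X"

text \<open>\<open>X\<close> is local for the family \<open>f : \<Pi>(i:I). A i \<rightarrow> B i\<close>, where \<open>A, B : I \<rightarrow> U\<close>.\<close>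

definition family_local :: "tm \<Rightarrow> tm \<Rightarrow> tm \<Rightarrow> tm \<Rightarrow> tm \<Rightarrow> tm" where
  "family_local I A B f X =
     Pi I (map_local (App A\<up> (Var 0)) (App B\<up> (Var 0)) (App f\<up> (Var 0)) X\<up>)"

text \<open>
  \<open>\<Sigma>(I:U). \<Sigma>(A:I\<rightarrow>U). \<Sigma>(B:I\<rightarrow>U). \<Sigma>(f:\<Pi>(i:I). A i \<rightarrow> B i). \<Pi>(X:U). is-local L X \<longleftrightarrow> f-local X\<close>
\<close>

definition accessible :: "nat \<Rightarrow> tm \<Rightarrow> tm" where
  "accessible n L =
     Sig (Univ n)
      (Sig (Var 0 \<rightarrow> Univ n)
        (Sig (Var 1 \<rightarrow> Univ n)
          (Sig (Pi (Var 2) (App (Var 2) (Var 0) \<rightarrow> App (Var 1) (Var 0)))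
            (Pi (Univ n)
              (Iff (is_local n (shift 5 L) (Var 0))
                   (family_local (Var 4) (Var 3) (Var 2) (Var 1) (Var 0)))))))"

text \<open>
  The type of presentations of \<open>L\<close> by a single map:
  \<open>\<Sigma>(A:U). \<Sigma>(B:U). \<Sigma>(g:A\<rightarrow>B). \<Pi>(X:U). is-local L X \<longleftrightarrow> map-local g X\<close>
\<close>

definition single_map_presentation :: "nat \<Rightarrow> tm \<Rightarrow> tm" where
  "single_map_presentation n L =
     Sig (Univ n)
      (Sig (Univ n)
        (Sig (Var 1 \<rightarrow> Var 0)
          (Pi (Univ n)
            (Iff (is_local n (shift 4 L) (Var 0))
                 (map_local (Var 3) (Var 2) (Var 1) (Var 0))))))"

end

theory Submission
  imports Defs "HOL-Library.Monad_Syntax"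
begin

text \<open>
  Let \<open>f : \<Pi>(i:I). A i \<rightarrow> B i\<close> present \<open>L\<close> and let \<open>e : S \<rightarrow> I\<close> be a cover of \<open>I\<close> by a set. Being an equivalence
  is a proposition, so the family \<open>f (e s)\<close> indexed by \<open>S\<close> has the same local types. The single map is its
  sum \<open>g : (\<Sigma>(s:S). A (e s)) \<rightarrow> (\<Sigma>(s:S). B (e s))\<close>, since precomposition with \<open>g\<close> is the product over \<open>S\<close> of
  the precompositions with the \<open>f (e s)\<close>. A product of equivalences is an equivalence. Conversely, if \<open>X\<close>
  has a point \<open>x\<close>, then, equality in \<open>S\<close> being decidable, a map \<open>B (e s) \<rightarrow> X\<close> extends by \<open>x\<close> to the whole
  sum, and this exhibits precomposition with \<open>f (e s)\<close> as a retract of precomposition with \<open>g\<close>. If \<open>X\<close> has no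
  point, then \<open>X\<close> equals the empty type, which is local by assumption. Excluded middle for \<open>\<parallel>X\<parallel>\<close> decides
  between the two cases.
\<close>

subsection \<open>Substitution calculus\<close>

text \<open>The goal asserts that a derivation between raw terms exists, so the informal argument
  has to become a closed proof term. Deriving such a term rule by rule is out of reach; it is
  written with named variables and accepted by a type checker whose soundness is proved once, from
  admissible substitution and from congruence of substitution into types. Two points shape the
  argument inside the type theory. An equivalence is a pair of a right and a left inverse, so each
  half passes through a product or a retract separately, with no coherence between them. And that
  \<open>S\<close> is a set enters twice: it makes \<open>s = t\<close> a proposition, which
  excluded middle can decide, and it makes every loop at \<open>s\<close> reflexivity, so that
  extending a map to the sum and restricting it again gives back the map. Equalities of functions
  are obtained pointwise by function extensionality; univalence reduces an arbitrary equivalence to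
  an identity map and identifies an uninhabited type with the empty one. The conclusion is truncated
  because the cover is only merely given.\<close>

lemma upr_simps [simp]: "upr \<xi> 0 = 0" "upr \<xi> (Suc k) = Suc (\<xi> k)"
  by (simp_all add: upr_def)

lemma scons_simps [simp]: "(a \<cdot> \<sigma>) 0 = a" "(a \<cdot> \<sigma>) (Suc k) = \<sigma> k"
  by (simp_all add: scons_def)

lemma ups_simps [simp]: "ups \<sigma> 0 = Var 0" "ups \<sigma> (Suc k) = (\<sigma> k)\<up>"
  by (simp_all add: ups_def)

lemma upr_comp: "upr (\<xi> \<circ> \<zeta>) = upr \<xi> \<circ> upr \<zeta>"
proof
  show "upr (\<xi> \<circ> \<zeta>) k = (upr \<xi> \<circ> upr \<zeta>) k" for k by (cases k) simp_all
qed

lemma ups_comp_ren: "ups (\<sigma> \<circ> \<xi>) = ups \<sigma> \<circ> upr \<xi>"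
proof
  show "ups (\<sigma> \<circ> \<xi>) k = (ups \<sigma> \<circ> upr \<xi>) k" for k by (cases k) simp_all
qed

lemma ren_ren: "ren \<xi> (ren \<zeta> t) = ren (\<xi> \<circ> \<zeta>) t"
  by (induction t arbitrary: \<xi> \<zeta>) (simp_all add: upr_comp)

lemma subst_ren: "subst \<sigma> (ren \<xi> t) = subst (\<sigma> \<circ> \<xi>) t"
  by (induction t arbitrary: \<sigma> \<xi>) (simp_all add: ups_comp_ren)

lemma ups_ren_comp: "ups (\<lambda>k. ren \<xi> (\<sigma> k)) = (\<lambda>k. ren (upr \<xi>) (ups \<sigma> k))"
proof
  have "Suc \<circ> \<xi> = upr \<xi> \<circ> Suc" by auto
  then show "ups (\<lambda>k. ren \<xi> (\<sigma> k)) k = ren (upr \<xi>) (ups \<sigma> k)" for k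
    by (cases k) (simp_all add: ren_ren)
qed

lemma ren_subst: "ren \<xi> (subst \<sigma> t) = subst (\<lambda>k. ren \<xi> (\<sigma> k)) t"
  by (induction t arbitrary: \<sigma> \<xi>) (simp_all add: ups_ren_comp)

lemma ups_subst_comp: "ups (\<lambda>k. subst \<tau> (\<sigma> k)) = (\<lambda>k. subst (ups \<tau>) (ups \<sigma> k))"
proof
  have "ups \<tau> \<circ> Suc = (\<lambda>k. (\<tau> k)\<up>)" by auto
  then show "ups (\<lambda>k. subst \<tau> (\<sigma> k)) k = subst (ups \<tau>) (ups \<sigma> k)" for k
    by (cases k) (simp_all add: ren_subst subst_ren)
qed

lemma subst_subst: "subst \<tau> (subst \<sigma> t) = subst (\<lambda>k. subst \<tau> (\<sigma> k)) t"
  by (induction t arbitrary: \<sigma> \<tau>) (simp_all add: ups_subst_comp)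

lemma ups_Var [simp]: "ups Var = Var"
proof
  show "ups Var k = Var k" for k by (cases k) simp_all
qed

lemma subst_Var [simp]: "subst Var t = t"
  by (induction t) simp_all

lemma ren_eq_subst: "ren \<xi> t = subst (\<lambda>k. Var (\<xi> k)) t"
  using subst_ren[of Var \<xi> t] by (simp add: comp_def)

lemma subst_cong: "(\<And>k. \<sigma> k = \<tau> k) \<Longrightarrow> subst \<sigma> t = subst \<tau> t"
  by (metis ext)

lemma subst_lift: "subst (ups \<sigma>) t\<up> = (subst \<sigma> t)\<up>"
  by (simp add: subst_ren ren_subst comp_def)

lemma lift_inst [simp]: "(t\<up>)\<lbrakk>a\<rbrakk> = t"
  by (simp add: subst_ren comp_def)

lemma subst_scons: "subst \<tau> (subst (a \<cdot> \<sigma>) t) = subst (subst \<tau> a \<cdot> (\<lambda>k. subst \<tau> (\<sigma> k))) t"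
  unfolding subst_subst by (rule subst_cong) (simp add: scons_def split: nat.split)

lemma subst_scons_ups: "subst (a \<cdot> \<sigma>) (subst (ups \<tau>) t) = subst (a \<cdot> (\<lambda>k. subst \<sigma> (\<tau> k))) t"
  unfolding subst_subst
  by (rule subst_cong) (simp add: scons_def ups_def subst_ren comp_def split: nat.split)

lemma subst_inst: "subst \<sigma> (B\<lbrakk>a\<rbrakk>) = (subst (ups \<sigma>) B)\<lbrakk>subst \<sigma> a\<rbrakk>"
  by (simp add: subst_scons subst_scons_ups)

lemma subst_inst2: "subst \<sigma> (subst (b \<cdot> a \<cdot> Var) t)
    = subst (subst \<sigma> b \<cdot> subst \<sigma> a \<cdot> Var) (subst (ups (ups \<sigma>)) t)"
  unfolding subst_subst
  by (rule subst_cong) (simp add: scons_def ups_def ren_ren subst_ren comp_def split: nat.split)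

lemma subst_inst3: "subst \<sigma> (subst (c \<cdot> b \<cdot> a \<cdot> Var) t)
    = subst (subst \<sigma> c \<cdot> subst \<sigma> b \<cdot> subst \<sigma> a \<cdot> Var) (subst (ups (ups (ups \<sigma>))) t)"
  unfolding subst_subst
  by (rule subst_cong) (simp add: scons_def ups_def ren_ren subst_ren comp_def split: nat.split)

lemma subst_motive1: "subst (ups \<sigma>) (subst (a \<cdot> (\<lambda>k. Var (k + 1))) C)
    = subst (subst (ups \<sigma>) a \<cdot> (\<lambda>k. Var (k + 1))) (subst (ups \<sigma>) C)"
  unfolding subst_subst
  by (rule subst_cong) (simp add: scons_def ups_def ren_eq_subst subst_subst comp_def split: nat.split)

lemma subst_motive2: "subst (ups (ups \<sigma>)) (subst (a \<cdot> (\<lambda>k. Var (k + 2))) C)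
    = subst (subst (ups (ups \<sigma>)) a \<cdot> (\<lambda>k. Var (k + 2))) (subst (ups \<sigma>) C)"
  unfolding subst_subst
  by (rule subst_cong) (simp add: scons_def ups_def ren_eq_subst subst_subst comp_def numeral_2_eq_2 split: nat.split)

lemma subst_motive3: "subst (ups \<sigma>) (subst (c \<cdot> b \<cdot> a \<cdot> (\<lambda>k. Var (k + 1))) C)
    = subst (subst (ups \<sigma>) c \<cdot> subst (ups \<sigma>) b \<cdot> subst (ups \<sigma>) a \<cdot> (\<lambda>k. Var (k + 1))) (subst (ups (ups (ups \<sigma>))) C)"
  unfolding subst_subst
  by (rule subst_cong) (simp add: scons_def ups_def ren_eq_subst subst_subst comp_def split: nat.split)

text \<open>The motive equations are kept in two forms, because simplification turns
  \<open>k + 1\<close> and \<open>k + 2\<close> into successors and goals arise on both sides of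
  that rewriting.\<close>

lemmas subst_commute = subst_inst subst_inst2 subst_inst3 subst_motive1 subst_motive2 subst_motive3 subst_lift
  subst_motive1[simplified] subst_motive2[simplified] subst_motive3[simplified]

lemma ups_2 [simp]: "ups \<sigma> 2 = (\<sigma> 1)\<up>"
  using ups_simps(2)[of \<sigma> 1] by (simp add: numeral_2_eq_2)

section \<open>Substitution commutes with the derived type formers\<close>

lemma subst_Fun [simp]: "subst \<sigma> (A \<rightarrow> B) = subst \<sigma> A \<rightarrow> subst \<sigma> B"
  by (simp add: Fun_def subst_lift)

lemma subst_Prod [simp]: "subst \<sigma> (A \<otimes> B) = subst \<sigma> A \<otimes> subst \<sigma> B"
  by (simp add: Prod_def subst_lift)

lemma subst_is_prop [simp]: "subst \<sigma> (is_prop A) = is_prop (subst \<sigma> A)"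
  by (simp add: is_prop_def subst_lift)

lemma subst_is_equiv [simp]: "subst \<sigma> (is_equiv A B f) = is_equiv (subst \<sigma> A) (subst \<sigma> B) (subst \<sigma> f)"
  by (simp add: is_equiv_def subst_lift)

lemma subst_Equiv [simp]: "subst \<sigma> (Equiv A B) = Equiv (subst \<sigma> A) (subst \<sigma> B)"
  by (simp add: Equiv_def subst_lift)

lemma subst_id_equiv [simp]: "subst \<sigma> (id_equiv A) = id_equiv (subst \<sigma> A)"
  by (simp add: id_equiv_def Let_def)

lemma subst_idtoeqv [simp]: "subst \<sigma> (idtoeqv i A B) = idtoeqv i (subst \<sigma> A) (subst \<sigma> B)"
  by (simp add: idtoeqv_def subst_lift numeral_2_eq_2)

lemma subst_Homotopy [simp]:
  "subst \<sigma> (Homotopy A B f g) = Homotopy (subst \<sigma> A) (subst (ups \<sigma>) B) (subst \<sigma> f) (subst \<sigma> g)"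
  by (simp add: Homotopy_def subst_lift)

text \<open>The abstraction over the path and the three binders of the motive put \<open>A\<close>
  four binders deep, hence the shift by 4; in the reflexivity case there are two, hence the shift by
  2. The codomain \<open>B\<close> has a variable of its own that must stay in place, so for it the
  claim is checked on variables, separating that one from the rest.\<close>

lemma subst_happly [simp]:
  "subst \<sigma> (happly A B f g) = happly (subst \<sigma> A) (subst (ups \<sigma>) B) (subst \<sigma> f) (subst \<sigma> g)"
proof -
  have 1: "subst (ups (ups (ups (ups \<sigma>)))) (shift 4 A) = shift 4 (subst \<sigma> A)"
    by (simp add: subst_ren ren_subst numeral_eq_Suc ren_ren comp_def)
  have 2: "subst (ups (ups \<sigma>)) (shift 2 A) = shift 2 (subst \<sigma> A)"
    by (simp add: subst_ren ren_subst numeral_eq_Suc ren_ren comp_def)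
  have "ups (ups (ups (ups (ups \<sigma>)))) (upr (\<lambda>k. k + 4) k) = ren (upr (\<lambda>k. k + 4)) (ups \<sigma> k)" for k
    by (cases k) (simp_all add: numeral_eq_Suc ren_ren comp_def)
  then have 3: "subst (ups (ups (ups (ups (ups \<sigma>))))) (ren (upr (\<lambda>k. k + 4)) B)
      = ren (upr (\<lambda>k. k + 4)) (subst (ups \<sigma>) B)"
    by (simp add: subst_ren ren_subst comp_def)
  show ?thesis by (simp add: happly_def 1 2[simplified] 3 subst_lift numeral_2_eq_2)
qed

subsection \<open>Admissibility of weakening and substitution\<close>

text \<open>The numbers select \<open>univ_intro\<close> and everything from \<open>pi_form\<close>
  on. The rules left out concern contexts, variables, conversion, equality as an equivalence
  relation and cumulativity; most of them fit goals of every shape and would defeat a uniform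
  treatment by the head symbol.\<close>

lemmas structural_rules = wf_ctx_has_type_eq_tm.intros(9,12-)[simplified] wf_ctx_has_type_eq_tm.intros(9,12-)

text \<open>
  One induction serves both: \<open>S \<Delta> \<sigma> \<Gamma>\<close> is any class of well-typed substitutions that can be pushed
  under binders. Renamings form such a class outright; general substitutions do so by weakening.
\<close>

locale substitution_class =
  fixes S :: "tm list \<Rightarrow> (nat \<Rightarrow> tm) \<Rightarrow> tm list \<Rightarrow> bool"
  assumes S_ctx: "S \<Delta> \<sigma> \<Gamma> \<Longrightarrow> \<turnstile> \<Delta> ctx"
    and S_var: "S \<Delta> \<sigma> \<Gamma> \<Longrightarrow> k < length \<Gamma> \<Longrightarrow> \<Delta> \<turnstile> \<sigma> k \<Colon> subst \<sigma> (shift (Suc k) (\<Gamma> ! k))"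
    and S_ext: "S \<Delta> \<sigma> \<Gamma> \<Longrightarrow> \<Delta> \<turnstile> subst \<sigma> A \<Colon> Univ i \<Longrightarrow> S (subst \<sigma> A # \<Delta>) (ups \<sigma>) (A # \<Gamma>)"
begin

text \<open>A rule such as \<open>pi_intro\<close> has no premise saying that the domain is a type.
  Going under its binder by \<open>S_ext\<close> nevertheless needs the substituted domain to be
  typed, so the induction carries this information for every entry of the context.\<close>

fun ctx_stable :: "tm list \<Rightarrow> bool" where
  "ctx_stable [] = True"
| "ctx_stable (A # \<Gamma>) = (ctx_stable \<Gamma> \<and> (\<exists>i. \<forall>\<Delta> \<sigma>. S \<Delta> \<sigma> \<Gamma> \<longrightarrow> \<Delta> \<turnstile> subst \<sigma> A \<Colon> Univ i))"

definition stable_type :: "tm list \<Rightarrow> tm \<Rightarrow> tm \<Rightarrow> bool" where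
  "stable_type \<Gamma> a A \<longleftrightarrow> ctx_stable \<Gamma> \<and> (\<forall>\<Delta> \<sigma>. S \<Delta> \<sigma> \<Gamma> \<longrightarrow> \<Delta> \<turnstile> subst \<sigma> a \<Colon> subst \<sigma> A)"

definition stable_eq :: "tm list \<Rightarrow> tm \<Rightarrow> tm \<Rightarrow> tm \<Rightarrow> bool" where
  "stable_eq \<Gamma> a b A \<longleftrightarrow> ctx_stable \<Gamma> \<and> (\<forall>\<Delta> \<sigma>. S \<Delta> \<sigma> \<Gamma> \<longrightarrow> \<Delta> \<turnstile> subst \<sigma> a \<doteq> subst \<sigma> b \<Colon> subst \<sigma> A)"

lemma S_under:
  "ctx_stable (A # \<Gamma>) \<Longrightarrow> S \<Delta> \<sigma> \<Gamma> \<Longrightarrow> S (subst \<sigma> A # \<Delta>) (ups \<sigma>) (A # \<Gamma>)"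
  using S_ext by (metis ctx_stable.simps(2))

lemma stable_typeD: "stable_type \<Gamma> a A \<Longrightarrow> S \<Delta> \<sigma> \<Gamma> \<Longrightarrow> \<Delta> \<turnstile> subst \<sigma> a \<Colon> subst \<sigma> A"
  by (simp add: stable_type_def)

lemma stable_eqD: "stable_eq \<Gamma> a b A \<Longrightarrow> S \<Delta> \<sigma> \<Gamma> \<Longrightarrow> \<Delta> \<turnstile> subst \<sigma> a \<doteq> subst \<sigma> b \<Colon> subst \<sigma> A"
  by (simp add: stable_eq_def)

lemma stable_typeD1:
  "stable_type (B # \<Gamma>) a A \<Longrightarrow> S \<Delta> \<sigma> \<Gamma> \<Longrightarrow> subst \<sigma> B # \<Delta> \<turnstile> subst (ups \<sigma>) a \<Colon> subst (ups \<sigma>) A"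
  using S_under stable_type_def by blast

lemma stable_eqD1:
  "stable_eq (B # \<Gamma>) a b A \<Longrightarrow> S \<Delta> \<sigma> \<Gamma> \<Longrightarrow>
    subst \<sigma> B # \<Delta> \<turnstile> subst (ups \<sigma>) a \<doteq> subst (ups \<sigma>) b \<Colon> subst (ups \<sigma>) A"
  using S_under stable_eq_def by blast

lemma stable_typeD2:
  "stable_type (C # B # \<Gamma>) a A \<Longrightarrow> S \<Delta> \<sigma> \<Gamma> \<Longrightarrow>
    subst (ups \<sigma>) C # subst \<sigma> B # \<Delta> \<turnstile> subst (ups (ups \<sigma>)) a \<Colon> subst (ups (ups \<sigma>)) A"
  by (meson S_under stable_typeD1 stable_type_def ctx_stable.simps(2))

lemma stable_eqD2:
  "stable_eq (C # B # \<Gamma>) a b A \<Longrightarrow> S \<Delta> \<sigma> \<Gamma> \<Longrightarrow>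
    subst (ups \<sigma>) C # subst \<sigma> B # \<Delta> \<turnstile> subst (ups (ups \<sigma>)) a \<doteq> subst (ups (ups \<sigma>)) b \<Colon> subst (ups (ups \<sigma>)) A"
  by (meson S_under stable_eqD1 stable_eq_def ctx_stable.simps(2))

text \<open>The motive of path induction is the one place with three binders. Fixing the context to
  its shape there lets the substituted entries be rewritten back to lifts of a single type.\<close>

lemma stable_typeD3:
  "stable_type (Id A\<up>\<up> (Var 1) (Var 0) # A\<up> # A # \<Gamma>) a T \<Longrightarrow> S \<Delta> \<sigma> \<Gamma> \<Longrightarrow>
    Id (subst \<sigma> A)\<up>\<up> (Var 1) (Var 0) # (subst \<sigma> A)\<up> # subst \<sigma> A # \<Delta>
      \<turnstile> subst (ups (ups (ups \<sigma>))) a \<Colon> subst (ups (ups (ups \<sigma>))) T"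
  using stable_typeD2[of "Id A\<up>\<up> (Var 1) (Var 0)" "A\<up>" "A # \<Gamma>" a T "subst \<sigma> A # \<Delta>" "ups \<sigma>"] S_under
  by (simp add: stable_type_def subst_lift)

lemma stable_eqD3:
  "stable_eq (Id A\<up>\<up> (Var 1) (Var 0) # A\<up> # A # \<Gamma>) a b T \<Longrightarrow> S \<Delta> \<sigma> \<Gamma> \<Longrightarrow>
    Id (subst \<sigma> A)\<up>\<up> (Var 1) (Var 0) # (subst \<sigma> A)\<up> # subst \<sigma> A # \<Delta>
      \<turnstile> subst (ups (ups (ups \<sigma>))) a \<doteq> subst (ups (ups (ups \<sigma>))) b \<Colon> subst (ups (ups (ups \<sigma>))) T"
  using stable_eqD2[of "Id A\<up>\<up> (Var 1) (Var 0)" "A\<up>" "A # \<Gamma>" a b T "subst \<sigma> A # \<Delta>" "ups \<sigma>"] S_under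
  by (simp add: stable_eq_def subst_lift)

lemmas stableD = stable_typeD3[simplified] stable_eqD3[simplified] stable_typeD stable_eqD stable_typeD1 stable_eqD1 stable_typeD2 stable_eqD2

lemma stable_ctx: "stable_type \<Gamma> a A \<Longrightarrow> ctx_stable \<Gamma>" "stable_eq \<Gamma> a b A \<Longrightarrow> ctx_stable \<Gamma>"
  by (simp_all add: stable_type_def stable_eq_def)

lemma stable_typeI: "ctx_stable \<Gamma> \<Longrightarrow> (\<And>\<Delta> \<sigma>. S \<Delta> \<sigma> \<Gamma> \<Longrightarrow> \<Delta> \<turnstile> subst \<sigma> a \<Colon> subst \<sigma> A) \<Longrightarrow> stable_type \<Gamma> a A"
  by (simp add: stable_type_def)

lemma stable_eqI:
  "ctx_stable \<Gamma> \<Longrightarrow> (\<And>\<Delta> \<sigma>. S \<Delta> \<sigma> \<Gamma> \<Longrightarrow> \<Delta> \<turnstile> subst \<sigma> a \<doteq> subst \<sigma> b \<Colon> subst \<sigma> A) \<Longrightarrow> stable_eq \<Gamma> a b A"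
  by (simp add: stable_eq_def)

text \<open>For a rule that introduces or eliminates a term former, the same rule applies to the
  substituted premises, once instantiation of motives has been commuted with substitution by
  \<open>subst_commute\<close>. The remaining rules, whose conclusions do not determine the premises
  to use, are the separate cases.\<close>

lemma substitution_induct:
  shows "\<turnstile> \<Gamma> ctx \<Longrightarrow> ctx_stable \<Gamma>"
    and "\<Gamma> \<turnstile> a \<Colon> A \<Longrightarrow> stable_type \<Gamma> a A"
    and "\<Gamma> \<turnstile> a \<doteq> b \<Colon> A \<Longrightarrow> stable_eq \<Gamma> a b A"
proof (induction rule: wf_ctx_has_type_eq_tm.inducts)
  case (ctx_ext \<Gamma> A i)
  then show ?case by (auto simp: stable_type_def)
next
  case (vble \<Gamma> k)
  then show ?case by (auto simp: stable_type_def S_var simp del: add_Suc_right)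
next
  case (conv \<Gamma> a A B i)
  then show ?case
    using wf_ctx_has_type_eq_tm.conv unfolding stable_type_def stable_eq_def by (metis subst.simps(2))
next
  case (eq_conv \<Gamma> a b A B i)
  then show ?case
    using wf_ctx_has_type_eq_tm.eq_conv unfolding stable_type_def stable_eq_def by (metis subst.simps(2))
next
  case (eq_refl \<Gamma> a A)
  then show ?case unfolding stable_type_def stable_eq_def using wf_ctx_has_type_eq_tm.eq_refl by blast
next
  case (eq_sym \<Gamma> a b A)
  then show ?case unfolding stable_eq_def using wf_ctx_has_type_eq_tm.eq_sym by blast
next
  case (eq_trans \<Gamma> a b A c)
  then show ?case unfolding stable_eq_def using wf_ctx_has_type_eq_tm.eq_trans by blast
next
  case (univ_cumul \<Gamma> A i)
  then show ?case unfolding stable_type_def using wf_ctx_has_type_eq_tm.univ_cumul by simp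
next
  case (univ_cumul_eq \<Gamma> A B i)
  then show ?case unfolding stable_eq_def using wf_ctx_has_type_eq_tm.univ_cumul_eq by simp
qed (simp | (rule stable_typeI stable_eqI, (auto dest!: stable_ctx)[1], ((simp add: subst_commute)?)[1],
    rule structural_rules; (auto dest: stableD S_ctx simp: subst_commute)[1]))+

end

text \<open>Requiring the two shifted types to be literally equal makes the typing of variables an
  instance of \<open>vble\<close>. No weakening is presupposed, which is why this class can come
  before weakening.\<close>

definition renaming :: "tm list \<Rightarrow> (nat \<Rightarrow> tm) \<Rightarrow> tm list \<Rightarrow> bool" where
  "renaming \<Delta> \<sigma> \<Gamma> \<longleftrightarrow> \<turnstile> \<Delta> ctx \<and> (\<exists>\<xi>. \<sigma> = (\<lambda>k. Var (\<xi> k)) \<and>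
    (\<forall>k<length \<Gamma>. \<xi> k < length \<Delta> \<and> shift (Suc (\<xi> k)) (\<Delta> ! \<xi> k) = ren \<xi> (shift (Suc k) (\<Gamma> ! k))))"

interpretation renaming: substitution_class renaming
proof
  fix \<Delta> \<sigma> \<Gamma> A i
  assume S: "renaming \<Delta> \<sigma> \<Gamma>"
  show "\<turnstile> \<Delta> ctx" using S by (simp add: renaming_def)
  show "\<Delta> \<turnstile> \<sigma> k \<Colon> subst \<sigma> (shift (Suc k) (\<Gamma> ! k))" if "k < length \<Gamma>" for k
    using S that vble unfolding renaming_def by (metis ren_eq_subst)
  assume A: "\<Delta> \<turnstile> subst \<sigma> A \<Colon> Univ i"
  obtain \<xi> where \<xi>: "\<sigma> = (\<lambda>k. Var (\<xi> k))"
    "\<And>k. k < length \<Gamma> \<Longrightarrow> \<xi> k < length \<Delta> \<and> shift (Suc (\<xi> k)) (\<Delta> ! \<xi> k) = ren \<xi> (shift (Suc k) (\<Gamma> ! k))"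
    using S by (auto simp: renaming_def)
  have up: "ups \<sigma> = (\<lambda>k. Var (upr \<xi> k))"
  proof
    show "ups \<sigma> k = Var (upr \<xi> k)" for k by (cases k) (simp_all add: \<xi>(1))
  qed
  have "upr \<xi> k < length (subst \<sigma> A # \<Delta>) \<and>
    shift (Suc (upr \<xi> k)) ((subst \<sigma> A # \<Delta>) ! upr \<xi> k) = ren (upr \<xi>) (shift (Suc k) ((A # \<Gamma>) ! k))"
    if "k < length (A # \<Gamma>)" for k
  proof (cases k)
    case 0
    then show ?thesis by (simp add: \<xi>(1) ren_eq_subst[of \<xi>, symmetric] ren_ren comp_def)
  next
    case (Suc m)
    then have "\<xi> m < length \<Delta>" "shift (Suc (\<xi> m)) (\<Delta> ! \<xi> m) = ren \<xi> (shift (Suc m) (\<Gamma> ! m))"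
      using \<xi>(2) that by auto
    moreover have "shift (Suc (Suc (\<xi> m))) t = ren Suc (shift (Suc (\<xi> m)) t)" for t
      by (simp add: ren_ren comp_def)
    ultimately have "shift (Suc (Suc (\<xi> m))) (\<Delta> ! \<xi> m) = ren Suc (ren \<xi> (shift (Suc m) (\<Gamma> ! m)))"
      by metis
    moreover have "ren Suc (ren \<xi> (shift (Suc m) t)) = ren (upr \<xi>) (shift (Suc (Suc m)) t)" for t
      by (simp add: ren_ren comp_def)
    ultimately show ?thesis using Suc \<open>\<xi> m < length \<Delta>\<close> by (simp add: \<xi>(1) del: add_Suc_right)
  qed
  then show "renaming (subst \<sigma> A # \<Delta>) (ups \<sigma>) (A # \<Gamma>)"
    unfolding renaming_def using up A ctx_ext by blast
qed

lemma renaming_Suc: "\<turnstile> B # \<Gamma> ctx \<Longrightarrow> renaming (B # \<Gamma>) (\<lambda>k. Var (Suc k)) \<Gamma>"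
  unfolding renaming_def by (intro conjI exI[of _ Suc]) (auto simp: ren_ren comp_def)

lemma weakening:
  assumes "\<turnstile> B # \<Gamma> ctx"
  shows "\<Gamma> \<turnstile> a \<Colon> A \<Longrightarrow> B # \<Gamma> \<turnstile> a\<up> \<Colon> A\<up>"
    and "\<Gamma> \<turnstile> a \<doteq> b \<Colon> A \<Longrightarrow> B # \<Gamma> \<turnstile> a\<up> \<doteq> b\<up> \<Colon> A\<up>"
  using renaming.substitution_induct(2,3) renaming_Suc[OF assms] unfolding ren_eq_subst
  by (blast dest: renaming.stable_typeD renaming.stable_eqD)+

definition substitution :: "tm list \<Rightarrow> (nat \<Rightarrow> tm) \<Rightarrow> tm list \<Rightarrow> bool" where
  "substitution \<Delta> \<sigma> \<Gamma> \<longleftrightarrow> \<turnstile> \<Delta> ctx \<and> (\<forall>k<length \<Gamma>. \<Delta> \<turnstile> \<sigma> k \<Colon> subst \<sigma> (shift (Suc k) (\<Gamma> ! k)))"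

interpretation substitution: substitution_class substitution
proof
  fix \<Delta> \<sigma> \<Gamma> A i
  assume S: "substitution \<Delta> \<sigma> \<Gamma>"
  show "\<turnstile> \<Delta> ctx" using S by (simp add: substitution_def)
  show "\<Delta> \<turnstile> \<sigma> k \<Colon> subst \<sigma> (shift (Suc k) (\<Gamma> ! k))" if "k < length \<Gamma>" for k
    using S that by (simp add: substitution_def)
  assume A: "\<Delta> \<turnstile> subst \<sigma> A \<Colon> Univ i"
  then have ctx: "\<turnstile> subst \<sigma> A # \<Delta> ctx" by (rule ctx_ext)
  have "subst \<sigma> A # \<Delta> \<turnstile> ups \<sigma> k \<Colon> subst (ups \<sigma>) (shift (Suc k) ((A # \<Gamma>) ! k))"
    if k: "k < length (A # \<Gamma>)" for k
  proof (cases k)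
    case 0
    show ?thesis using vble[OF ctx, of 0] 0 by (simp add: subst_ren ren_subst comp_def)
  next
    case (Suc m)
    then have "\<Delta> \<turnstile> \<sigma> m \<Colon> subst \<sigma> (shift (Suc m) (\<Gamma> ! m))" using S k by (simp add: substitution_def)
    from weakening(1)[OF ctx this] show ?thesis using Suc
      by (simp add: subst_ren ren_subst comp_def)
  qed
  then show "substitution (subst \<sigma> A # \<Delta>) (ups \<sigma>) (A # \<Gamma>)"
    using ctx by (simp add: substitution_def)
qed

section \<open>Typing and equality of substitution instances\<close>

lemma substitution_type: "\<Gamma> \<turnstile> a \<Colon> A \<Longrightarrow> substitution \<Delta> \<sigma> \<Gamma> \<Longrightarrow> \<Delta> \<turnstile> subst \<sigma> a \<Colon> subst \<sigma> A"
  using substitution.substitution_induct(2) substitution.stable_typeD by blast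

text \<open>That \<open>P\<close> is a type is not a premise; it is recovered from the stability of
  the context, which the induction established along with the typing.\<close>

lemma substitution_head_type:
  "P # \<Gamma> \<turnstile> a \<Colon> A \<Longrightarrow> substitution \<Delta> \<sigma> \<Gamma> \<Longrightarrow> \<exists>i. \<Delta> \<turnstile> subst \<sigma> P \<Colon> Univ i"
  using substitution.substitution_induct(2) substitution.stable_ctx(1) by fastforce

lemma substitution_scons:
  assumes "substitution \<Delta> \<sigma> \<Gamma>" "\<Delta> \<turnstile> a \<Colon> subst \<sigma> A"
  shows "substitution \<Delta> (a \<cdot> \<sigma>) (A # \<Gamma>)"
  unfolding substitution_def
proof (intro conjI allI impI)
  fix k assume "k < length (A # \<Gamma>)"
  then show "\<Delta> \<turnstile> (a \<cdot> \<sigma>) k \<Colon> subst (a \<cdot> \<sigma>) (shift (Suc k) ((A # \<Gamma>) ! k))"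
    using assms by (cases k) (simp_all add: substitution_def subst_ren comp_def)
qed (use assms in \<open>simp add: substitution_def\<close>)

lemma substitution_ups:
  "substitution \<Delta> \<sigma> \<Gamma> \<Longrightarrow> \<Delta> \<turnstile> subst \<sigma> A \<Colon> Univ i \<Longrightarrow> substitution (subst \<sigma> A # \<Delta>) (ups \<sigma>) (A # \<Gamma>)"
  by (rule substitution.S_ext)

lemma substitution_Var: "\<turnstile> \<Gamma> ctx \<Longrightarrow> substitution \<Gamma> Var \<Gamma>"
  using vble by (simp add: substitution_def del: add_Suc_right)

lemma substitution_Suc:
  assumes "\<turnstile> A # \<Delta> ctx" "substitution \<Delta> \<sigma> \<Gamma>"
  shows "substitution (A # \<Delta>) (\<lambda>k. (\<sigma> k)\<up>) \<Gamma>"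
  unfolding substitution_def
proof (intro conjI allI impI)
  fix k assume "k < length \<Gamma>"
  then have "\<Delta> \<turnstile> \<sigma> k \<Colon> subst \<sigma> (shift (Suc k) (\<Gamma> ! k))"
    using assms(2) by (simp add: substitution_def)
  from weakening(1)[OF assms(1) this]
  show "A # \<Delta> \<turnstile> (\<sigma> k)\<up> \<Colon> subst (\<lambda>k. (\<sigma> k)\<up>) (shift (Suc k) (\<Gamma> ! k))" by (simp add: ren_subst)
qed (rule assms(1))

lemma substitution_wk1: "\<turnstile> A # \<Gamma> ctx \<Longrightarrow> \<turnstile> \<Gamma> ctx \<Longrightarrow> substitution (A # \<Gamma>) (\<lambda>k. Var (k + 1)) \<Gamma>"
  using substitution_Suc[OF _ substitution_Var] by simp

lemma substitution_wk2:
  "\<turnstile> B # A # \<Gamma> ctx \<Longrightarrow> \<turnstile> A # \<Gamma> ctx \<Longrightarrow> \<turnstile> \<Gamma> ctx \<Longrightarrow> substitution (B # A # \<Gamma>) (\<lambda>k. Var (k + 2)) \<Gamma>"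
  using substitution_Suc[OF _ substitution_wk1] by simp

lemma substitution_inst: "A # \<Gamma> \<turnstile> b \<Colon> B \<Longrightarrow> \<turnstile> \<Gamma> ctx \<Longrightarrow> \<Gamma> \<turnstile> a \<Colon> A \<Longrightarrow> \<Gamma> \<turnstile> b\<lbrakk>a\<rbrakk> \<Colon> B\<lbrakk>a\<rbrakk>"
  by (rule substitution_type, assumption) (simp add: substitution_scons substitution_Var)

text \<open>Congruence of substitution is read off from congruence of application and the \<open>\<beta>\<close> rule.\<close>

lemma functionality:
  assumes C: "P # \<Gamma> \<turnstile> C \<Colon> Univ i" and S: "substitution \<Delta> \<sigma> \<Gamma>"
    and a: "\<Delta> \<turnstile> a \<Colon> subst \<sigma> P" and b: "\<Delta> \<turnstile> b \<Colon> subst \<sigma> P" and ab: "\<Delta> \<turnstile> a \<doteq> b \<Colon> subst \<sigma> P"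
  shows "\<Delta> \<turnstile> subst (a \<cdot> \<sigma>) C \<doteq> subst (b \<cdot> \<sigma>) C \<Colon> Univ i"
proof -
  obtain j where P: "\<Delta> \<turnstile> subst \<sigma> P \<Colon> Univ j" using substitution_head_type[OF C S] by blast
  let ?C = "subst (ups \<sigma>) C"
  have C': "subst \<sigma> P # \<Delta> \<turnstile> ?C \<Colon> Univ i"
    using substitution_type[OF C substitution_ups[OF S P]] by simp
  have beta: "\<Delta> \<turnstile> App (Lam (subst \<sigma> P) ?C) x \<doteq> subst (x \<cdot> \<sigma>) C \<Colon> Univ i" if "\<Delta> \<turnstile> x \<Colon> subst \<sigma> P" for x
    using pi_comp[OF C' that] by (simp add: subst_scons_ups)
  have "\<Delta> \<turnstile> App (Lam (subst \<sigma> P) ?C) a \<doteq> App (Lam (subst \<sigma> P) ?C) b \<Colon> Univ i"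
    using pi_elim_eq[OF eq_refl[OF pi_intro[OF C']] ab] by simp
  then show ?thesis using beta[OF a] beta[OF b] eq_sym eq_trans by blast
qed

lemma cumul:
  assumes "i \<le> j"
  shows "\<Gamma> \<turnstile> A \<Colon> Univ i \<Longrightarrow> \<Gamma> \<turnstile> A \<Colon> Univ j" and "\<Gamma> \<turnstile> A \<doteq> B \<Colon> Univ i \<Longrightarrow> \<Gamma> \<turnstile> A \<doteq> B \<Colon> Univ j"
  using assms by (induction rule: dec_induct) (auto intro: univ_cumul univ_cumul_eq)

text \<open>Both variables are abstracted at once. The type of the second depends on the value of
  the first, so the two beta reductions are carried out separately at \<open>p, q\<close> and at
  \<open>p', q'\<close>, each with its own domain for the inner abstraction; the congruence step in
  between uses only the domain at \<open>p\<close>.\<close>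

lemma functionality2:
  assumes C: "Q # P # \<Gamma> \<turnstile> C \<Colon> Univ i" and S: "substitution \<Delta> \<sigma> \<Gamma>"
    and p: "\<Delta> \<turnstile> p \<Colon> subst \<sigma> P" "\<Delta> \<turnstile> p' \<Colon> subst \<sigma> P" "\<Delta> \<turnstile> p \<doteq> p' \<Colon> subst \<sigma> P"
    and q: "\<Delta> \<turnstile> q \<Colon> subst (p \<cdot> \<sigma>) Q" "\<Delta> \<turnstile> q' \<Colon> subst (p' \<cdot> \<sigma>) Q" "\<Delta> \<turnstile> q \<doteq> q' \<Colon> subst (p \<cdot> \<sigma>) Q"
  shows "\<Delta> \<turnstile> subst (q \<cdot> p \<cdot> \<sigma>) C \<doteq> subst (q' \<cdot> p' \<cdot> \<sigma>) C \<Colon> Univ i"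
proof -
  let ?P = "subst \<sigma> P" and ?Q = "subst (ups \<sigma>) Q" and ?C = "subst (ups (ups \<sigma>)) C"
  obtain j where "\<Delta> \<turnstile> ?P \<Colon> Univ j"
    using substitution.substitution_induct(2)[OF C] S
    by (auto simp: substitution.stable_type_def)
  then have S1: "substitution (?P # \<Delta>) (ups \<sigma>) (P # \<Gamma>)" using substitution_ups[OF S] by blast
  then obtain k where "?P # \<Delta> \<turnstile> ?Q \<Colon> Univ k" using substitution_head_type[OF C] by blast
  then have "?Q # ?P # \<Delta> \<turnstile> ?C \<Colon> Univ i"
    using substitution_type[OF C substitution_ups[OF S1]] by simp
  then have G: "?P # \<Delta> \<turnstile> Lam ?Q ?C \<Colon> Pi ?Q (Univ i)" by (rule pi_intro)
  let ?H = "Lam ?P (Lam ?Q ?C)"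
  have beta: "\<Delta> \<turnstile> App (App ?H x) y \<doteq> subst (y \<cdot> x \<cdot> \<sigma>) C \<Colon> Univ i"
    if x: "\<Delta> \<turnstile> x \<Colon> ?P" and y: "\<Delta> \<turnstile> y \<Colon> subst (x \<cdot> \<sigma>) Q" for x y
  proof -
    have Sx: "substitution \<Delta> (x \<cdot> \<sigma>) (P # \<Gamma>)" using substitution_scons[OF S x] .
    obtain l where "\<Delta> \<turnstile> subst (x \<cdot> \<sigma>) Q \<Colon> Univ l" using substitution_head_type[OF C Sx] by blast
    then have "subst (x \<cdot> \<sigma>) Q # \<Delta> \<turnstile> subst (ups (x \<cdot> \<sigma>)) C \<Colon> Univ i"
      using substitution_type[OF C substitution_ups[OF Sx]] by simp
    from pi_comp[OF this y]
    have 1: "\<Delta> \<turnstile> App (Lam (subst (x \<cdot> \<sigma>) Q) (subst (ups (x \<cdot> \<sigma>)) C)) y \<doteq> subst (y \<cdot> x \<cdot> \<sigma>) C \<Colon> Univ i"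
      by (simp add: subst_scons_ups)
    have "ups (x \<cdot> \<sigma>) = (\<lambda>k. subst (ups (x \<cdot> Var)) (ups (ups \<sigma>) k))"
      unfolding ups_subst_comp[symmetric]
      by (rule arg_cong[of _ _ ups]) (auto simp: scons_def ups_def subst_ren comp_def split: nat.split)
    then have "subst (ups (x \<cdot> \<sigma>)) C = subst (ups (x \<cdot> Var)) ?C" by (simp add: subst_subst)
    with pi_comp[OF G x]
    have "\<Delta> \<turnstile> App ?H x \<doteq> Lam (subst (x \<cdot> \<sigma>) Q) (subst (ups (x \<cdot> \<sigma>)) C) \<Colon> Pi (subst (x \<cdot> \<sigma>) Q) (Univ i)"
      by (simp add: subst_scons_ups)
    from pi_elim_eq[OF this eq_refl[OF y]] 1 show ?thesis by (auto intro: eq_trans)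
  qed
  have "\<Delta> \<turnstile> App ?H p \<doteq> App ?H p' \<Colon> Pi (subst (p \<cdot> \<sigma>) Q) (Univ i)"
    using pi_elim_eq[OF eq_refl[OF pi_intro[OF G]] p(3)] by (simp add: subst_scons_ups)
  from pi_elim_eq[OF this q(3)]
  have "\<Delta> \<turnstile> App (App ?H p) q \<doteq> App (App ?H p') q' \<Colon> Univ i" by simp
  then show ?thesis using beta[OF p(1) q(1)] beta[OF p(2) q(2)] eq_sym eq_trans by blast
qed

text \<open>Contracting a path induction changes the type as well: it is stated at \<open>p\<close>
  and \<open>b\<close>, while \<open>id_comp\<close> speaks about \<open>Refl a\<close> and
  \<open>a\<close>. The first endpoint is the same on both sides and is absorbed into the
  substitution, so that congruence in two variables suffices.\<close>

lemma id_elim_type_cong: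
  assumes C: "Id A\<up>\<up> (Var 1) (Var 0) # A\<up> # A # \<Gamma> \<turnstile> C \<Colon> Univ i" and \<Gamma>: "\<turnstile> \<Gamma> ctx"
    and A: "\<Gamma> \<turnstile> A \<Colon> Univ j"
    and a: "\<Gamma> \<turnstile> a \<Colon> A" and b: "\<Gamma> \<turnstile> b \<Colon> A" and p: "\<Gamma> \<turnstile> p \<Colon> Id A a b"
    and ba: "\<Gamma> \<turnstile> b \<doteq> a \<Colon> A" and pr: "\<Gamma> \<turnstile> p \<doteq> Refl a \<Colon> Id A a b"
  shows "\<Gamma> \<turnstile> subst (p \<cdot> b \<cdot> a \<cdot> Var) C \<doteq> subst (Refl a \<cdot> a \<cdot> a \<cdot> Var) C \<Colon> Univ i"
proof (rule functionality2[OF C, where \<sigma> = "a \<cdot> Var"])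
  show "substitution \<Gamma> (a \<cdot> Var) (A # \<Gamma>)"
    using substitution_scons[OF substitution_Var[OF \<Gamma>]] a by simp
  have "subst (x \<cdot> y \<cdot> Var) A\<up>\<up> = A" for x y by (simp add: subst_ren comp_def)
  then show "\<Gamma> \<turnstile> p \<Colon> subst (b \<cdot> a \<cdot> Var) (Id A\<up>\<up> (Var 1) (Var 0))"
    "\<Gamma> \<turnstile> Refl a \<Colon> subst (a \<cdot> a \<cdot> Var) (Id A\<up>\<up> (Var 1) (Var 0))"
    "\<Gamma> \<turnstile> p \<doteq> Refl a \<Colon> subst (b \<cdot> a \<cdot> Var) (Id A\<up>\<up> (Var 1) (Var 0))"
    using p pr id_intro[OF A a] by simp_all
qed (use a b ba in simp_all)

subsection \<open>Universe shift\<close>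

text \<open>Raising every universe by \<open>n\<close> preserves derivations, so it suffices to treat the universe \<open>Univ 0\<close>.\<close>

primrec ushift :: "nat \<Rightarrow> tm \<Rightarrow> tm" where
  "ushift n (Var k) = Var k"
| "ushift n (Univ i) = Univ (i + n)"
| "ushift n (Pi A B) = Pi (ushift n A) (ushift n B)"
| "ushift n (Lam A b) = Lam (ushift n A) (ushift n b)"
| "ushift n (App f a) = App (ushift n f) (ushift n a)"
| "ushift n (Sig A B) = Sig (ushift n A) (ushift n B)"
| "ushift n (Pair a b) = Pair (ushift n a) (ushift n b)"
| "ushift n (IndSig C g p) = IndSig (ushift n C) (ushift n g) (ushift n p)"
| "ushift n (Coprod A B) = Coprod (ushift n A) (ushift n B)"
| "ushift n (InL a) = InL (ushift n a)"
| "ushift n (InR b) = InR (ushift n b)"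
| "ushift n (IndCoprod C c d p) = IndCoprod (ushift n C) (ushift n c) (ushift n d) (ushift n p)"
| "ushift n Empty = Empty"
| "ushift n (IndEmpty C p) = IndEmpty (ushift n C) (ushift n p)"
| "ushift n Unit = Unit"
| "ushift n Star = Star"
| "ushift n (IndUnit C c p) = IndUnit (ushift n C) (ushift n c) (ushift n p)"
| "ushift n NatT = NatT"
| "ushift n Zero = Zero"
| "ushift n (Succ m) = Succ (ushift n m)"
| "ushift n (IndNat C z s m) = IndNat (ushift n C) (ushift n z) (ushift n s) (ushift n m)"
| "ushift n (Id A a b) = Id (ushift n A) (ushift n a) (ushift n b)"
| "ushift n (Refl a) = Refl (ushift n a)"
| "ushift n (IndId C c a b p) = IndId (ushift n C) (ushift n c) (ushift n a) (ushift n b) (ushift n p)"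
| "ushift n (Funext f g) = Funext (ushift n f) (ushift n g)"
| "ushift n (Univalence i A B) = Univalence (i + n) (ushift n A) (ushift n B)"
| "ushift n (Trunc A) = Trunc (ushift n A)"
| "ushift n (TruncIn a) = TruncIn (ushift n a)"
| "ushift n (TruncPath a b) = TruncPath (ushift n a) (ushift n b)"
| "ushift n (TruncRec B h f t) = TruncRec (ushift n B) (ushift n h) (ushift n f) (ushift n t)"

lemma ushift_ren [simp]: "ushift n (ren \<xi> t) = ren \<xi> (ushift n t)"
  by (induction t arbitrary: \<xi>) simp_all

lemma ushift_ups: "ups (\<lambda>k. ushift n (\<sigma> k)) = (\<lambda>k. ushift n (ups \<sigma> k))"
proof
  show "ups (\<lambda>k. ushift n (\<sigma> k)) k = ushift n (ups \<sigma> k)" for k by (cases k) simp_all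
qed

lemma ushift_subst: "ushift n (subst \<sigma> t) = subst (\<lambda>k. ushift n (\<sigma> k)) (ushift n t)"
  by (induction t arbitrary: \<sigma>) (simp_all add: ushift_ups)

lemma ushift_scons: "(\<lambda>k. ushift n ((a \<cdot> \<sigma>) k)) = ushift n a \<cdot> (\<lambda>k. ushift n (\<sigma> k))"
  by (auto simp: scons_def split: nat.split)

lemma ushift_defs [simp]:
  "ushift n (A \<rightarrow> B) = ushift n A \<rightarrow> ushift n B"
  "ushift n (A \<otimes> B) = ushift n A \<otimes> ushift n B"
  "ushift n (is_prop A) = is_prop (ushift n A)"
  "ushift n (is_equiv A B f) = is_equiv (ushift n A) (ushift n B) (ushift n f)"
  "ushift n (Equiv A B) = Equiv (ushift n A) (ushift n B)"
  "ushift n (id_equiv A) = id_equiv (ushift n A)"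
  "ushift n (idtoeqv i A B) = idtoeqv (i + n) (ushift n A) (ushift n B)"
  "ushift n (Homotopy A B f g) = Homotopy (ushift n A) (ushift n B) (ushift n f) (ushift n g)"
  "ushift n (happly A B f g) = happly (ushift n A) (ushift n B) (ushift n f) (ushift n g)"
  by (simp_all add: Fun_def Prod_def is_prop_def is_equiv_def Equiv_def id_equiv_def Let_def
      idtoeqv_def Homotopy_def happly_def)

text \<open>Every rule is schematic in its universe levels, and no rule ties a type former to a
  fixed level. Adding \<open>n\<close> throughout therefore turns each instance of a rule into
  another instance of it.\<close>

lemma ushift_derivation:
  shows "\<turnstile> \<Gamma> ctx \<Longrightarrow> \<turnstile> map (ushift n) \<Gamma> ctx"
    and "\<Gamma> \<turnstile> a \<Colon> A \<Longrightarrow> map (ushift n) \<Gamma> \<turnstile> ushift n a \<Colon> ushift n A"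
    and "\<Gamma> \<turnstile> a \<doteq> b \<Colon> A \<Longrightarrow> map (ushift n) \<Gamma> \<turnstile> ushift n a \<doteq> ushift n b \<Colon> ushift n A"
proof (induction rule: wf_ctx_has_type_eq_tm.inducts)
  case (vble \<Gamma> k)
  then show ?case using wf_ctx_has_type_eq_tm.vble[of "map (ushift n) \<Gamma>" k] by simp
next
  case (conv \<Gamma> a A B i)
  then show ?case using wf_ctx_has_type_eq_tm.conv by simp
next
  case (eq_conv \<Gamma> a b A B i)
  then show ?case using wf_ctx_has_type_eq_tm.eq_conv by simp
next
  case (eq_sym \<Gamma> a b A)
  then show ?case using wf_ctx_has_type_eq_tm.eq_sym by blast
next
  case (eq_trans \<Gamma> a b A c)
  then show ?case using wf_ctx_has_type_eq_tm.eq_trans by blast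
qed (simp add: wf_ctx_has_type_eq_tm.intros(1,2,5,10,11)
    | (((simp add: ushift_subst ushift_scons)?)[1], rule wf_ctx_has_type_eq_tm.intros(2) structural_rules;
       (auto simp: ushift_subst ushift_scons)[1]))+

subsection \<open>Type checker\<close>

text \<open>
  A checker is given a flag \<open>nf\<close>, a context, a term and possibly its expected type; it returns the term,
  normalised if \<open>nf\<close> holds, and its type. Every contracted redex has its body and its reduct checked
  afresh, so that soundness needs neither subject reduction nor injectivity of \<open>Pi\<close>.
\<close>

type_synonym checker = "bool \<Rightarrow> tm list \<Rightarrow> tm \<Rightarrow> tm option \<Rightarrow> (tm \<times> tm) option"

primrec lookup :: "tm list \<Rightarrow> nat \<Rightarrow> tm option" where
  "lookup [] k = None"
| "lookup (A # \<Gamma>) k = (case k of 0 \<Rightarrow> Some A | Suc m \<Rightarrow> lookup \<Gamma> m)"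

definition canonical :: "tm \<Rightarrow> bool" where
  "canonical T = (case T of Pi A B \<Rightarrow> True | Sig A B \<Rightarrow> True | Id A a b \<Rightarrow> True | Coprod A B \<Rightarrow> True
    | Univ i \<Rightarrow> True | Trunc A \<Rightarrow> True | Empty \<Rightarrow> True | _ \<Rightarrow> False)"

text \<open>
  Pairs and injections do not determine their types. Where such a term is substituted, \<open>wrap\<close> records
  its type by applying the identity function on that type.
\<close>

definition needs_type :: "tm \<Rightarrow> bool" where
  "needs_type t = (case t of Pair a b \<Rightarrow> True | InL a \<Rightarrow> True | InR b \<Rightarrow> True | _ \<Rightarrow> False)"

definition is_lam :: "tm \<Rightarrow> bool" where
  "is_lam t = (case t of Lam A b \<Rightarrow> True | _ \<Rightarrow> False)"

definition asc :: "tm \<Rightarrow> tm \<Rightarrow> tm" where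
  "asc A a = App (Lam A (Var 0)) a"

definition wrap :: "tm \<Rightarrow> tm \<Rightarrow> tm" where
  "wrap A a = (if needs_type a then asc A a else a)"

definition on_univ :: "tm \<Rightarrow> (nat \<Rightarrow> 'a option) \<Rightarrow> 'a option" where
  "on_univ T k = (case T of Univ i \<Rightarrow> k i | _ \<Rightarrow> None)"
definition on_pi :: "tm \<Rightarrow> (tm \<Rightarrow> tm \<Rightarrow> 'a option) \<Rightarrow> 'a option" where
  "on_pi T k = (case T of Pi A B \<Rightarrow> k A B | _ \<Rightarrow> None)"
definition on_sig :: "tm \<Rightarrow> (tm \<Rightarrow> tm \<Rightarrow> 'a option) \<Rightarrow> 'a option" where
  "on_sig T k = (case T of Sig A B \<Rightarrow> k A B | _ \<Rightarrow> None)"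
definition on_coprod :: "tm \<Rightarrow> (tm \<Rightarrow> tm \<Rightarrow> 'a option) \<Rightarrow> 'a option" where
  "on_coprod T k = (case T of Coprod A B \<Rightarrow> k A B | _ \<Rightarrow> None)"
definition on_id :: "tm \<Rightarrow> (tm \<Rightarrow> 'a option) \<Rightarrow> 'a option" where
  "on_id T k = (case T of Id A a b \<Rightarrow> k A | _ \<Rightarrow> None)"
definition on_trunc :: "tm \<Rightarrow> (tm \<Rightarrow> 'a option) \<Rightarrow> 'a option" where
  "on_trunc T k = (case T of Trunc A \<Rightarrow> k A | _ \<Rightarrow> None)"

definition if_lam :: "tm \<Rightarrow> (tm \<Rightarrow> tm \<Rightarrow> 'a) \<Rightarrow> 'a \<Rightarrow> 'a" where
  "if_lam t k z = (case t of Lam A b \<Rightarrow> k A b | _ \<Rightarrow> z)"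
definition if_pair :: "tm \<Rightarrow> (tm \<Rightarrow> tm \<Rightarrow> 'a) \<Rightarrow> 'a \<Rightarrow> 'a" where
  "if_pair t k z = (case t of Pair a b \<Rightarrow> k a b | _ \<Rightarrow> z)"
definition if_inj :: "tm \<Rightarrow> (tm \<Rightarrow> 'a) \<Rightarrow> (tm \<Rightarrow> 'a) \<Rightarrow> 'a \<Rightarrow> 'a" where
  "if_inj t k l z = (case t of InL a \<Rightarrow> k a | InR b \<Rightarrow> l b | _ \<Rightarrow> z)"
definition if_refl :: "tm \<Rightarrow> (tm \<Rightarrow> 'a) \<Rightarrow> 'a \<Rightarrow> 'a" where
  "if_refl t k z = (case t of Refl a \<Rightarrow> k a | _ \<Rightarrow> z)"
definition if_var0 :: "tm \<Rightarrow> 'a \<Rightarrow> 'a \<Rightarrow> 'a" where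
  "if_var0 t y z = (case t of Var k \<Rightarrow> (case k of 0 \<Rightarrow> y | Suc _ \<Rightarrow> z) | _ \<Rightarrow> z)"
definition if_univ :: "tm \<Rightarrow> (nat \<Rightarrow> 'a) \<Rightarrow> 'a \<Rightarrow> 'a" where
  "if_univ T k z = (case T of Univ i \<Rightarrow> k i | _ \<Rightarrow> z)"

text \<open>Cumulativity is compared only between universes at the top of a type, matching
  \<open>univ_cumul\<close>, which has no counterpart below \<open>Pi\<close> or
  \<open>Sig\<close>.\<close>

definition level_le :: "tm \<Rightarrow> tm \<Rightarrow> bool" where
  "level_le T S = if_univ T (\<lambda>i. if_univ S (\<lambda>j. i \<le> j) False) (T = S)"

definition normal_type :: "checker \<Rightarrow> tm list \<Rightarrow> tm \<Rightarrow> tm option" where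
  "normal_type r \<Gamma> T = do { (N, K) \<leftarrow> r True \<Gamma> T None; on_univ K (\<lambda>i. Some N) }"

definition expose :: "checker \<Rightarrow> tm list \<Rightarrow> tm \<Rightarrow> tm option" where
  "expose r \<Gamma> T = (if canonical T then Some T else normal_type r \<Gamma> T)"

definition infer_univ :: "checker \<Rightarrow> bool \<Rightarrow> tm list \<Rightarrow> tm \<Rightarrow> (tm \<times> nat) option" where
  "infer_univ r nf \<Gamma> A = do { (A', K) \<leftarrow> r nf \<Gamma> A None; K' \<leftarrow> expose r \<Gamma> K; on_univ K' (\<lambda>i. Some (A', i)) }"

definition subtype :: "checker \<Rightarrow> tm list \<Rightarrow> tm \<Rightarrow> tm \<Rightarrow> unit option" where
  "subtype r \<Gamma> T S = (if level_le T S then Some () else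
     do { T' \<leftarrow> normal_type r \<Gamma> T; S' \<leftarrow> normal_type r \<Gamma> S; if level_le T' S' then Some () else None })"

definition equal_types :: "checker \<Rightarrow> tm list \<Rightarrow> tm \<Rightarrow> tm \<Rightarrow> unit option" where
  "equal_types r \<Gamma> T S = do { T' \<leftarrow> normal_type r \<Gamma> T; S' \<leftarrow> normal_type r \<Gamma> S; if T' = S' then Some () else None }"

definition check :: "checker \<Rightarrow> bool \<Rightarrow> tm list \<Rightarrow> tm \<Rightarrow> tm \<Rightarrow> tm option" where
  "check r nf \<Gamma> t T = do { (t', _) \<leftarrow> r nf \<Gamma> t (Some T); Some t' }"

definition red_app where
  "red_app r nf \<Gamma> f' w A B T s = (if nf then if_lam f' (\<lambda>D b. do {
     _ \<leftarrow> subtype r \<Gamma> A D; _ \<leftarrow> infer_univ r False \<Gamma> D; _ \<leftarrow> check r False (D # \<Gamma>) b B;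
     let t = b\<lbrakk>w\<rbrakk>; u \<leftarrow> check r True \<Gamma> t T; Some (u, T) }) s else s)"

definition red_sig where
  "red_sig r nf \<Gamma> g p' A B T s = (if nf then if_pair p' (\<lambda>a b. do {
     _ \<leftarrow> check r False \<Gamma> a A; let v = wrap A a; let D = B\<lbrakk>v\<rbrakk>; _ \<leftarrow> check r False \<Gamma> b D;
     let w = wrap D b; let t = subst (w \<cdot> v \<cdot> Var) g; u \<leftarrow> check r True \<Gamma> t T; Some (u, T) }) s else s)"

definition red_coprod where
  "red_coprod r nf \<Gamma> c d p' A B T s = (if nf then if_inj p'
     (\<lambda>a. do { _ \<leftarrow> check r False \<Gamma> a A; let w = wrap A a; let t = c\<lbrakk>w\<rbrakk>; u \<leftarrow> check r True \<Gamma> t T; Some (u, T) })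
     (\<lambda>b. do { _ \<leftarrow> check r False \<Gamma> b B; let w = wrap B b; let t = d\<lbrakk>w\<rbrakk>; u \<leftarrow> check r True \<Gamma> t T; Some (u, T) }) s
     else s)"

definition red_id where
  "red_id r nf \<Gamma> c a a' b' p' T s = (if nf then if_refl p' (\<lambda>q.
     if a' = q \<and> b' = q \<and> \<not> needs_type a then do { let t = c\<lbrakk>a\<rbrakk>; u \<leftarrow> check r True \<Gamma> t T; Some (u, T) } else None) s
     else s)"

text \<open>When the argument is wrapped, the reported type is \<open>B\<close> at the ascribed
  argument, whereas \<open>pi_elim\<close> yields \<open>B\<close> at the bare one. The extra checks
  of \<open>A\<close> and \<open>B\<close> in that case supply what \<open>functionality\<close>
  needs to identify the two.\<close>

definition infer_app :: "checker \<Rightarrow> bool \<Rightarrow> tm list \<Rightarrow> tm \<Rightarrow> tm \<Rightarrow> (tm \<times> tm) option" where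
  "infer_app r nf \<Gamma> f a = do { (f', F) \<leftarrow> r nf \<Gamma> f None; F' \<leftarrow> expose r \<Gamma> F;
     on_pi F' (\<lambda>A B. do { a' \<leftarrow> check r nf \<Gamma> a A;
       _ \<leftarrow> (if needs_type a then do { _ \<leftarrow> infer_univ r False \<Gamma> A; infer_univ r False (A # \<Gamma>) B } else Some (A, 0));
       let w = wrap A a; let T = B\<lbrakk>w\<rbrakk>; red_app r nf \<Gamma> f' w A B T (Some (App f' a', T)) }) }"

text \<open>An application of an identity function is recognised first and treated as an ascription:
  its argument is checked against the annotation, and normalisation drops the annotation. The
  motives of sum and coproduct elimination are instantiated with ascribed pairs and injections,
  since the bare ones have no inferable type.\<close>

primrec infer :: "checker \<Rightarrow> bool \<Rightarrow> tm list \<Rightarrow> tm \<Rightarrow> (tm \<times> tm) option" where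
  "infer r nf \<Gamma> (Var k) = do { A \<leftarrow> lookup \<Gamma> k; let T = shift (Suc k) A; Some (Var k, T) }"
| "infer r nf \<Gamma> (Univ i) = Some (Univ i, Univ (Suc i))"
| "infer r nf \<Gamma> (Pi A B) = do { (A', i) \<leftarrow> infer_univ r nf \<Gamma> A; (B', j) \<leftarrow> infer_univ r nf (A # \<Gamma>) B;
     let m = max i j; Some (Pi A' B', Univ m) }"
| "infer r nf \<Gamma> (Lam A b) = do { (A', i) \<leftarrow> infer_univ r nf \<Gamma> A; (b', B) \<leftarrow> r nf (A # \<Gamma>) b None;
     Some (Lam A' b', Pi A B) }"
| "infer r nf \<Gamma> (App f a) =
     if_lam f (\<lambda>A b. if_var0 b (do { _ \<leftarrow> infer_univ r False \<Gamma> A; a' \<leftarrow> check r nf \<Gamma> a A;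
         let t = (if nf then a' else App f a); Some (t, A) }) (infer_app r nf \<Gamma> f a))
       (infer_app r nf \<Gamma> f a)"
| "infer r nf \<Gamma> (Sig A B) = do { (A', i) \<leftarrow> infer_univ r nf \<Gamma> A; (B', j) \<leftarrow> infer_univ r nf (A # \<Gamma>) B;
     let m = max i j; Some (Sig A' B', Univ m) }"
| "infer r nf \<Gamma> (Pair a b) = None"
| "infer r nf \<Gamma> (IndSig C g p) = do { (p', P) \<leftarrow> r nf \<Gamma> p None; P' \<leftarrow> expose r \<Gamma> P;
     on_sig P' (\<lambda>A B. do {
       _ \<leftarrow> infer_univ r False \<Gamma> A; _ \<leftarrow> infer_univ r False (A # \<Gamma>) B; (C', i) \<leftarrow> infer_univ r nf (Sig A B # \<Gamma>) C;
       let M = subst (asc (shift 2 (Sig A B)) (Pair (Var 1) (Var 0)) \<cdot> (\<lambda>k. Var (k + 2))) C;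
       g' \<leftarrow> check r nf (B # A # \<Gamma>) g M;
       let T = C\<lbrakk>p\<rbrakk>; red_sig r nf \<Gamma> g p' A B T (Some (IndSig C' g' p', T)) }) }"
| "infer r nf \<Gamma> (Coprod A B) = do { (A', i) \<leftarrow> infer_univ r nf \<Gamma> A; (B', j) \<leftarrow> infer_univ r nf \<Gamma> B;
     let m = max i j; Some (Coprod A' B', Univ m) }"
| "infer r nf \<Gamma> (InL a) = None"
| "infer r nf \<Gamma> (InR b) = None"
| "infer r nf \<Gamma> (IndCoprod C c d p) = do { (p', P) \<leftarrow> r nf \<Gamma> p None; P' \<leftarrow> expose r \<Gamma> P;
     on_coprod P' (\<lambda>A B. do {
       _ \<leftarrow> infer_univ r False \<Gamma> A; _ \<leftarrow> infer_univ r False \<Gamma> B; (C', i) \<leftarrow> infer_univ r nf (Coprod A B # \<Gamma>) C;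
       let M = subst (asc (Coprod A B)\<up> (InL (Var 0)) \<cdot> (\<lambda>k. Var (k + 1))) C;
       c' \<leftarrow> check r nf (A # \<Gamma>) c M;
       let N = subst (asc (Coprod A B)\<up> (InR (Var 0)) \<cdot> (\<lambda>k. Var (k + 1))) C;
       d' \<leftarrow> check r nf (B # \<Gamma>) d N;
       let T = C\<lbrakk>p\<rbrakk>; red_coprod r nf \<Gamma> c d p' A B T (Some (IndCoprod C' c' d' p', T)) }) }"
| "infer r nf \<Gamma> Empty = Some (Empty, Univ 0)"
| "infer r nf \<Gamma> (IndEmpty C p) = do { p' \<leftarrow> check r nf \<Gamma> p Empty; (C', i) \<leftarrow> infer_univ r nf (Empty # \<Gamma>) C;
     let T = C\<lbrakk>p\<rbrakk>; Some (IndEmpty C' p', T) }"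
| "infer r nf \<Gamma> Unit = None"
| "infer r nf \<Gamma> Star = None"
| "infer r nf \<Gamma> (IndUnit C c p) = None"
| "infer r nf \<Gamma> NatT = None"
| "infer r nf \<Gamma> Zero = None"
| "infer r nf \<Gamma> (Succ m) = None"
| "infer r nf \<Gamma> (IndNat C z s m) = None"
| "infer r nf \<Gamma> (Id A a b) = do { (A', i) \<leftarrow> infer_univ r nf \<Gamma> A; a' \<leftarrow> check r nf \<Gamma> a A; b' \<leftarrow> check r nf \<Gamma> b A;
     Some (Id A' a' b', Univ i) }"
| "infer r nf \<Gamma> (Refl a) = do { (a', A) \<leftarrow> r nf \<Gamma> a None; _ \<leftarrow> infer_univ r False \<Gamma> A; Some (Refl a', Id A a a) }"
| "infer r nf \<Gamma> (IndId C c a b p) = do { (p', P) \<leftarrow> r nf \<Gamma> p None; P' \<leftarrow> expose r \<Gamma> P;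
     on_id P' (\<lambda>A. do {
       _ \<leftarrow> infer_univ r False \<Gamma> A; a' \<leftarrow> check r nf \<Gamma> a A; b' \<leftarrow> check r nf \<Gamma> b A;
       _ \<leftarrow> subtype r \<Gamma> P' (Id A a b);
       let A1 = A\<up>; let A2 = A1\<up>; (C', i) \<leftarrow> infer_univ r nf (Id A2 (Var 1) (Var 0) # A1 # A # \<Gamma>) C;
       let M = subst (Refl (Var 0) \<cdot> Var 0 \<cdot> Var 0 \<cdot> (\<lambda>k. Var (k + 1))) C; c' \<leftarrow> check r nf (A # \<Gamma>) c M;
       let T = subst (p \<cdot> b \<cdot> a \<cdot> Var) C;
       red_id r nf \<Gamma> c a a' b' p' T (Some (IndId C' c' a' b' p', T)) }) }"
| "infer r nf \<Gamma> (Funext f g) = do { (f', F) \<leftarrow> r nf \<Gamma> f None; F' \<leftarrow> expose r \<Gamma> F;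
     on_pi F' (\<lambda>A B. do { g' \<leftarrow> check r nf \<Gamma> g (Pi A B);
       let T = is_equiv (Id (Pi A B) f g) (Homotopy A B f g) (happly A B f g); Some (Funext f' g', T) }) }"
| "infer r nf \<Gamma> (Univalence i A B) = do { A' \<leftarrow> check r nf \<Gamma> A (Univ i); B' \<leftarrow> check r nf \<Gamma> B (Univ i);
     let T = is_equiv (Id (Univ i) A B) (Equiv A B) (idtoeqv i A B); Some (Univalence i A' B', T) }"
| "infer r nf \<Gamma> (Trunc A) = do { (A', i) \<leftarrow> infer_univ r nf \<Gamma> A; Some (Trunc A', Univ i) }"
| "infer r nf \<Gamma> (TruncIn a) = do { (a', A) \<leftarrow> r nf \<Gamma> a None; Some (TruncIn a', Trunc A) }"
| "infer r nf \<Gamma> (TruncPath a b) = do { (a', T) \<leftarrow> r nf \<Gamma> a None; T' \<leftarrow> expose r \<Gamma> T;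
     on_trunc T' (\<lambda>A. do { b' \<leftarrow> check r nf \<Gamma> b (Trunc A); Some (TruncPath a' b', Id (Trunc A) a b) }) }"
| "infer r nf \<Gamma> (TruncRec B h f t) = do { (B', i) \<leftarrow> infer_univ r nf \<Gamma> B; let H = is_prop B; h' \<leftarrow> check r nf \<Gamma> h H;
     (t', T) \<leftarrow> r nf \<Gamma> t None; T' \<leftarrow> expose r \<Gamma> T;
     on_trunc T' (\<lambda>A. do { let F = A \<rightarrow> B; f' \<leftarrow> check r nf \<Gamma> f F; Some (TruncRec B' h' f' t', B) }) }"

definition check_intro :: "checker \<Rightarrow> bool \<Rightarrow> tm list \<Rightarrow> tm \<Rightarrow> tm \<Rightarrow> tm option" where
  "check_intro r nf \<Gamma> t T = (case t of
     Pair a b \<Rightarrow> on_sig T (\<lambda>A B. do { _ \<leftarrow> infer_univ r False \<Gamma> A; _ \<leftarrow> infer_univ r False (A # \<Gamma>) B;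
       a' \<leftarrow> check r nf \<Gamma> a A; let D = B\<lbrakk>wrap A a\<rbrakk>; b' \<leftarrow> check r nf \<Gamma> b D; Some (Pair a' b') })
   | Lam A b \<Rightarrow> on_pi T (\<lambda>D B. do { (A', i) \<leftarrow> infer_univ r nf \<Gamma> A;
       _ \<leftarrow> (if A = D then Some () else do { _ \<leftarrow> equal_types r \<Gamma> A D; _ \<leftarrow> infer_univ r False (A # \<Gamma>) B; Some () });
       b' \<leftarrow> check r nf (A # \<Gamma>) b B; Some (Lam A' b') })
   | InL a \<Rightarrow> on_coprod T (\<lambda>A B. do { _ \<leftarrow> infer_univ r False \<Gamma> A; _ \<leftarrow> infer_univ r False \<Gamma> B;
       a' \<leftarrow> check r nf \<Gamma> a A; Some (InL a') })
   | InR b \<Rightarrow> on_coprod T (\<lambda>A B. do { _ \<leftarrow> infer_univ r False \<Gamma> A; _ \<leftarrow> infer_univ r False \<Gamma> B;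
       b' \<leftarrow> check r nf \<Gamma> b B; Some (InR b') })
   | _ \<Rightarrow> None)"

definition step :: "checker \<Rightarrow> checker" where
  "step r nf \<Gamma> t E = (case E of None \<Rightarrow> infer r nf \<Gamma> t
     | Some T \<Rightarrow> if needs_type t \<or> is_lam t
         then do { T' \<leftarrow> expose r \<Gamma> T; t' \<leftarrow> check_intro r nf \<Gamma> t T'; Some (t', T) }
         else do { (t', S) \<leftarrow> r nf \<Gamma> t None; _ \<leftarrow> subtype r \<Gamma> S T; Some (t', T) })"

text \<open>Recursion fuel \<open>2 ^ m\<close>, arranged so that the evaluated terms mention only \<open>m\<close>.\<close>

primrec iter2 :: "nat \<Rightarrow> checker \<Rightarrow> checker" where
  "iter2 0 r = step r"
| "iter2 (Suc m) r = iter2 m (iter2 m r)"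

section \<open>Soundness of the type checker\<close>

definition no_check :: checker where
  "no_check nf \<Gamma> t E = None"

text \<open>Only the input \<open>t\<close> is claimed to be typed. About the normal form
  \<open>t'\<close> nothing but the judgmental equality is asserted, so no result on the typing of
  the right-hand sides of equations is required; a part of a normal form is checked again before a
  rule needs its type.\<close>

definition sound :: "checker \<Rightarrow> bool" where
  "sound r \<longleftrightarrow> (\<forall>nf \<Gamma> t E t' T. \<turnstile> \<Gamma> ctx \<longrightarrow> r nf \<Gamma> t E = Some (t', T) \<longrightarrow>
     \<Gamma> \<turnstile> t \<Colon> T \<and> \<Gamma> \<turnstile> t \<doteq> t' \<Colon> T \<and> (\<forall>S. E = Some S \<longrightarrow> S = T))"

lemma soundD:
  "sound r \<Longrightarrow> \<turnstile> \<Gamma> ctx \<Longrightarrow> r nf \<Gamma> t E = Some (t', T) \<Longrightarrow> \<Gamma> \<turnstile> t \<Colon> T \<and> \<Gamma> \<turnstile> t \<doteq> t' \<Colon> T"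
  unfolding sound_def by blast

lemma lookup_Some: "lookup \<Gamma> k = Some A \<Longrightarrow> k < length \<Gamma> \<and> \<Gamma> ! k = A"
  by (induction \<Gamma> arbitrary: k) (auto split: nat.splits)

lemma on_Some:
  "on_univ T ku = Some y \<Longrightarrow> \<exists>i. T = Univ i \<and> ku i = Some y"
  "on_pi T k = Some y \<Longrightarrow> \<exists>A B. T = Pi A B \<and> k A B = Some y"
  "on_sig T k = Some y \<Longrightarrow> \<exists>A B. T = Sig A B \<and> k A B = Some y"
  "on_coprod T k = Some y \<Longrightarrow> \<exists>A B. T = Coprod A B \<and> k A B = Some y"
  "on_id T k1 = Some y \<Longrightarrow> \<exists>A a b. T = Id A a b \<and> k1 A = Some y"
  "on_trunc T k1 = Some y \<Longrightarrow> \<exists>A. T = Trunc A \<and> k1 A = Some y"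
  by (auto simp: on_univ_def on_pi_def on_sig_def on_coprod_def on_id_def on_trunc_def split: tm.splits)

lemma asc_sound:
  assumes "\<Gamma> \<turnstile> A \<Colon> Univ i" "\<Gamma> \<turnstile> a \<Colon> A"
  shows "\<Gamma> \<turnstile> asc A a \<Colon> A" "\<Gamma> \<turnstile> asc A a \<doteq> a \<Colon> A"
proof -
  have v: "A # \<Gamma> \<turnstile> Var 0 \<Colon> A\<up>" using vble[OF ctx_ext[OF assms(1)], of 0] by simp
  show "\<Gamma> \<turnstile> asc A a \<Colon> A" unfolding asc_def using pi_elim[OF pi_intro[OF v] assms(2)] by simp
  show "\<Gamma> \<turnstile> asc A a \<doteq> a \<Colon> A" unfolding asc_def using pi_comp[OF v assms(2)] by simp
qed

lemma wrap_sound: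
  assumes "needs_type a \<Longrightarrow> \<Gamma> \<turnstile> A \<Colon> Univ i" "\<Gamma> \<turnstile> a \<Colon> A"
  shows "\<Gamma> \<turnstile> wrap A a \<Colon> A" "\<Gamma> \<turnstile> wrap A a \<doteq> a \<Colon> A"
  using asc_sound assms eq_refl unfolding wrap_def by auto

context
  fixes r :: checker
  assumes r: "sound r"
begin

context
  fixes \<Gamma> :: "tm list"
  assumes \<Gamma>: "\<turnstile> \<Gamma> ctx"
begin

lemma normal_type_sound: "normal_type r \<Gamma> T = Some N \<Longrightarrow> \<exists>i. \<Gamma> \<turnstile> T \<doteq> N \<Colon> Univ i"
  using soundD[OF r \<Gamma>] by (fastforce simp: normal_type_def bind_eq_Some_conv dest!: on_Some)

lemma expose_sound: "expose r \<Gamma> T = Some T' \<Longrightarrow> T' = T \<or> (\<exists>i. \<Gamma> \<turnstile> T \<doteq> T' \<Colon> Univ i)"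
  using normal_type_sound by (auto simp: expose_def split: if_splits)

lemma expose_conv:
  assumes "expose r \<Gamma> T = Some T'"
  shows "\<Gamma> \<turnstile> a \<Colon> T \<longleftrightarrow> \<Gamma> \<turnstile> a \<Colon> T'" "\<Gamma> \<turnstile> a \<doteq> b \<Colon> T \<longleftrightarrow> \<Gamma> \<turnstile> a \<doteq> b \<Colon> T'"
  using expose_sound[OF assms] by (meson conv eq_conv eq_sym)+

lemma infer_univ_sound: "infer_univ r nf \<Gamma> A = Some (A', i) \<Longrightarrow> \<Gamma> \<turnstile> A \<Colon> Univ i \<and> \<Gamma> \<turnstile> A \<doteq> A' \<Colon> Univ i"
  using soundD[OF r \<Gamma>] expose_conv by (fastforce simp: infer_univ_def bind_eq_Some_conv dest!: on_Some)

lemma level_le_cumul: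
  assumes "level_le T S"
  shows "\<Gamma> \<turnstile> a \<Colon> T \<Longrightarrow> \<Gamma> \<turnstile> a \<Colon> S" "\<Gamma> \<turnstile> a \<doteq> b \<Colon> T \<Longrightarrow> \<Gamma> \<turnstile> a \<doteq> b \<Colon> S"
  using assms cumul by (auto simp: level_le_def if_univ_def split: tm.splits)

lemma subtype_sound:
  assumes "subtype r \<Gamma> T S = Some u"
  shows "\<Gamma> \<turnstile> a \<Colon> T \<Longrightarrow> \<Gamma> \<turnstile> a \<Colon> S" "\<Gamma> \<turnstile> a \<doteq> b \<Colon> T \<Longrightarrow> \<Gamma> \<turnstile> a \<doteq> b \<Colon> S"
proof -
  have "level_le T S \<or> (\<exists>i j T' S'. \<Gamma> \<turnstile> T \<doteq> T' \<Colon> Univ i \<and> level_le T' S' \<and> \<Gamma> \<turnstile> S \<doteq> S' \<Colon> Univ j)"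
  proof (cases "level_le T S")
    case False
    then obtain T' S' where "normal_type r \<Gamma> T = Some T'" "normal_type r \<Gamma> S = Some S'" "level_le T' S'"
      using assms by (auto simp: subtype_def bind_eq_Some_conv split: if_splits)
    then show ?thesis using normal_type_sound by blast
  qed simp
  then show "\<Gamma> \<turnstile> a \<Colon> T \<Longrightarrow> \<Gamma> \<turnstile> a \<Colon> S" "\<Gamma> \<turnstile> a \<doteq> b \<Colon> T \<Longrightarrow> \<Gamma> \<turnstile> a \<doteq> b \<Colon> S"
    by (meson level_le_cumul conv eq_conv eq_sym)+
qed

lemma equal_types_sound: "equal_types r \<Gamma> T S = Some u \<Longrightarrow> \<exists>i. \<Gamma> \<turnstile> T \<doteq> S \<Colon> Univ i"
proof -
  assume "equal_types r \<Gamma> T S = Some u"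
  then obtain N i j where "\<Gamma> \<turnstile> T \<doteq> N \<Colon> Univ i" "\<Gamma> \<turnstile> S \<doteq> N \<Colon> Univ j"
    using normal_type_sound by (fastforce simp: equal_types_def bind_eq_Some_conv split: if_splits)
  then have "\<Gamma> \<turnstile> T \<doteq> N \<Colon> Univ (max i j)" "\<Gamma> \<turnstile> S \<doteq> N \<Colon> Univ (max i j)" using cumul(2)[of i "max i j"] cumul(2)[of j "max i j"] by auto
  then show ?thesis using eq_sym eq_trans by blast
qed

lemma check_sound: "check r nf \<Gamma> t T = Some t' \<Longrightarrow> \<Gamma> \<turnstile> t \<Colon> T \<and> \<Gamma> \<turnstile> t \<doteq> t' \<Colon> T"
  using r \<Gamma> unfolding sound_def by (fastforce simp: check_def bind_eq_Some_conv)

end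

context
  fixes \<Gamma> :: "tm list"
  assumes \<Gamma>: "\<turnstile> \<Gamma> ctx"
begin

lemma infer_sound:
  assumes "infer r nf \<Gamma> t = Some (t', T)"
  shows "\<Gamma> \<turnstile> t \<Colon> T \<and> \<Gamma> \<turnstile> t \<doteq> t' \<Colon> T"
proof (cases t)
  case (Var k)
  with assms obtain A where "lookup \<Gamma> k = Some A" and t: "t' = Var k" "T = shift (Suc k) A"
    by (auto simp: Let_def bind_eq_Some_conv)
  then have "\<Gamma> \<turnstile> Var k \<Colon> shift (Suc k) A" using vble[OF \<Gamma>] lookup_Some by blast
  then show ?thesis using t Var eq_refl by simp
next
  case (Univ i)
  then show ?thesis using assms univ_intro[OF \<Gamma>] eq_refl by auto
next
  case (Pi A B)
  with assms obtain A' B' i j where u: "infer_univ r nf \<Gamma> A = Some (A', i)" "infer_univ r nf (A # \<Gamma>) B = Some (B', j)"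
    and t: "t' = Pi A' B'" "T = Univ (max i j)"
    by (auto simp: Let_def bind_eq_Some_conv)
  have A: "\<Gamma> \<turnstile> A \<Colon> Univ i" "\<Gamma> \<turnstile> A \<doteq> A' \<Colon> Univ i" using infer_univ_sound[OF \<Gamma> u(1)] by auto
  have B: "A # \<Gamma> \<turnstile> B \<Colon> Univ j" "A # \<Gamma> \<turnstile> B \<doteq> B' \<Colon> Univ j"
    using infer_univ_sound[OF ctx_ext[OF A(1)] u(2)] by auto
  show ?thesis unfolding Pi t
    by (intro conjI pi_form pi_form_eq; rule cumul[rotated]; (rule A B)?; simp)
next
  case (Sig A B)
  with assms obtain A' B' i j where u: "infer_univ r nf \<Gamma> A = Some (A', i)" "infer_univ r nf (A # \<Gamma>) B = Some (B', j)"
    and t: "t' = Sig A' B'" "T = Univ (max i j)"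
    by (auto simp: Let_def bind_eq_Some_conv)
  have A: "\<Gamma> \<turnstile> A \<Colon> Univ i" "\<Gamma> \<turnstile> A \<doteq> A' \<Colon> Univ i" using infer_univ_sound[OF \<Gamma> u(1)] by auto
  have B: "A # \<Gamma> \<turnstile> B \<Colon> Univ j" "A # \<Gamma> \<turnstile> B \<doteq> B' \<Colon> Univ j"
    using infer_univ_sound[OF ctx_ext[OF A(1)] u(2)] by auto
  show ?thesis unfolding Sig t
    by (intro conjI sig_form sig_form_eq; rule cumul[rotated]; (rule A B)?; simp)
next
  case (Coprod A B)
  with assms obtain A' B' i j where u: "infer_univ r nf \<Gamma> A = Some (A', i)" "infer_univ r nf \<Gamma> B = Some (B', j)"
    and t: "t' = Coprod A' B'" "T = Univ (max i j)"
    by (auto simp: Let_def bind_eq_Some_conv)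
  have A: "\<Gamma> \<turnstile> A \<Colon> Univ i" "\<Gamma> \<turnstile> A \<doteq> A' \<Colon> Univ i" using infer_univ_sound[OF \<Gamma> u(1)] by auto
  have B: "\<Gamma> \<turnstile> B \<Colon> Univ j" "\<Gamma> \<turnstile> B \<doteq> B' \<Colon> Univ j"
    using infer_univ_sound[OF \<Gamma> u(2)] by auto
  show ?thesis unfolding Coprod t
    by (intro conjI coprod_form coprod_form_eq; rule cumul[rotated]; (rule A B)?; simp)
next
  case (Lam A b)
  with assms obtain A' b' i B where u: "infer_univ r nf \<Gamma> A = Some (A', i)" "r nf (A # \<Gamma>) b None = Some (b', B)"
    and t: "t' = Lam A' b'" "T = Pi A B"
    by (auto simp: Let_def bind_eq_Some_conv)
  have A: "\<Gamma> \<turnstile> A \<Colon> Univ i" "\<Gamma> \<turnstile> A \<doteq> A' \<Colon> Univ i" using infer_univ_sound[OF \<Gamma> u(1)] by auto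
  have "A # \<Gamma> \<turnstile> b \<Colon> B \<and> A # \<Gamma> \<turnstile> b \<doteq> b' \<Colon> B" using soundD[OF r ctx_ext[OF A(1)] u(2)] .
  then show ?thesis unfolding Lam t using A pi_intro pi_intro_eq by blast
next
  case (App f a)
  show ?thesis
  proof (cases "\<exists>A. f = Lam A (Var 0)")
    case True
    then obtain A where f: "f = Lam A (Var 0)" by blast
    with assms App obtain A' i a' where u: "infer_univ r False \<Gamma> A = Some (A', i)" "check r nf \<Gamma> a A = Some a'"
      and t: "t' = (if nf then a' else App f a)" "T = A"
      by (auto simp: Let_def bind_eq_Some_conv if_lam_def if_var0_def)
    have A: "\<Gamma> \<turnstile> A \<Colon> Univ i" using infer_univ_sound[OF \<Gamma> u(1)] by simp
    have a: "\<Gamma> \<turnstile> a \<Colon> A" "\<Gamma> \<turnstile> a \<doteq> a' \<Colon> A" using check_sound[OF \<Gamma> u(2)] by auto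
    note s = asc_sound[OF A a(1), unfolded asc_def]
    show ?thesis unfolding App f t using s eq_trans[OF s(2) a(2)] eq_refl[OF s(1)] by simp
  next
    case False
    have "infer r nf \<Gamma> t = infer_app r nf \<Gamma> f a"
      using False App by (auto simp: if_lam_def if_var0_def split: tm.splits nat.splits)
    with assms obtain f' F F' where u: "r nf \<Gamma> f None = Some (f', F)" "expose r \<Gamma> F = Some F'"
      and on: "on_pi F' (\<lambda>A B. do { a' \<leftarrow> check r nf \<Gamma> a A;
       _ \<leftarrow> (if needs_type a then do { _ \<leftarrow> infer_univ r False \<Gamma> A; infer_univ r False (A # \<Gamma>) B } else Some (A, 0));
       red_app r nf \<Gamma> f' (wrap A a) A B (B\<lbrakk>wrap A a\<rbrakk>) (Some (App f' a', B\<lbrakk>wrap A a\<rbrakk>)) }) = Some (t', T)"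
      by (auto simp: infer_app_def Let_def bind_eq_Some_conv)
    from on obtain A B a' where F': "F' = Pi A B" and ca: "check r nf \<Gamma> a A = Some a'"
      and w: "needs_type a \<Longrightarrow> (\<exists>x i. infer_univ r False \<Gamma> A = Some (x, i)) \<and> (\<exists>x i. infer_univ r False (A # \<Gamma>) B = Some (x, i))"
      and res: "red_app r nf \<Gamma> f' (wrap A a) A B (B\<lbrakk>wrap A a\<rbrakk>) (Some (App f' a', B\<lbrakk>wrap A a\<rbrakk>)) = Some (t', T)"
      by (auto simp: Let_def bind_eq_Some_conv dest!: on_Some split: if_splits)
    have f: "\<Gamma> \<turnstile> f \<Colon> Pi A B" "\<Gamma> \<turnstile> f \<doteq> f' \<Colon> Pi A B"
      using soundD[OF r \<Gamma> u(1)] expose_conv[OF \<Gamma> u(2)] F' by blast+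
    have a: "\<Gamma> \<turnstile> a \<Colon> A" "\<Gamma> \<turnstile> a \<doteq> a' \<Colon> A" using check_sound[OF \<Gamma> ca] by auto
    have ws: "\<Gamma> \<turnstile> wrap A a \<Colon> A \<and> \<Gamma> \<turnstile> wrap A a \<doteq> a \<Colon> A"
    proof (cases "needs_type a")
      case True
      then show ?thesis using w infer_univ_sound[OF \<Gamma>] wrap_sound a(1) by blast
    qed (simp add: wrap_def a eq_refl)
    \<comment> \<open>The elimination rule gives the type at \<open>a\<close>, the checker reports
      it at \<open>wrap A a\<close>; this equality transports everything from one to the
      other.\<close>
    have tyeq: "wrap A a = a \<or> (\<exists>i. \<Gamma> \<turnstile> B\<lbrakk>a\<rbrakk> \<doteq> B\<lbrakk>wrap A a\<rbrakk> \<Colon> Univ i)"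
    proof (cases "needs_type a")
      case True
      then obtain x i y j where "infer_univ r False \<Gamma> A = Some (x, i)" and uB: "infer_univ r False (A # \<Gamma>) B = Some (y, j)"
        using w by blast
      then have "\<Gamma> \<turnstile> A \<Colon> Univ i" using infer_univ_sound[OF \<Gamma>] by blast
      then have "A # \<Gamma> \<turnstile> B \<Colon> Univ j" using infer_univ_sound[OF ctx_ext uB] by blast
      then have "\<Gamma> \<turnstile> B\<lbrakk>a\<rbrakk> \<doteq> B\<lbrakk>wrap A a\<rbrakk> \<Colon> Univ j"
        by (rule functionality[OF _ substitution_Var[OF \<Gamma>]]) (use a ws eq_sym in simp_all)
      then show ?thesis by blast
    qed (simp add: wrap_def)
    have tr: "\<Gamma> \<turnstile> x \<Colon> B\<lbrakk>wrap A a\<rbrakk>" if "\<Gamma> \<turnstile> x \<Colon> B\<lbrakk>a\<rbrakk>" for x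
      using tyeq conv[OF that] that by auto
    have tre: "\<Gamma> \<turnstile> x \<doteq> y \<Colon> B\<lbrakk>wrap A a\<rbrakk>" if "\<Gamma> \<turnstile> x \<doteq> y \<Colon> B\<lbrakk>a\<rbrakk>" for x y
      using tyeq eq_conv[OF that] that by auto
    note app = tr[OF pi_elim[OF f(1) a(1)]] tre[OF pi_elim_eq[OF f(2) a(2)]]
      tre[OF pi_elim_eq[OF f(2) eq_sym[OF conjunct2[OF ws]]]]
    show ?thesis
    proof (cases "nf \<and> (\<exists>A' b. f' = Lam A' b)")
      case True
      then obtain A' b where f': "f' = Lam A' b" and nf by blast
      have "\<exists>v x i y. subtype r \<Gamma> A A' = Some v \<and> infer_univ r False \<Gamma> A' = Some (x, i) \<and>
        check r False (A' # \<Gamma>) b B = Some y \<and> check r True \<Gamma> (b\<lbrakk>wrap A a\<rbrakk>) (B\<lbrakk>wrap A a\<rbrakk>) = Some t' \<and>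
        T = B\<lbrakk>wrap A a\<rbrakk>"
        using res \<open>nf\<close> unfolding red_app_def f' by (simp add: if_lam_def Let_def bind_eq_Some_conv) metis
      then obtain v x i y where v: "subtype r \<Gamma> A A' = Some v" "infer_univ r False \<Gamma> A' = Some (x, i)"
        "check r False (A' # \<Gamma>) b B = Some y" "check r True \<Gamma> (b\<lbrakk>wrap A a\<rbrakk>) (B\<lbrakk>wrap A a\<rbrakk>) = Some t'"
        and T: "T = B\<lbrakk>wrap A a\<rbrakk>"
        by blast
      \<comment> \<open>The domain \<open>A'\<close> of the normalised function may differ from
        \<open>A\<close>. The argument is moved into \<open>A'\<close> by \<open>subtype\<close>,
        and the body was checked under \<open>A'\<close> against \<open>B\<close>, so the beta rule
        applies without comparing \<open>Pi A B\<close> with any other product.\<close>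
      have A': "\<Gamma> \<turnstile> A' \<Colon> Univ i" using infer_univ_sound[OF \<Gamma> v(2)] by simp
      have "A' # \<Gamma> \<turnstile> b \<Colon> B" using check_sound[OF ctx_ext[OF A'] v(3)] by simp
      from pi_comp[OF this subtype_sound(1)[OF \<Gamma> v(1)]] ws
      have "\<Gamma> \<turnstile> App f' (wrap A a) \<doteq> b\<lbrakk>wrap A a\<rbrakk> \<Colon> B\<lbrakk>wrap A a\<rbrakk>" unfolding f' by blast
      then show ?thesis using check_sound[OF \<Gamma> v(4)] app eq_trans unfolding App T by blast
    next
      case False
      then have "t' = App f' a'" "T = B\<lbrakk>wrap A a\<rbrakk>" using res by (auto simp: red_app_def if_lam_def split: if_splits tm.splits)
      then show ?thesis using app App by simp
    qed
  qed
next
  case (IndSig C g p)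
  with assms obtain p' P P' where u: "r nf \<Gamma> p None = Some (p', P)" "expose r \<Gamma> P = Some P'"
    and on: "on_sig P' (\<lambda>A B. do {
       _ \<leftarrow> infer_univ r False \<Gamma> A; _ \<leftarrow> infer_univ r False (A # \<Gamma>) B; (C', i) \<leftarrow> infer_univ r nf (Sig A B # \<Gamma>) C;
       g' \<leftarrow> check r nf (B # A # \<Gamma>) g
         (subst (asc (shift 2 (Sig A B)) (Pair (Var 1) (Var 0)) \<cdot> (\<lambda>k. Var (k + 2))) C);
       red_sig r nf \<Gamma> g p' A B (C\<lbrakk>p\<rbrakk>) (Some (IndSig C' g' p', C\<lbrakk>p\<rbrakk>)) }) = Some (t', T)"
    by (auto simp: Let_def bind_eq_Some_conv)
  from on obtain A B x i y j C' k g' where P': "P' = Sig A B"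
    and v: "infer_univ r False \<Gamma> A = Some (x, i)" "infer_univ r False (A # \<Gamma>) B = Some (y, j)"
      "infer_univ r nf (Sig A B # \<Gamma>) C = Some (C', k)"
      "check r nf (B # A # \<Gamma>) g
         (subst (asc (shift 2 (Sig A B)) (Pair (Var 1) (Var 0)) \<cdot> (\<lambda>k. Var (k + 2))) C) = Some g'"
    and res: "red_sig r nf \<Gamma> g p' A B (C\<lbrakk>p\<rbrakk>) (Some (IndSig C' g' p', C\<lbrakk>p\<rbrakk>)) = Some (t', T)"
    by (auto simp: Let_def bind_eq_Some_conv dest!: on_Some)
  have p: "\<Gamma> \<turnstile> p \<Colon> Sig A B" "\<Gamma> \<turnstile> p \<doteq> p' \<Colon> Sig A B"
    using soundD[OF r \<Gamma> u(1)] expose_conv[OF \<Gamma> u(2)] P' by blast+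
  have A: "\<Gamma> \<turnstile> A \<Colon> Univ i" using infer_univ_sound[OF \<Gamma> v(1)] by simp
  have B: "A # \<Gamma> \<turnstile> B \<Colon> Univ j" using infer_univ_sound[OF ctx_ext[OF A] v(2)] by simp
  have S: "\<Gamma> \<turnstile> Sig A B \<Colon> Univ (max i j)"
    by (rule sig_form; rule cumul[rotated]; (rule A B)?; simp)
  have C: "Sig A B # \<Gamma> \<turnstile> C \<Colon> Univ k" "Sig A B # \<Gamma> \<turnstile> C \<doteq> C' \<Colon> Univ k"
    using infer_univ_sound[OF ctx_ext[OF S] v(3)] by auto
  note wk = substitution_wk2[OF ctx_ext[OF B] ctx_ext[OF A] \<Gamma>]
  let ?w = "\<lambda>k. Var (k + 2)" and ?pr = "Pair (Var 1) (Var 0)"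
  have SS: "B # A # \<Gamma> \<turnstile> subst ?w (Sig A B) \<Colon> Univ (max i j)"
    using substitution_type[OF S wk] by simp
  have sh: "shift 2 (Sig A B) = subst ?w (Sig A B)" by (rule ren_eq_subst)
  have pr: "B # A # \<Gamma> \<turnstile> ?pr \<Colon> subst ?w (Sig A B)"
  proof -
    have wA: "B # A # \<Gamma> \<turnstile> subst ?w A \<Colon> Univ i" using substitution_type[OF A wk] by simp
    have "subst ?w A # B # A # \<Gamma> \<turnstile> subst (ups ?w) B \<Colon> Univ j"
      using substitution_type[OF B substitution_ups[OF wk wA]] by simp
    moreover have "B # A # \<Gamma> \<turnstile> Var 1 \<Colon> subst ?w A"
      using vble[OF ctx_ext[OF B], of 1] by (simp add: ren_eq_subst numeral_2_eq_2)
    \<comment> \<open>Weakening \<open>B\<close> by two and then putting \<open>Var 1\<close>, the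
      first component, for its own variable amounts to a single lift.\<close>
    moreover have "(subst (ups ?w) B)\<lbrakk>Var 1\<rbrakk> = B\<up>"
      unfolding subst_scons_ups ren_eq_subst[of Suc]
      by (rule subst_cong) (simp add: scons_def split: nat.split)
    then have "B # A # \<Gamma> \<turnstile> Var 0 \<Colon> (subst (ups ?w) B)\<lbrakk>Var 1\<rbrakk>"
      using vble[OF ctx_ext[OF B], of 0] by simp
    ultimately show ?thesis by (simp add: sig_intro)
  qed
  \<comment> \<open>The branch was checked against the motive at an ascribed pair, while
    \<open>sig_elim\<close> asks for the bare pair.\<close>
  have "B # A # \<Gamma> \<turnstile> subst (asc (shift 2 (Sig A B)) ?pr \<cdot> ?w) C \<doteq> subst (?pr \<cdot> ?w) C \<Colon> Univ k"
    unfolding sh by (rule functionality[OF C(1) wk asc_sound(1)[OF SS pr] pr asc_sound(2)[OF SS pr]])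
  then have g: "B # A # \<Gamma> \<turnstile> g \<Colon> subst (?pr \<cdot> ?w) C" "B # A # \<Gamma> \<turnstile> g \<doteq> g' \<Colon> subst (?pr \<cdot> ?w) C"
    using check_sound[OF ctx_ext[OF B] v(4)] conv eq_conv by blast+
  show ?thesis
  proof (cases "nf \<and> (\<exists>a b. p' = Pair a b)")
    case True
    then obtain a b where p': "p' = Pair a b" and nf by blast
    let ?a = "wrap A a" let ?b = "wrap (B\<lbrakk>?a\<rbrakk>) b"
    have "\<exists>a' b'. check r False \<Gamma> a A = Some a' \<and> check r False \<Gamma> b (B\<lbrakk>?a\<rbrakk>) = Some b' \<and>
        check r True \<Gamma> (subst (?b \<cdot> ?a \<cdot> Var) g) (C\<lbrakk>p\<rbrakk>) = Some t' \<and> T = C\<lbrakk>p\<rbrakk>"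
      using res \<open>nf\<close> unfolding red_sig_def p' by (simp add: if_pair_def Let_def bind_eq_Some_conv) metis
    then obtain a' b' where c: "check r False \<Gamma> a A = Some a'"
      "check r False \<Gamma> b (B\<lbrakk>?a\<rbrakk>) = Some b'" "check r True \<Gamma> (subst (?b \<cdot> ?a \<cdot> Var) g) (C\<lbrakk>p\<rbrakk>) = Some t'"
      and T: "T = C\<lbrakk>p\<rbrakk>"
      by blast
    have a: "\<Gamma> \<turnstile> a \<Colon> A" using check_sound[OF \<Gamma> c(1)] by simp
    note wa = wrap_sound[OF A a]
    have b: "\<Gamma> \<turnstile> b \<Colon> B\<lbrakk>?a\<rbrakk>" using check_sound[OF \<Gamma> c(2)] by simp
    have Ba: "\<Gamma> \<turnstile> B\<lbrakk>?a\<rbrakk> \<Colon> Univ j" using substitution_inst[OF B \<Gamma> wa(1)] by simp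
    note wb = wrap_sound[OF Ba b]
    have pr': "\<Gamma> \<turnstile> Pair ?a ?b \<Colon> Sig A B" using sig_intro[OF B wa(1) wb(1)] .
    have peq: "\<Gamma> \<turnstile> p \<doteq> Pair ?a ?b \<Colon> Sig A B"
      using eq_trans[OF p(2)] sig_intro_eq[OF B wa(2) wb(2)] eq_sym unfolding p' by blast
    have "\<Gamma> \<turnstile> C\<lbrakk>p\<rbrakk> \<doteq> C\<lbrakk>Pair ?a ?b\<rbrakk> \<Colon> Univ k"
      by (rule functionality[OF C(1) substitution_Var[OF \<Gamma>]]) (use p pr' peq in simp_all)
    then have "\<Gamma> \<turnstile> IndSig C g (Pair ?a ?b) \<doteq> subst (?b \<cdot> ?a \<cdot> Var) g \<Colon> C\<lbrakk>p\<rbrakk>"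
      using sig_comp[OF C(1) g(1) wa(1) wb(1)] eq_conv eq_sym by blast
    moreover have "\<Gamma> \<turnstile> IndSig C g p \<doteq> IndSig C g (Pair ?a ?b) \<Colon> C\<lbrakk>p\<rbrakk>"
      using sig_elim_eq[OF eq_refl[OF C(1)] eq_refl[OF g(1)] peq] .
    ultimately show ?thesis unfolding IndSig T
      using check_sound[OF \<Gamma> c(3)] sig_elim[OF C(1) g(1) p(1)] eq_trans by blast
  next
    case False
    then have "t' = IndSig C' g' p'" "T = C\<lbrakk>p\<rbrakk>" using res by (auto simp: red_sig_def if_pair_def split: if_splits tm.splits)
    then show ?thesis using sig_elim[OF C(1) g(1) p(1)] sig_elim_eq[OF C(2) g(2) p(2)] IndSig by simp
  qed
next
  case (IndCoprod C c d p)
  with assms obtain p' P P' where u: "r nf \<Gamma> p None = Some (p', P)" "expose r \<Gamma> P = Some P'"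
    and on: "on_coprod P' (\<lambda>A B. do {
       _ \<leftarrow> infer_univ r False \<Gamma> A; _ \<leftarrow> infer_univ r False \<Gamma> B; (C', i) \<leftarrow> infer_univ r nf (Coprod A B # \<Gamma>) C;
       c' \<leftarrow> check r nf (A # \<Gamma>) c (subst (asc (Coprod A B)\<up> (InL (Var 0)) \<cdot> (\<lambda>k. Var (k + 1))) C);
       d' \<leftarrow> check r nf (B # \<Gamma>) d (subst (asc (Coprod A B)\<up> (InR (Var 0)) \<cdot> (\<lambda>k. Var (k + 1))) C);
       red_coprod r nf \<Gamma> c d p' A B (C\<lbrakk>p\<rbrakk>) (Some (IndCoprod C' c' d' p', C\<lbrakk>p\<rbrakk>)) }) = Some (t', T)"
    by (auto simp: Let_def bind_eq_Some_conv)
  from on obtain A B x i y j C' k c' d' where P': "P' = Coprod A B"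
    and v: "infer_univ r False \<Gamma> A = Some (x, i)" "infer_univ r False \<Gamma> B = Some (y, j)"
      "infer_univ r nf (Coprod A B # \<Gamma>) C = Some (C', k)"
      "check r nf (A # \<Gamma>) c (subst (asc (Coprod A B)\<up> (InL (Var 0)) \<cdot> (\<lambda>k. Var (k + 1))) C) = Some c'"
      "check r nf (B # \<Gamma>) d (subst (asc (Coprod A B)\<up> (InR (Var 0)) \<cdot> (\<lambda>k. Var (k + 1))) C) = Some d'"
    and res: "red_coprod r nf \<Gamma> c d p' A B (C\<lbrakk>p\<rbrakk>) (Some (IndCoprod C' c' d' p', C\<lbrakk>p\<rbrakk>)) = Some (t', T)"
    by (auto simp: Let_def bind_eq_Some_conv dest!: on_Some)
  have p: "\<Gamma> \<turnstile> p \<Colon> Coprod A B" "\<Gamma> \<turnstile> p \<doteq> p' \<Colon> Coprod A B"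
    using soundD[OF r \<Gamma> u(1)] expose_conv[OF \<Gamma> u(2)] P' by blast+
  let ?m = "max i j" and ?w = "\<lambda>k. Var (k + 1)"
  have A: "\<Gamma> \<turnstile> A \<Colon> Univ ?m" and B: "\<Gamma> \<turnstile> B \<Colon> Univ ?m"
    using infer_univ_sound[OF \<Gamma> v(1)] infer_univ_sound[OF \<Gamma> v(2)] cumul(1)[of i ?m] cumul(1)[of j ?m] by auto
  have S: "\<Gamma> \<turnstile> Coprod A B \<Colon> Univ ?m" using A B by (rule coprod_form)
  have C: "Coprod A B # \<Gamma> \<turnstile> C \<Colon> Univ k" "Coprod A B # \<Gamma> \<turnstile> C \<doteq> C' \<Colon> Univ k"
    using infer_univ_sound[OF ctx_ext[OF S] v(3)] by auto
  \<comment> \<open>Stated for an arbitrary summand \<open>X\<close>, since both branches were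
    checked against the motive at an ascribed injection.\<close>
  have motive: "X # \<Gamma> \<turnstile> subst (asc (Coprod A B)\<up> z \<cdot> ?w) C \<doteq> subst (z \<cdot> ?w) C \<Colon> Univ k"
    if X: "\<Gamma> \<turnstile> X \<Colon> Univ ?m" and z: "X # \<Gamma> \<turnstile> z \<Colon> (Coprod A B)\<up>" for X z
  proof (rule functionality[OF C(1) substitution_wk1[OF ctx_ext[OF X] \<Gamma>]])
    have "X # \<Gamma> \<turnstile> (Coprod A B)\<up> \<Colon> Univ ?m" using weakening(1)[OF ctx_ext[OF X] S] by simp
    from asc_sound[OF this z] z
    show "X # \<Gamma> \<turnstile> asc (Coprod A B)\<up> z \<Colon> subst ?w (Coprod A B)"
      "X # \<Gamma> \<turnstile> z \<Colon> subst ?w (Coprod A B)"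
      "X # \<Gamma> \<turnstile> asc (Coprod A B)\<up> z \<doteq> z \<Colon> subst ?w (Coprod A B)"
      by (simp_all add: ren_eq_subst)
  qed
  have "A # \<Gamma> \<turnstile> InL (Var 0) \<Colon> (Coprod A B)\<up>"
    using coprod_intro1[OF weakening(1)[OF ctx_ext[OF A] A, simplified] weakening(1)[OF ctx_ext[OF A] B, simplified]]
      vble[OF ctx_ext[OF A], of 0] by simp
  from motive[OF A this]
  have c: "A # \<Gamma> \<turnstile> c \<Colon> subst (InL (Var 0) \<cdot> ?w) C" "A # \<Gamma> \<turnstile> c \<doteq> c' \<Colon> subst (InL (Var 0) \<cdot> ?w) C"
    using check_sound[OF ctx_ext[OF A] v(4)] conv eq_conv by blast+
  have "B # \<Gamma> \<turnstile> InR (Var 0) \<Colon> (Coprod A B)\<up>"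
    using coprod_intro2[OF weakening(1)[OF ctx_ext[OF B] A, simplified] weakening(1)[OF ctx_ext[OF B] B, simplified]]
      vble[OF ctx_ext[OF B], of 0] by simp
  from motive[OF B this]
  have d: "B # \<Gamma> \<turnstile> d \<Colon> subst (InR (Var 0) \<cdot> ?w) C" "B # \<Gamma> \<turnstile> d \<doteq> d' \<Colon> subst (InR (Var 0) \<cdot> ?w) C"
    using check_sound[OF ctx_ext[OF B] v(5)] conv eq_conv by blast+
  note elim = coprod_elim[OF C(1) c(1) d(1) p(1)]
  have congr: "\<Gamma> \<turnstile> IndCoprod C c d p \<doteq> IndCoprod C c d q \<Colon> C\<lbrakk>p\<rbrakk> \<and> \<Gamma> \<turnstile> C\<lbrakk>q\<rbrakk> \<doteq> C\<lbrakk>p\<rbrakk> \<Colon> Univ k"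
    if "\<Gamma> \<turnstile> q \<Colon> Coprod A B" "\<Gamma> \<turnstile> p \<doteq> q \<Colon> Coprod A B" for q
    using coprod_elim_eq[OF eq_refl[OF C(1)] eq_refl[OF c(1)] eq_refl[OF d(1)] that(2)]
      functionality[OF C(1) substitution_Var[OF \<Gamma>], of q p] that p eq_sym by simp
  consider a where "nf" "p' = InL a" | b where "nf" "p' = InR b"
    | "Some (IndCoprod C' c' d' p', C\<lbrakk>p\<rbrakk>) = Some (t', T)"
    using res by (auto simp: red_coprod_def if_inj_def split: if_splits tm.splits)
  then show ?thesis
  proof cases
    case (1 a)
    have "\<exists>y. check r False \<Gamma> a A = Some y \<and> check r True \<Gamma> (c\<lbrakk>wrap A a\<rbrakk>) (C\<lbrakk>p\<rbrakk>) = Some t' \<and> T = C\<lbrakk>p\<rbrakk>"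
      using res \<open>nf\<close> unfolding red_coprod_def 1(2) by (simp add: if_inj_def Let_def bind_eq_Some_conv) metis
    then obtain y where e: "check r False \<Gamma> a A = Some y" "check r True \<Gamma> (c\<lbrakk>wrap A a\<rbrakk>) (C\<lbrakk>p\<rbrakk>) = Some t'"
      and T: "T = C\<lbrakk>p\<rbrakk>"
      by blast
    have a: "\<Gamma> \<turnstile> a \<Colon> A" using check_sound[OF \<Gamma> e(1)] by simp
    note wa = wrap_sound[OF A a]
    have "\<Gamma> \<turnstile> p \<doteq> InL (wrap A a) \<Colon> Coprod A B"
      using eq_trans[OF p(2)] coprod_intro1_eq[OF A B eq_sym[OF wa(2)]] 1 by simp
    then have "\<Gamma> \<turnstile> IndCoprod C c d p \<doteq> c\<lbrakk>wrap A a\<rbrakk> \<Colon> C\<lbrakk>p\<rbrakk>"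
      using congr coprod_intro1[OF A B wa(1)] coprod_comp1[OF C(1) c(1) d(1) wa(1)] eq_conv eq_trans by blast
    then show ?thesis using check_sound[OF \<Gamma> e(2)] elim eq_trans IndCoprod T by blast
  next
    case (2 b)
    have "\<exists>y. check r False \<Gamma> b B = Some y \<and> check r True \<Gamma> (d\<lbrakk>wrap B b\<rbrakk>) (C\<lbrakk>p\<rbrakk>) = Some t' \<and> T = C\<lbrakk>p\<rbrakk>"
      using res \<open>nf\<close> unfolding red_coprod_def 2(2) by (simp add: if_inj_def Let_def bind_eq_Some_conv) metis
    then obtain y where e: "check r False \<Gamma> b B = Some y" "check r True \<Gamma> (d\<lbrakk>wrap B b\<rbrakk>) (C\<lbrakk>p\<rbrakk>) = Some t'"
      and T: "T = C\<lbrakk>p\<rbrakk>"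
      by blast
    have b: "\<Gamma> \<turnstile> b \<Colon> B" using check_sound[OF \<Gamma> e(1)] by simp
    note wb = wrap_sound[OF B b]
    have "\<Gamma> \<turnstile> p \<doteq> InR (wrap B b) \<Colon> Coprod A B"
      using eq_trans[OF p(2)] coprod_intro2_eq[OF A B eq_sym[OF wb(2)]] 2 by simp
    then have "\<Gamma> \<turnstile> IndCoprod C c d p \<doteq> d\<lbrakk>wrap B b\<rbrakk> \<Colon> C\<lbrakk>p\<rbrakk>"
      using congr coprod_intro2[OF A B wb(1)] coprod_comp2[OF C(1) c(1) d(1) wb(1)] eq_conv eq_trans by blast
    then show ?thesis using check_sound[OF \<Gamma> e(2)] elim eq_trans IndCoprod T by blast
  next
    case 3
    then show ?thesis using elim coprod_elim_eq[OF C(2) c(2) d(2) p(2)] IndCoprod by simp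
  qed
next
  case Empty
  then show ?thesis using assms empty_form[OF \<Gamma>] eq_refl by auto
next
  case (IndEmpty C p)
  with assms obtain p' C' i where u: "check r nf \<Gamma> p Empty = Some p'" "infer_univ r nf (Empty # \<Gamma>) C = Some (C', i)"
    and t: "t' = IndEmpty C' p'" "T = C\<lbrakk>p\<rbrakk>"
    by (auto simp: Let_def bind_eq_Some_conv)
  have "Empty # \<Gamma> \<turnstile> C \<Colon> Univ i \<and> Empty # \<Gamma> \<turnstile> C \<doteq> C' \<Colon> Univ i"
    using infer_univ_sound[OF ctx_ext[OF empty_form[OF \<Gamma>]] u(2)] .
  then show ?thesis unfolding IndEmpty t using check_sound[OF \<Gamma> u(1)] empty_elim empty_elim_eq by blast
next
  case (Id A a b)
  with assms obtain A' i a' b' where u: "infer_univ r nf \<Gamma> A = Some (A', i)" "check r nf \<Gamma> a A = Some a'"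
    "check r nf \<Gamma> b A = Some b'" and t: "t' = Id A' a' b'" "T = Univ i"
    by (auto simp: Let_def bind_eq_Some_conv)
  then show ?thesis unfolding Id t
    using infer_univ_sound[OF \<Gamma> u(1)] check_sound[OF \<Gamma> u(2)] check_sound[OF \<Gamma> u(3)] id_form id_form_eq by blast
next
  case (Refl a)
  with assms obtain a' A x i where u: "r nf \<Gamma> a None = Some (a', A)" "infer_univ r False \<Gamma> A = Some (x, i)"
    and t: "t' = Refl a'" "T = Id A a a"
    by (auto simp: Let_def bind_eq_Some_conv)
  then show ?thesis unfolding Refl t
    using infer_univ_sound[OF \<Gamma> u(2)] soundD[OF r \<Gamma> u(1)] id_intro id_intro_eq by blast
next
  case (IndId C c a b p)
  let ?I = "\<lambda>A. Id A\<up>\<up> (Var 1) (Var 0) # A\<up> # A # \<Gamma>"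
  let ?mot = "subst (Refl (Var 0) \<cdot> Var 0 \<cdot> Var 0 \<cdot> (\<lambda>k. Var (k + 1))) C"
  let ?T = "subst (p \<cdot> b \<cdot> a \<cdot> Var) C"
  from IndId assms obtain p' P P' where u: "r nf \<Gamma> p None = Some (p', P)" "expose r \<Gamma> P = Some P'"
    and on: "on_id P' (\<lambda>A. do {
       _ \<leftarrow> infer_univ r False \<Gamma> A; a' \<leftarrow> check r nf \<Gamma> a A; b' \<leftarrow> check r nf \<Gamma> b A;
       _ \<leftarrow> subtype r \<Gamma> P' (Id A a b);
       (C', i) \<leftarrow> infer_univ r nf (?I A) C;
       c' \<leftarrow> check r nf (A # \<Gamma>) c ?mot;
       red_id r nf \<Gamma> c a a' b' p' ?T (Some (IndId C' c' a' b' p', ?T)) }) = Some (t', T)"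
    by (auto simp: Let_def bind_eq_Some_conv)
  from on obtain A x y z i a' b' v C' j c' where P': "P' = Id A y z"
    and v: "infer_univ r False \<Gamma> A = Some (x, i)" "check r nf \<Gamma> a A = Some a'" "check r nf \<Gamma> b A = Some b'"
      "subtype r \<Gamma> P' (Id A a b) = Some v" "infer_univ r nf (?I A) C = Some (C', j)"
      "check r nf (A # \<Gamma>) c ?mot = Some c'"
    and res: "red_id r nf \<Gamma> c a a' b' p' ?T (Some (IndId C' c' a' b' p', ?T)) = Some (t', T)"
    by (auto simp: Let_def bind_eq_Some_conv dest!: on_Some)
  have p: "\<Gamma> \<turnstile> p \<Colon> Id A a b" "\<Gamma> \<turnstile> p \<doteq> p' \<Colon> Id A a b"
    using soundD[OF r \<Gamma> u(1)] expose_conv[OF \<Gamma> u(2)] subtype_sound[OF \<Gamma> v(4)] by blast+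
  have A: "\<Gamma> \<turnstile> A \<Colon> Univ i" using infer_univ_sound[OF \<Gamma> v(1)] by simp
  have A1: "A # \<Gamma> \<turnstile> A\<up> \<Colon> Univ i" using weakening(1)[OF ctx_ext[OF A] A] by simp
  have A2: "A\<up> # A # \<Gamma> \<turnstile> A\<up>\<up> \<Colon> Univ i" using weakening(1)[OF ctx_ext[OF A1] A1] by simp
  have "A\<up> # A # \<Gamma> \<turnstile> Var 0 \<Colon> A\<up>\<up>" "A\<up> # A # \<Gamma> \<turnstile> Var 1 \<Colon> A\<up>\<up>"
    using vble[OF ctx_ext[OF A1], of 0] vble[OF ctx_ext[OF A1], of 1] by (simp_all add: ren_ren comp_def)
  then have I: "\<turnstile> ?I A ctx" using A2 id_form ctx_ext by blast
  have C: "?I A \<turnstile> C \<Colon> Univ j" "?I A \<turnstile> C \<doteq> C' \<Colon> Univ j" using infer_univ_sound[OF I v(5)] by auto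
  have c: "A # \<Gamma> \<turnstile> c \<Colon> ?mot" "A # \<Gamma> \<turnstile> c \<doteq> c' \<Colon> ?mot" using check_sound[OF ctx_ext[OF A] v(6)] by auto
  have a: "\<Gamma> \<turnstile> a \<Colon> A" "\<Gamma> \<turnstile> a \<doteq> a' \<Colon> A" using check_sound[OF \<Gamma> v(2)] by auto
  have b: "\<Gamma> \<turnstile> b \<Colon> A" "\<Gamma> \<turnstile> b \<doteq> b' \<Colon> A" using check_sound[OF \<Gamma> v(3)] by auto
  show ?thesis
  proof (cases "nf \<and> (\<exists>q. p' = Refl q)")
    case True
    then obtain q where q: "p' = Refl q" and nf by blast
    have "(a' = q \<and> b' = q) \<and> check r True \<Gamma> (c\<lbrakk>a\<rbrakk>) ?T = Some t' \<and> T = ?T"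
      using res \<open>nf\<close> unfolding red_id_def q by (auto simp: if_refl_def Let_def bind_eq_Some_conv split: if_splits)
    then have p': "p' = Refl a'" "b' = a'" and k: "check r True \<Gamma> (c\<lbrakk>a\<rbrakk>) ?T = Some t'" and T: "T = ?T"
      using q by auto
    \<comment> \<open>The two endpoints share the normal form \<open>q\<close>, hence are
      judgmentally equal, although \<open>id_comp\<close> is stated for one and the same term at
      both ends.\<close>
    have ba: "\<Gamma> \<turnstile> b \<doteq> a \<Colon> A" using b(2) a(2) p' eq_sym eq_trans by metis
    have "\<Gamma> \<turnstile> Id A a a \<doteq> Id A a b \<Colon> Univ i"
      by (rule id_form_eq) (use A a ba eq_refl eq_sym in blast)+
    then have "\<Gamma> \<turnstile> Refl a' \<doteq> Refl a \<Colon> Id A a b"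
      using id_intro_eq[OF A a(2)] eq_sym eq_conv by blast
    then have pr: "\<Gamma> \<turnstile> p \<doteq> Refl a \<Colon> Id A a b" using p(2) p' eq_trans by blast
    have cong: "\<Gamma> \<turnstile> IndId C c a b p \<doteq> IndId C c a a (Refl a) \<Colon> ?T"
      using id_elim_eq[OF eq_refl[OF C(1)] eq_refl[OF c(1)] eq_refl[OF a(1)] ba pr] .
    have "\<Gamma> \<turnstile> IndId C c a a (Refl a) \<doteq> c\<lbrakk>a\<rbrakk> \<Colon> ?T"
      using id_comp[OF C(1) c(1) a(1)] id_elim_type_cong[OF C(1) \<Gamma> A a(1) b(1) p(1) ba pr] eq_conv eq_sym by blast
    then show ?thesis unfolding IndId T
      using check_sound[OF \<Gamma> k] id_elim[OF C(1) c(1) a(1) b(1) p(1)] cong eq_trans by blast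
  next
    case False
    then have "t' = IndId C' c' a' b' p'" "T = ?T" using res by (auto simp: red_id_def if_refl_def split: if_splits tm.splits)
    then show ?thesis unfolding IndId
      using id_elim[OF C(1) c(1) a(1) b(1) p(1)] id_elim_eq[OF C(2) c(2) a(2) b(2) p(2)] by simp
  qed
next
  case (Funext f g)
  with assms obtain f' F F' A B g' where u: "r nf \<Gamma> f None = Some (f', F)" "expose r \<Gamma> F = Some F'"
    and F': "F' = Pi A B" and g: "check r nf \<Gamma> g (Pi A B) = Some g'"
    and t: "t' = Funext f' g'" "T = is_equiv (Id (Pi A B) f g) (Homotopy A B f g) (happly A B f g)"
    by (auto simp: Let_def bind_eq_Some_conv dest!: on_Some)
  have "\<Gamma> \<turnstile> f \<Colon> Pi A B" "\<Gamma> \<turnstile> f \<doteq> f' \<Colon> Pi A B"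
    using soundD[OF r \<Gamma> u(1)] expose_conv[OF \<Gamma> u(2)] F' by blast+
  then show ?thesis unfolding Funext t using check_sound[OF \<Gamma> g] funext funext_eq by blast
next
  case (Univalence i A B)
  with assms obtain A' B' where u: "check r nf \<Gamma> A (Univ i) = Some A'" "check r nf \<Gamma> B (Univ i) = Some B'"
    and t: "t' = Univalence i A' B'" "T = is_equiv (Id (Univ i) A B) (Equiv A B) (idtoeqv i A B)"
    by (auto simp: Let_def bind_eq_Some_conv)
  then show ?thesis unfolding Univalence t
    using check_sound[OF \<Gamma> u(1)] check_sound[OF \<Gamma> u(2)] univalence univalence_eq by blast
next
  case (Trunc A)
  then show ?thesis using assms infer_univ_sound[OF \<Gamma>] trunc_form trunc_form_eq
    by (fastforce simp: Let_def bind_eq_Some_conv)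
next
  case (TruncIn a)
  then show ?thesis using assms soundD[OF r \<Gamma>] trunc_intro trunc_intro_eq
    by (fastforce simp: Let_def bind_eq_Some_conv)
next
  case (TruncPath a b)
  with assms obtain a' T0 T' A b' where u: "r nf \<Gamma> a None = Some (a', T0)" "expose r \<Gamma> T0 = Some T'"
    and T': "T' = Trunc A" and b: "check r nf \<Gamma> b (Trunc A) = Some b'"
    and t: "t' = TruncPath a' b'" "T = Id (Trunc A) a b"
    by (auto simp: Let_def bind_eq_Some_conv dest!: on_Some)
  have "\<Gamma> \<turnstile> a \<Colon> Trunc A" "\<Gamma> \<turnstile> a \<doteq> a' \<Colon> Trunc A"
    using soundD[OF r \<Gamma> u(1)] expose_conv[OF \<Gamma> u(2)] T' by blast+
  then show ?thesis unfolding TruncPath t using check_sound[OF \<Gamma> b] trunc_path trunc_path_eq by blast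
next
  case (TruncRec B h f s)
  with assms obtain B' i h' s' T0 T' A f' where v: "infer_univ r nf \<Gamma> B = Some (B', i)"
    "check r nf \<Gamma> h (is_prop B) = Some h'" and u: "r nf \<Gamma> s None = Some (s', T0)" "expose r \<Gamma> T0 = Some T'"
    and T': "T' = Trunc A" and f: "check r nf \<Gamma> f (A \<rightarrow> B) = Some f'"
    and t: "t' = TruncRec B' h' f' s'" "T = B"
    by (auto simp: Let_def bind_eq_Some_conv dest!: on_Some)
  have "\<Gamma> \<turnstile> s \<Colon> Trunc A" "\<Gamma> \<turnstile> s \<doteq> s' \<Colon> Trunc A"
    using soundD[OF r \<Gamma> u(1)] expose_conv[OF \<Gamma> u(2)] T' by blast+
  then show ?thesis unfolding TruncRec t
    using infer_univ_sound[OF \<Gamma> v(1)] check_sound[OF \<Gamma> v(2)] check_sound[OF \<Gamma> f] trunc_rec trunc_rec_eq by blast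
qed (use assms in simp_all)

lemma check_intro_sound:
  assumes "check_intro r nf \<Gamma> t T = Some t'"
  shows "\<Gamma> \<turnstile> t \<Colon> T \<and> \<Gamma> \<turnstile> t \<doteq> t' \<Colon> T"
proof (cases t)
  case (Pair a b)
  have "\<exists>A B x i y j a' b'. T = Sig A B \<and> infer_univ r False \<Gamma> A = Some (x, i) \<and> infer_univ r False (A # \<Gamma>) B = Some (y, j)
      \<and> check r nf \<Gamma> a A = Some a' \<and> check r nf \<Gamma> b (B\<lbrakk>wrap A a\<rbrakk>) = Some b' \<and> t' = Pair a' b'"
    using assms unfolding Pair by (auto simp: check_intro_def Let_def bind_eq_Some_conv dest!: on_Some)
  then obtain A B x i y j a' b' where t: "T = Sig A B" "t' = Pair a' b'"
    and u: "infer_univ r False \<Gamma> A = Some (x, i)" "infer_univ r False (A # \<Gamma>) B = Some (y, j)"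
      "check r nf \<Gamma> a A = Some a'" "check r nf \<Gamma> b (B\<lbrakk>wrap A a\<rbrakk>) = Some b'"
    by blast
  have A: "\<Gamma> \<turnstile> A \<Colon> Univ i" using infer_univ_sound[OF \<Gamma> u(1)] by simp
  have B: "A # \<Gamma> \<turnstile> B \<Colon> Univ j" using infer_univ_sound[OF ctx_ext[OF A] u(2)] by simp
  have a: "\<Gamma> \<turnstile> a \<Colon> A" "\<Gamma> \<turnstile> a \<doteq> a' \<Colon> A" using check_sound[OF \<Gamma> u(3)] by auto
  note wa = wrap_sound[OF A a(1)]
  have "\<Gamma> \<turnstile> B\<lbrakk>wrap A a\<rbrakk> \<doteq> B\<lbrakk>a\<rbrakk> \<Colon> Univ j"
    by (rule functionality[OF B substitution_Var[OF \<Gamma>]]) (use a wa in simp_all)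
  then have "\<Gamma> \<turnstile> b \<Colon> B\<lbrakk>a\<rbrakk>" "\<Gamma> \<turnstile> b \<doteq> b' \<Colon> B\<lbrakk>a\<rbrakk>"
    using check_sound[OF \<Gamma> u(4)] conv eq_conv by blast+
  then show ?thesis unfolding Pair t using sig_intro[OF B a(1)] sig_intro_eq[OF B a(2)] by blast
next
  case (Lam A b)
  have "\<exists>D B A' i v x j b'. T = Pi D B \<and> infer_univ r nf \<Gamma> A = Some (A', i) \<and>
      (A = D \<or> equal_types r \<Gamma> A D = Some v \<and> infer_univ r False (A # \<Gamma>) B = Some (x, j)) \<and>
      check r nf (A # \<Gamma>) b B = Some b' \<and> t' = Lam A' b'"
    using assms unfolding Lam by (auto simp: check_intro_def Let_def bind_eq_Some_conv dest!: on_Some split: if_splits)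
  then obtain D B A' i v x j b' where t: "T = Pi D B" "t' = Lam A' b'" and u: "infer_univ r nf \<Gamma> A = Some (A', i)"
    and D: "A = D \<or> equal_types r \<Gamma> A D = Some v \<and> infer_univ r False (A # \<Gamma>) B = Some (x, j)"
    and b: "check r nf (A # \<Gamma>) b B = Some b'"
    by blast
  have A: "\<Gamma> \<turnstile> A \<Colon> Univ i" "\<Gamma> \<turnstile> A \<doteq> A' \<Colon> Univ i" using infer_univ_sound[OF \<Gamma> u] by auto
  have b': "A # \<Gamma> \<turnstile> b \<Colon> B" "A # \<Gamma> \<turnstile> b \<doteq> b' \<Colon> B" using check_sound[OF ctx_ext[OF A(1)] b] by auto
  have P: "\<Gamma> \<turnstile> Lam A b \<Colon> Pi A B" "\<Gamma> \<turnstile> Lam A b \<doteq> Lam A' b' \<Colon> Pi A B"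
    using pi_intro[OF b'(1)] pi_intro_eq[OF A b'(2)] by auto
  have "A = D \<or> (\<exists>k. \<Gamma> \<turnstile> Pi A B \<doteq> Pi D B \<Colon> Univ k)"
  proof (cases "A = D")
    case False
    with D have D': "equal_types r \<Gamma> A D = Some v" "infer_univ r False (A # \<Gamma>) B = Some (x, j)" by auto
    obtain k where k: "\<Gamma> \<turnstile> A \<doteq> D \<Colon> Univ k" using equal_types_sound[OF \<Gamma> D'(1)] by blast
    have B: "A # \<Gamma> \<turnstile> B \<Colon> Univ j" using infer_univ_sound[OF ctx_ext[OF A(1)] D'(2)] by simp
    have "\<Gamma> \<turnstile> Pi A B \<doteq> Pi D B \<Colon> Univ (i + j + k)"
      by (rule pi_form_eq; rule cumul[rotated]; (rule A k eq_refl[OF B])?; simp)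
    then show ?thesis by blast
  qed simp
  then show ?thesis unfolding Lam t using P conv eq_conv by blast
next
  case (InL a)
  have "\<exists>A B x i y j a'. T = Coprod A B \<and> infer_univ r False \<Gamma> A = Some (x, i) \<and> infer_univ r False \<Gamma> B = Some (y, j)
      \<and> check r nf \<Gamma> a A = Some a' \<and> t' = InL a'"
    using assms unfolding InL by (auto simp: check_intro_def Let_def bind_eq_Some_conv dest!: on_Some)
  then obtain A B x i y j a' where t: "T = Coprod A B" "t' = InL a'"
    and u: "infer_univ r False \<Gamma> A = Some (x, i)" "infer_univ r False \<Gamma> B = Some (y, j)" "check r nf \<Gamma> a A = Some a'"
    by blast
  have "\<Gamma> \<turnstile> A \<Colon> Univ (i + j)" "\<Gamma> \<turnstile> B \<Colon> Univ (i + j)"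
    using infer_univ_sound[OF \<Gamma> u(1)] infer_univ_sound[OF \<Gamma> u(2)] cumul(1)[of i "i + j"] cumul(1)[of j "i + j"] by auto
  then show ?thesis unfolding InL t
    using check_sound[OF \<Gamma> u(3)] coprod_intro1 coprod_intro1_eq by blast
next
  case (InR b)
  have "\<exists>A B x i y j b'. T = Coprod A B \<and> infer_univ r False \<Gamma> A = Some (x, i) \<and> infer_univ r False \<Gamma> B = Some (y, j)
      \<and> check r nf \<Gamma> b B = Some b' \<and> t' = InR b'"
    using assms unfolding InR by (auto simp: check_intro_def Let_def bind_eq_Some_conv dest!: on_Some)
  then obtain A B x i y j b' where t: "T = Coprod A B" "t' = InR b'"
    and u: "infer_univ r False \<Gamma> A = Some (x, i)" "infer_univ r False \<Gamma> B = Some (y, j)" "check r nf \<Gamma> b B = Some b'"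
    by blast
  have "\<Gamma> \<turnstile> A \<Colon> Univ (i + j)" "\<Gamma> \<turnstile> B \<Colon> Univ (i + j)"
    using infer_univ_sound[OF \<Gamma> u(1)] infer_univ_sound[OF \<Gamma> u(2)] cumul(1)[of i "i + j"] cumul(1)[of j "i + j"] by auto
  then show ?thesis unfolding InR t
    using check_sound[OF \<Gamma> u(3)] coprod_intro2 coprod_intro2_eq by blast
qed (use assms in \<open>simp_all add: check_intro_def\<close>)

end

lemma step_sound: "sound (step r)"
  unfolding sound_def
proof (intro allI impI)
  fix nf \<Gamma> t E t' T
  assume \<Gamma>: "\<turnstile> \<Gamma> ctx" and st: "step r nf \<Gamma> t E = Some (t', T)"
  show "\<Gamma> \<turnstile> t \<Colon> T \<and> \<Gamma> \<turnstile> t \<doteq> t' \<Colon> T \<and> (\<forall>S. E = Some S \<longrightarrow> S = T)"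
  proof (cases E)
    case None
    then show ?thesis using st infer_sound[OF \<Gamma>] by (simp add: step_def)
  next
    case (Some S)
    show ?thesis
    proof (cases "needs_type t \<or> is_lam t")
      case True
      then obtain T' where e: "expose r \<Gamma> S = Some T'" and c: "check_intro r nf \<Gamma> t T' = Some t'" and "S = T"
        using st Some by (auto simp: step_def bind_eq_Some_conv)
      then show ?thesis using check_intro_sound[OF \<Gamma> c] expose_conv[OF \<Gamma> e] Some by simp
    next
      case False
      then obtain S' v where i: "r nf \<Gamma> t None = Some (t', S')" and s: "subtype r \<Gamma> S' S = Some v" and "S = T"
        using st Some by (auto simp: step_def bind_eq_Some_conv)
      then show ?thesis using soundD[OF r \<Gamma> i] subtype_sound[OF \<Gamma> s] Some by blast
    qed
  qed
qed

end

lemma iter2_sound: "sound r \<Longrightarrow> sound (iter2 m r)"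
  by (induction m arbitrary: r) (simp_all add: step_sound)

lemma no_check_sound: "sound no_check"
  by (simp add: sound_def no_check_def)

text \<open>The number 6 stands for 64 nested steps. It bounds the depth of the recursion, not the
  number of calls, and is enough for every term below. The flag \<open>False\<close> means that the
  proof term itself is not normalised, only types that have to be exposed or compared.\<close>

definition typechecks :: "tm list \<Rightarrow> tm \<Rightarrow> tm \<Rightarrow> bool" where
  "typechecks \<Gamma> t T \<longleftrightarrow> check (iter2 6 no_check) False \<Gamma> t T \<noteq> None"

lemma typechecks_sound: "typechecks \<Gamma> t T \<Longrightarrow> \<turnstile> \<Gamma> ctx \<Longrightarrow> \<Gamma> \<turnstile> t \<Colon> T"
  unfolding typechecks_def using check_sound[OF iter2_sound[OF no_check_sound]] by blast

subsection \<open>Evaluation\<close>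

text \<open>A first-order form of renaming: the crossed binders are counted by a cutoff instead of
  being wrapped around a function, so evaluation only compares numbers.\<close>

primrec shift_at :: "nat \<Rightarrow> nat \<Rightarrow> tm \<Rightarrow> tm" where
  "shift_at d c (Var k) = Var (if k < c then k else k + d)"
| "shift_at d c (Univ i) = Univ i"
| "shift_at d c (Pi A B) = Pi (shift_at d c A) (shift_at d (Suc c) B)"
| "shift_at d c (Lam A b) = Lam (shift_at d c A) (shift_at d (Suc c) b)"
| "shift_at d c (App f a) = App (shift_at d c f) (shift_at d c a)"
| "shift_at d c (Sig A B) = Sig (shift_at d c A) (shift_at d (Suc c) B)"
| "shift_at d c (Pair a b) = Pair (shift_at d c a) (shift_at d c b)"
| "shift_at d c (IndSig C g p) = IndSig (shift_at d (Suc c) C) (shift_at d (Suc (Suc c)) g) (shift_at d c p)"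
| "shift_at d c (Coprod A B) = Coprod (shift_at d c A) (shift_at d c B)"
| "shift_at d c (InL a) = InL (shift_at d c a)"
| "shift_at d c (InR b) = InR (shift_at d c b)"
| "shift_at d c (IndCoprod C l r p) = IndCoprod (shift_at d (Suc c) C) (shift_at d (Suc c) l) (shift_at d (Suc c) r) (shift_at d c p)"
| "shift_at d c Empty = Empty"
| "shift_at d c (IndEmpty C p) = IndEmpty (shift_at d (Suc c) C) (shift_at d c p)"
| "shift_at d c Unit = Unit"
| "shift_at d c Star = Star"
| "shift_at d c (IndUnit C u p) = IndUnit (shift_at d (Suc c) C) (shift_at d c u) (shift_at d c p)"
| "shift_at d c NatT = NatT"
| "shift_at d c Zero = Zero"
| "shift_at d c (Succ m) = Succ (shift_at d c m)"
| "shift_at d c (IndNat C z s m) = IndNat (shift_at d (Suc c) C) (shift_at d c z) (shift_at d (Suc (Suc c)) s) (shift_at d c m)"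
| "shift_at d c (Id A a b) = Id (shift_at d c A) (shift_at d c a) (shift_at d c b)"
| "shift_at d c (Refl a) = Refl (shift_at d c a)"
| "shift_at d c (IndId C u a b p) = IndId (shift_at d (Suc (Suc (Suc c))) C) (shift_at d (Suc c) u) (shift_at d c a) (shift_at d c b) (shift_at d c p)"
| "shift_at d c (Funext f g) = Funext (shift_at d c f) (shift_at d c g)"
| "shift_at d c (Univalence i A B) = Univalence i (shift_at d c A) (shift_at d c B)"
| "shift_at d c (Trunc A) = Trunc (shift_at d c A)"
| "shift_at d c (TruncIn a) = TruncIn (shift_at d c a)"
| "shift_at d c (TruncPath a b) = TruncPath (shift_at d c a) (shift_at d c b)"
| "shift_at d c (TruncRec B h f t) = TruncRec (shift_at d c B) (shift_at d c h) (shift_at d c f) (shift_at d c t)"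

lemma upr_cutoff: "upr (\<lambda>k. if k < c then k else k + d) = (\<lambda>k. if k < Suc c then k else k + d)"
proof
  show "upr (\<lambda>k. if k < c then k else k + d) k = (if k < Suc c then k else k + d)" for k
    by (cases k) auto
qed

lemma shift_at_eq_ren: "shift_at d c t = ren (\<lambda>k. if k < c then k else k + d) t"
  by (induction t arbitrary: c) (simp_all add: upr_cutoff)

primrec select :: "tm list \<Rightarrow> nat \<Rightarrow> nat \<Rightarrow> tm" where
  "select [] d k = Var (k + d)"
| "select (s # ss) d k = (case k of 0 \<Rightarrow> s | Suc m \<Rightarrow> select ss d m)"

text \<open>A substitution is represented by the list \<open>ss\<close> of its first values followed
  by a shift by \<open>d\<close>. The values are not lifted at each of the \<open>c\<close> binders
  crossed; the whole shift by \<open>c\<close> happens once, where a variable is reached.\<close>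

primrec subst_at :: "tm list \<Rightarrow> nat \<Rightarrow> nat \<Rightarrow> tm \<Rightarrow> tm" where
  "subst_at ss d c (Var k) = (if k < c then Var k else shift_at c 0 (select ss d (k - c)))"
| "subst_at ss d c (Univ i) = Univ i"
| "subst_at ss d c (Pi A B) = Pi (subst_at ss d c A) (subst_at ss d (Suc c) B)"
| "subst_at ss d c (Lam A b) = Lam (subst_at ss d c A) (subst_at ss d (Suc c) b)"
| "subst_at ss d c (App f a) = App (subst_at ss d c f) (subst_at ss d c a)"
| "subst_at ss d c (Sig A B) = Sig (subst_at ss d c A) (subst_at ss d (Suc c) B)"
| "subst_at ss d c (Pair a b) = Pair (subst_at ss d c a) (subst_at ss d c b)"
| "subst_at ss d c (IndSig C g p) = IndSig (subst_at ss d (Suc c) C) (subst_at ss d (Suc (Suc c)) g) (subst_at ss d c p)"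
| "subst_at ss d c (Coprod A B) = Coprod (subst_at ss d c A) (subst_at ss d c B)"
| "subst_at ss d c (InL a) = InL (subst_at ss d c a)"
| "subst_at ss d c (InR b) = InR (subst_at ss d c b)"
| "subst_at ss d c (IndCoprod C l r p) = IndCoprod (subst_at ss d (Suc c) C) (subst_at ss d (Suc c) l) (subst_at ss d (Suc c) r) (subst_at ss d c p)"
| "subst_at ss d c Empty = Empty"
| "subst_at ss d c (IndEmpty C p) = IndEmpty (subst_at ss d (Suc c) C) (subst_at ss d c p)"
| "subst_at ss d c Unit = Unit"
| "subst_at ss d c Star = Star"
| "subst_at ss d c (IndUnit C u p) = IndUnit (subst_at ss d (Suc c) C) (subst_at ss d c u) (subst_at ss d c p)"
| "subst_at ss d c NatT = NatT"
| "subst_at ss d c Zero = Zero"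
| "subst_at ss d c (Succ m) = Succ (subst_at ss d c m)"
| "subst_at ss d c (IndNat C z s m) = IndNat (subst_at ss d (Suc c) C) (subst_at ss d c z) (subst_at ss d (Suc (Suc c)) s) (subst_at ss d c m)"
| "subst_at ss d c (Id A a b) = Id (subst_at ss d c A) (subst_at ss d c a) (subst_at ss d c b)"
| "subst_at ss d c (Refl a) = Refl (subst_at ss d c a)"
| "subst_at ss d c (IndId C u a b p) = IndId (subst_at ss d (Suc (Suc (Suc c))) C) (subst_at ss d (Suc c) u) (subst_at ss d c a) (subst_at ss d c b) (subst_at ss d c p)"
| "subst_at ss d c (Funext f g) = Funext (subst_at ss d c f) (subst_at ss d c g)"
| "subst_at ss d c (Univalence i A B) = Univalence i (subst_at ss d c A) (subst_at ss d c B)"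
| "subst_at ss d c (Trunc A) = Trunc (subst_at ss d c A)"
| "subst_at ss d c (TruncIn a) = TruncIn (subst_at ss d c a)"
| "subst_at ss d c (TruncPath a b) = TruncPath (subst_at ss d c a) (subst_at ss d c b)"
| "subst_at ss d c (TruncRec B h f t) = TruncRec (subst_at ss d c B) (subst_at ss d c h) (subst_at ss d c f) (subst_at ss d c t)"

lemma ups_cutoff: "ups (\<lambda>k. if k < c then Var k else ren (\<lambda>j. j + c) (\<sigma> (k - c)))
    = (\<lambda>k. if k < Suc c then Var k else ren (\<lambda>j. j + Suc c) (\<sigma> (k - Suc c)))"
proof
  show "ups (\<lambda>k. if k < c then Var k else ren (\<lambda>j. j + c) (\<sigma> (k - c))) k
    = (if k < Suc c then Var k else ren (\<lambda>j. j + Suc c) (\<sigma> (k - Suc c)))" for k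
    by (cases k) (auto simp: ren_ren comp_def)
qed

lemma subst_at_eq_subst: "subst_at ss d c t = subst (\<lambda>k. if k < c then Var k else ren (\<lambda>j. j + c) (select ss d (k - c))) t"
  by (induction t arbitrary: c) (simp_all only: subst_at.simps subst.simps ups_cutoff shift_at_eq_ren not_less0 if_False)

text \<open>These are the fixed renamings that occur in the checker and in the types of the theorem:
  shifts by 1 and 2, by 4 in \<open>happly\<close> and \<open>single_map_presentation\<close>, by 5
  in \<open>accessible\<close>, and the shift below one binder used for the codomain in
  \<open>happly\<close>.\<close>

lemma ren_eval:
  "ren Suc t = shift_at (Suc 0) 0 t"
  "ren (\<lambda>k. Suc (Suc k)) t = shift_at (Suc (Suc 0)) 0 t"
  "ren (\<lambda>k. Suc (Suc (Suc (Suc k)))) t = shift_at (Suc (Suc (Suc (Suc 0)))) 0 t"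
  "ren (\<lambda>k. Suc (Suc (Suc (Suc (Suc k))))) t = shift_at (Suc (Suc (Suc (Suc (Suc 0))))) 0 t"
  "ren (upr (\<lambda>k. Suc (Suc (Suc (Suc k))))) t = shift_at (Suc (Suc (Suc (Suc 0)))) (Suc 0) t"
  using upr_cutoff[of 0 "Suc (Suc (Suc (Suc 0)))"] by (simp_all add: shift_at_eq_ren)

lemma infer_Var_eval: "infer r nf \<Gamma> (Var k) = do { A \<leftarrow> lookup \<Gamma> k; let T = shift_at (Suc k) 0 A; Some (Var k, T) }"
  by (simp add: shift_at_eq_ren)

lemma ren_id: "ren (\<lambda>k. k) t = t"
  by (simp add: ren_eq_subst)

lemma select_scons: "select [] d = (\<lambda>k. Var (k + d))" "select (a # ss) d = a \<cdot> select ss d"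
  by (auto simp: scons_def)

lemma subst_eval:
  "subst (a \<cdot> Var) t = subst_at [a] 0 0 t"
  "subst (b \<cdot> a \<cdot> Var) t = subst_at [b, a] 0 0 t"
  "subst (c \<cdot> b \<cdot> a \<cdot> Var) t = subst_at [c, b, a] 0 0 t"
  "subst (a \<cdot> (\<lambda>k. Var (Suc k))) t = subst_at [a] (Suc 0) 0 t"
  "subst (a \<cdot> (\<lambda>k. Var (Suc (Suc k)))) t = subst_at [a] (Suc (Suc 0)) 0 t"
  "subst (c \<cdot> b \<cdot> a \<cdot> (\<lambda>k. Var (Suc k))) t = subst_at [c, b, a] (Suc 0) 0 t"
  by (simp_all add: subst_at_eq_subst select_scons ren_id)

section \<open>Evaluation equations for the checker\<close>

lemma iter2_eval:
  "iter2 0 r nf \<Gamma> t E = step r nf \<Gamma> t E"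
  "iter2 (Suc m) r nf \<Gamma> t E = iter2 m (iter2 m r) nf \<Gamma> t E"
  by simp_all

lemma step_eval:
  "step r nf \<Gamma> t None = infer r nf \<Gamma> t"
  "step r nf \<Gamma> t (Some T) = (if needs_type t \<or> is_lam t
         then do { T' \<leftarrow> expose r \<Gamma> T; t' \<leftarrow> check_intro r nf \<Gamma> t T'; Some (t', T) }
         else do { (t', S) \<leftarrow> r nf \<Gamma> t None; _ \<leftarrow> subtype r \<Gamma> S T; Some (t', T) })"
  by (simp_all add: step_def)

lemma check_intro_eval:
  "check_intro r nf \<Gamma> (Pair a b) T = on_sig T (\<lambda>A B. do { _ \<leftarrow> infer_univ r False \<Gamma> A; _ \<leftarrow> infer_univ r False (A # \<Gamma>) B;
       a' \<leftarrow> check r nf \<Gamma> a A; let D = B\<lbrakk>wrap A a\<rbrakk>; b' \<leftarrow> check r nf \<Gamma> b D; Some (Pair a' b') })"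
  "check_intro r nf \<Gamma> (Lam A b) T = on_pi T (\<lambda>D B. do { (A', i) \<leftarrow> infer_univ r nf \<Gamma> A;
       _ \<leftarrow> (if A = D then Some () else do { _ \<leftarrow> equal_types r \<Gamma> A D; _ \<leftarrow> infer_univ r False (A # \<Gamma>) B; Some () });
       b' \<leftarrow> check r nf (A # \<Gamma>) b B; Some (Lam A' b') })"
  "check_intro r nf \<Gamma> (InL a) T = on_coprod T (\<lambda>A B. do { _ \<leftarrow> infer_univ r False \<Gamma> A; _ \<leftarrow> infer_univ r False \<Gamma> B;
       a' \<leftarrow> check r nf \<Gamma> a A; Some (InL a') })"
  "check_intro r nf \<Gamma> (InR b) T = on_coprod T (\<lambda>A B. do { _ \<leftarrow> infer_univ r False \<Gamma> A; _ \<leftarrow> infer_univ r False \<Gamma> B;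
       b' \<leftarrow> check r nf \<Gamma> b B; Some (InR b') })"
  by (simp_all add: check_intro_def)

text \<open>The simplifier contracts \<open>(\<lambda>x y. t) a b\<close> one argument at a time and would descend into \<open>\<lambda>y. t\<close> in
  between. Discharging the premise of the congruence rule of \<open>apply1\<close> \<open>\<beta>\<close>-normalises the instantiated
  rule, and with it the first argument, without descending into it.\<close>

definition apply1 :: "nat \<Rightarrow> ('a \<Rightarrow> 'b) \<Rightarrow> 'a \<Rightarrow> 'b" where
  "apply1 i g x = g x"

lemma apply1_cong: "i = j \<Longrightarrow> apply1 i g x = apply1 j g x"
  by simp

definition is_pair :: "tm \<Rightarrow> bool" where
  "is_pair t = (case t of Pair a b \<Rightarrow> True | _ \<Rightarrow> False)"

lemma on_eval:
  "on_univ (Univ i) k1 = k1 i" "on_pi (Pi A B) k = apply1 0 (k A) B" "on_sig (Sig A B) k = apply1 0 (k A) B"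
  "on_coprod (Coprod A B) k = apply1 0 (k A) B" "on_id (Id A a b) k2 = k2 A" "on_trunc (Trunc A) k2 = k2 A"
  "case_prod h (x, y) = apply1 0 (h x) y"
  by (simp_all add: on_univ_def on_pi_def on_sig_def on_coprod_def on_id_def on_trunc_def apply1_def)

text \<open>Separating the test from the projection lets the conditional be decided before either
  branch is instantiated. The default \<open>undefined\<close> is never reached, as the projection
  stands behind the test \<open>is_lam\<close>.\<close>

definition with_lam :: "tm \<Rightarrow> (tm \<Rightarrow> tm \<Rightarrow> 'a) \<Rightarrow> 'a" where
  "with_lam t k = if_lam t k undefined"

definition with_pair :: "tm \<Rightarrow> (tm \<Rightarrow> tm \<Rightarrow> 'a) \<Rightarrow> 'a" where
  "with_pair t k = if_pair t k undefined"

lemma if_eval: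
  "if_lam t k z = (if is_lam t then with_lam t k else z)" "with_lam (Lam A b) k = apply1 0 (k A) b"
  "if_pair t k z = (if is_pair t then with_pair t k else z)" "with_pair (Pair a b) k = apply1 0 (k a) b"
  by (auto simp: if_lam_def is_lam_def if_pair_def is_pair_def apply1_def with_lam_def with_pair_def split: tm.splits)

text \<open>Congruence rules without premises keep the simplifier from descending into arguments that are
  already values; arguments still to be computed are bound by \<open>let\<close>.\<close>

lemma eval_cong:
  "x = y \<Longrightarrow> Option.bind x f = Option.bind y f"
  "k = k' \<Longrightarrow> select ss d k = select ss d k'"
  by simp_all

lemma frozen_cong:
  "on_univ T k1 = on_univ T k1" "on_pi T k = on_pi T k" "on_sig T k = on_sig T k"
  "on_coprod T k = on_coprod T k" "on_id T k2 = on_id T k2" "on_trunc T k2 = on_trunc T k2"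
  "if_lam t l z = if_lam t l z" "if_pair t l z = if_pair t l z" "if_inj t m m' z = if_inj t m m' z"
  "if_refl t m z = if_refl t m z" "if_var0 t z' z = if_var0 t z' z" "if_univ T q z = if_univ T q z"
  "iter2 j r nf \<Gamma> t E = iter2 j r nf \<Gamma> t E" "step r nf \<Gamma> t E = step r nf \<Gamma> t E"
  "infer r nf \<Gamma> t = infer r nf \<Gamma> t" "infer_app r nf \<Gamma> f a = infer_app r nf \<Gamma> f a"
  "check r nf \<Gamma> t T = check r nf \<Gamma> t T" "check_intro r nf \<Gamma> t T = check_intro r nf \<Gamma> t T"
  "infer_univ r nf \<Gamma> A = infer_univ r nf \<Gamma> A" "expose r \<Gamma> T = expose r \<Gamma> T" "normal_type r \<Gamma> T = normal_type r \<Gamma> T"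
  "subtype r \<Gamma> T S = subtype r \<Gamma> T S" "equal_types r \<Gamma> T S = equal_types r \<Gamma> T S" "level_le T S = level_le T S"
  "red_app r nf \<Gamma> f' w A B T s = red_app r nf \<Gamma> f' w A B T s"
  "red_sig r nf \<Gamma> g p' A B T s = red_sig r nf \<Gamma> g p' A B T s"
  "red_coprod r nf \<Gamma> c d p' A B T s = red_coprod r nf \<Gamma> c d p' A B T s"
  "red_id r nf \<Gamma> c a a' b' p' T s = red_id r nf \<Gamma> c a a' b' p' T s"
  "canonical T = canonical T" "needs_type T = needs_type T" "is_lam T = is_lam T"
  "lookup \<Gamma> i = lookup \<Gamma> i" "Some x = Some x"
  "case_prod h p = case_prod h p" "is_pair T = is_pair T" "with_lam t l = with_lam t l" "with_pair t l = with_pair t l"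
  by (rule refl)+

lemma case_tm_frozen:
  "case_tm f1 f2 f3 f4 f5 f6 f7 f8 f9 f10 f11 f12 f13 f14 f15 f16 f17 f18 f19 f20 f21 f22 f23 f24 f25 f26 f27 f28 f29 f30 t
   = case_tm f1 f2 f3 f4 f5 f6 f7 f8 f9 f10 f11 f12 f13 f14 f15 f16 f17 f18 f19 f20 f21 f22 f23 f24 f25 f26 f27 f28 f29 f30 t"
  by (rule refl)

lemma typechecks_eval:
  "typechecks \<Gamma> t T = (check (iter2 (Suc (Suc (Suc (Suc (Suc (Suc 0)))))) no_check) False \<Gamma> t T \<noteq> None)"
  by (simp add: typechecks_def numeral_eq_Suc)

lemma nat_eval: "(2::nat) = Suc (Suc 0)" "(3::nat) = Suc (Suc (Suc 0))" "(4::nat) = Suc (Suc (Suc (Suc 0)))"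
  "(5::nat) = Suc (Suc (Suc (Suc (Suc 0))))" "(Suc i \<le> 0) = False"
  by simp_all

lemmas eval_simps =
  typechecks_eval check_def iter2_eval step_eval check_intro_eval infer_Var_eval infer.simps(2-) infer_app_def
  red_app_def red_sig_def red_coprod_def red_id_def
  normal_type_def expose_def infer_univ_def subtype_def equal_types_def level_le_def if_univ_def
  if_eval if_inj_def if_refl_def if_var0_def on_eval apply1_def canonical_def is_pair_def needs_type_def is_lam_def
  wrap_def asc_def lookup.simps Option.bind.bind_lunit Option.bind.bind_lzero
  ren_eval subst_eval shift_at.simps subst_at.simps select.simps
  Fun_def Prod_def is_prop_def is_equiv_def Equiv_def id_equiv_def Let_def idtoeqv_def Homotopy_def happly_def
  tm.case tm.inject tm.distinct nat.case nat.inject nat.distinct option.distinct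
  simp_thms if_True if_False refl
  One_nat_def nat_eval le0 Suc_le_mono not_less0 zero_less_Suc Suc_less_eq diff_Suc_Suc minus_nat.diff_0
  add_0_right add_Suc_right max_Suc_Suc max_0L max_0R

lemmas eval_congs = apply1_cong eval_cong frozen_cong case_tm_frozen if_weak_cong let_weak_cong nat.case_cong_weak

subsection \<open>Terms with named variables\<close>

text \<open>
  A term in an unknown context is a function of the length of that context, and a binder is a
  function on such terms; a variable is identified by its position counted from the outermost one.
\<close>

type_synonym hterm = "nat \<Rightarrow> tm"

named_theorems hoas

definition hvar :: "nat \<Rightarrow> hterm" where [hoas]: "hvar l n = Var (n - Suc l)"
definition hU :: hterm where [hoas]: "hU n = Univ 0"
definition hU1 :: hterm where [hoas]: "hU1 n = Univ (Suc 0)"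
definition hempty :: hterm where [hoas]: "hempty n = Empty"
definition hpi :: "hterm \<Rightarrow> (hterm \<Rightarrow> hterm) \<Rightarrow> hterm" where
  [hoas]: "hpi A B n = Pi (A n) (B (hvar n) (Suc n))"
definition hlam :: "hterm \<Rightarrow> (hterm \<Rightarrow> hterm) \<Rightarrow> hterm" where
  [hoas]: "hlam A b n = Lam (A n) (b (hvar n) (Suc n))"
definition hsig :: "hterm \<Rightarrow> (hterm \<Rightarrow> hterm) \<Rightarrow> hterm" where
  [hoas]: "hsig A B n = Sig (A n) (B (hvar n) (Suc n))"
definition happ :: "hterm \<Rightarrow> hterm \<Rightarrow> hterm" (infixl "\<bullet>" 90) where
  [hoas]: "(f \<bullet> a) n = App (f n) (a n)"
definition hpair :: "hterm \<Rightarrow> hterm \<Rightarrow> hterm" ("\<langle>_, _\<rangle>") where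
  [hoas]: "hpair a b n = Pair (a n) (b n)"
definition hid :: "hterm \<Rightarrow> hterm \<Rightarrow> hterm \<Rightarrow> hterm" where
  [hoas]: "hid A a b n = Id (A n) (a n) (b n)"
definition hrefl :: "hterm \<Rightarrow> hterm" where [hoas]: "hrefl a n = Refl (a n)"
definition hcoprod :: "hterm \<Rightarrow> hterm \<Rightarrow> hterm" where [hoas]: "hcoprod A B n = Coprod (A n) (B n)"
definition htrunc :: "hterm \<Rightarrow> hterm" where [hoas]: "htrunc A n = Trunc (A n)"
definition htin :: "hterm \<Rightarrow> hterm" where [hoas]: "htin a n = TruncIn (a n)"
definition htpath :: "hterm \<Rightarrow> hterm \<Rightarrow> hterm" where [hoas]: "htpath a b n = TruncPath (a n) (b n)"
definition htrec :: "hterm \<Rightarrow> hterm \<Rightarrow> hterm \<Rightarrow> hterm \<Rightarrow> hterm" where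
  [hoas]: "htrec B h f t n = TruncRec (B n) (h n) (f n) (t n)"
definition hfunext :: "hterm \<Rightarrow> hterm \<Rightarrow> hterm" where [hoas]: "hfunext f g n = Funext (f n) (g n)"
definition hua :: "hterm \<Rightarrow> hterm \<Rightarrow> hterm" where [hoas]: "hua A B n = Univalence 0 (A n) (B n)"
definition hsplit :: "(hterm \<Rightarrow> hterm) \<Rightarrow> (hterm \<Rightarrow> hterm \<Rightarrow> hterm) \<Rightarrow> hterm \<Rightarrow> hterm" where
  [hoas]: "hsplit C g p n = IndSig (C (hvar n) (Suc n)) (g (hvar n) (hvar (Suc n)) (Suc (Suc n))) (p n)"
definition hcase :: "(hterm \<Rightarrow> hterm) \<Rightarrow> (hterm \<Rightarrow> hterm) \<Rightarrow> (hterm \<Rightarrow> hterm) \<Rightarrow> hterm \<Rightarrow> hterm" where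
  [hoas]: "hcase C c d p n =
     IndCoprod (C (hvar n) (Suc n)) (c (hvar n) (Suc n)) (d (hvar n) (Suc n)) (p n)"
definition habsurd :: "(hterm \<Rightarrow> hterm) \<Rightarrow> hterm \<Rightarrow> hterm" where
  [hoas]: "habsurd C p n = IndEmpty (C (hvar n) (Suc n)) (p n)"
definition hJ :: "(hterm \<Rightarrow> hterm \<Rightarrow> hterm \<Rightarrow> hterm) \<Rightarrow> (hterm \<Rightarrow> hterm) \<Rightarrow> hterm \<Rightarrow> hterm \<Rightarrow> hterm \<Rightarrow> hterm" where
  [hoas]: "hJ C c a b p n =
     IndId (C (hvar n) (hvar (Suc n)) (hvar (Suc (Suc n))) (Suc (Suc (Suc n)))) (c (hvar n) (Suc n)) (a n) (b n) (p n)"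

section \<open>The notions of the theorem as terms with named variables\<close>

definition his_prop :: "hterm \<Rightarrow> hterm" where [hoas]: "his_prop A n = is_prop (A n)"
definition his_set :: "hterm \<Rightarrow> hterm" where [hoas]: "his_set A n = is_set (A n)"
definition his_equiv :: "hterm \<Rightarrow> hterm \<Rightarrow> hterm \<Rightarrow> hterm" where
  [hoas]: "his_equiv A B f n = is_equiv (A n) (B n) (f n)"
definition hEquiv :: "hterm \<Rightarrow> hterm \<Rightarrow> hterm" where [hoas]: "hEquiv A B n = Equiv (A n) (B n)"
definition hidtoeqv :: "hterm \<Rightarrow> hterm \<Rightarrow> hterm" where [hoas]: "hidtoeqv A B n = idtoeqv 0 (A n) (B n)"
text \<open>The codomain expected by \<open>happly\<close> lives below one binder; here the
  functions are non-dependent, so it is a lift.\<close>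

definition hhapply :: "hterm \<Rightarrow> hterm \<Rightarrow> hterm \<Rightarrow> hterm \<Rightarrow> hterm" where
  [hoas]: "hhapply A B f g n = happly (A n) (B n)\<up> (f n) (g n)"
definition hfibre :: "hterm \<Rightarrow> hterm \<Rightarrow> hterm \<Rightarrow> hterm \<Rightarrow> hterm" where
  [hoas]: "hfibre A B f b n = fibre (A n) (B n) (f n) (b n)"
definition hconn :: "hterm \<Rightarrow> hterm \<Rightarrow> hterm \<Rightarrow> hterm" where
  [hoas]: "hconn A B f n = is_conn_map (A n) (B n) (f n)"
definition hprecomp :: "hterm \<Rightarrow> hterm \<Rightarrow> hterm \<Rightarrow> hterm \<Rightarrow> hterm" where
  [hoas]: "hprecomp A B g X n = precomp (A n) (B n) (g n) (X n)"
definition hmap_local :: "hterm \<Rightarrow> hterm \<Rightarrow> hterm \<Rightarrow> hterm \<Rightarrow> hterm" where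
  [hoas]: "hmap_local A B g X n = map_local (A n) (B n) (g n) (X n)"
definition hfamily_local :: "hterm \<Rightarrow> hterm \<Rightarrow> hterm \<Rightarrow> hterm \<Rightarrow> hterm \<Rightarrow> hterm" where
  [hoas]: "hfamily_local I A B f X n = family_local (I n) (A n) (B n) (f n) (X n)"
definition hIff :: "hterm \<Rightarrow> hterm \<Rightarrow> hterm" where [hoas]: "hIff A B n = Iff (A n) (B n)"
definition hLEM :: hterm where [hoas]: "hLEM n = LEM 0"
definition hsets_cover :: hterm where [hoas]: "hsets_cover n = sets_cover 0"
definition hPropU :: hterm where [hoas]: "hPropU n = PropU 0"
definition hsubuniverse :: hterm where [hoas]: "hsubuniverse n = refl_subuniverse 0"
definition haccessible :: "hterm \<Rightarrow> hterm" where [hoas]: "haccessible L n = accessible 0 (L n)"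
definition his_local :: "hterm \<Rightarrow> hterm \<Rightarrow> hterm" where [hoas]: "his_local L X n = is_local 0 (L n) (X n)"
definition hpresentation :: "hterm \<Rightarrow> hterm" where [hoas]: "hpresentation L n = single_map_presentation 0 (L n)"

syntax
  "_hpi" :: "pttrn \<Rightarrow> hterm \<Rightarrow> hterm \<Rightarrow> hterm" ("(3PI _ : _./ _)" [0, 0, 50] 50)
  "_hlam" :: "pttrn \<Rightarrow> hterm \<Rightarrow> hterm \<Rightarrow> hterm" ("(3LAM _ : _./ _)" [0, 0, 50] 50)
  "_hsig" :: "pttrn \<Rightarrow> hterm \<Rightarrow> hterm \<Rightarrow> hterm" ("(3SIG _ : _./ _)" [0, 0, 50] 50)
translations
  "PI x : A. B" \<rightleftharpoons> "CONST hpi A (\<lambda>x. B)"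
  "LAM x : A. b" \<rightleftharpoons> "CONST hlam A (\<lambda>x. b)"
  "SIG x : A. B" \<rightleftharpoons> "CONST hsig A (\<lambda>x. B)"

definition harr :: "hterm \<Rightarrow> hterm \<Rightarrow> hterm" (infixr "\<rightharpoonup>" 60) where
  [hoas]: "A \<rightharpoonup> B = (PI x : A. B)"
definition hprod :: "hterm \<Rightarrow> hterm \<Rightarrow> hterm" (infixr "\<otimes>\<^sub>h" 65) where
  [hoas]: "A \<otimes>\<^sub>h B = (SIG x : A. B)"
definition hnot :: "hterm \<Rightarrow> hterm" where [hoas]: "hnot A = (A \<rightharpoonup> hempty)"
definition hdec :: "hterm \<Rightarrow> hterm" where [hoas]: "hdec A = hcoprod A (hnot A)"
definition hid_map :: "hterm \<Rightarrow> hterm" where [hoas]: "hid_map A = (LAM x : A. x)"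
text \<open>Pairs carry no type. Wherever one stands in a position whose type must be inferred, an
  ascription supplies it.\<close>

definition hasc :: "hterm \<Rightarrow> hterm \<Rightarrow> hterm" where [hoas]: "hasc A a = hid_map A \<bullet> a"
definition hfst :: "hterm \<Rightarrow> hterm \<Rightarrow> hterm" where [hoas]: "hfst A p = hsplit (\<lambda>_. A) (\<lambda>a b. a) p"
definition hsnd :: "hterm \<Rightarrow> (hterm \<Rightarrow> hterm) \<Rightarrow> hterm \<Rightarrow> hterm" where
  [hoas]: "hsnd A B p = hsplit (\<lambda>z. B (hfst A z)) (\<lambda>a b. b) p"
definition htransport :: "(hterm \<Rightarrow> hterm) \<Rightarrow> hterm \<Rightarrow> hterm \<Rightarrow> hterm \<Rightarrow> hterm \<Rightarrow> hterm" where
  [hoas]: "htransport P a b p u = hJ (\<lambda>x y q. P x \<rightharpoonup> P y) (\<lambda>x. hid_map (P x)) a b p \<bullet> u"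
definition hsym :: "hterm \<Rightarrow> hterm \<Rightarrow> hterm \<Rightarrow> hterm \<Rightarrow> hterm" where
  [hoas]: "hsym A a b p = hJ (\<lambda>x y q. hid A y x) hrefl a b p"
definition htrans :: "hterm \<Rightarrow> hterm \<Rightarrow> hterm \<Rightarrow> hterm \<Rightarrow> hterm \<Rightarrow> hterm \<Rightarrow> hterm" where
  [hoas]: "htrans A a b c p q = htransport (\<lambda>z. hid A a z) b c q p"
definition hap :: "hterm \<Rightarrow> (hterm \<Rightarrow> hterm) \<Rightarrow> hterm \<Rightarrow> hterm \<Rightarrow> hterm \<Rightarrow> hterm" where
  [hoas]: "hap B f a b p = hJ (\<lambda>x y q. hid B (f x) (f y)) (\<lambda>x. hrefl (f x)) a b p"
definition hhomotopy :: "hterm \<Rightarrow> hterm \<Rightarrow> hterm \<Rightarrow> hterm \<Rightarrow> hterm" where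
  [hoas]: "hhomotopy A B f g = (PI x : A. hid B (f \<bullet> x) (g \<bullet> x))"
definition hright_inv :: "hterm \<Rightarrow> hterm \<Rightarrow> hterm \<Rightarrow> hterm" where
  [hoas]: "hright_inv A B f = (SIG g : B \<rightharpoonup> A. PI y : B. hid B (f \<bullet> (g \<bullet> y)) y)"
definition hleft_inv :: "hterm \<Rightarrow> hterm \<Rightarrow> hterm \<Rightarrow> hterm" where
  [hoas]: "hleft_inv A B f = (SIG g : B \<rightharpoonup> A. PI x : A. hid A (g \<bullet> (f \<bullet> x)) x)"

text \<open>A telescope takes the quantifier as a parameter: \<open>hpi\<close> gives the statement and \<open>hlam\<close> its proof.\<close>

type_synonym quantifier = "hterm \<Rightarrow> (hterm \<Rightarrow> hterm) \<Rightarrow> hterm"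

lemma inhabitedI: "typechecks [] t T \<Longrightarrow> inhabited T"
  unfolding inhabited_def using typechecks_sound ctx_emp by blast

text \<open>This is how results are combined: a proof term abstracts over the types of the results
  it uses. The checker then sees variables in their place and never has to unfold earlier
  proofs.\<close>

lemma inhabited_mp: "inhabited (A \<rightarrow> B) \<Longrightarrow> inhabited A \<Longrightarrow> inhabited B"
  unfolding inhabited_def Fun_def using pi_elim by (metis lift_inst)

lemmas defs_eval = sets_cover_def LEM_def is_set_def is_contr_def is_conn_map_def fibre_def PropU_def fst_tm_def
  holds_def precomp_def map_local_def refl_subuniverse_def is_local_def family_local_def accessible_def
  single_map_presentation_def Iff_def

subsection \<open>Univalence and function extensionality\<close>

definition preimage :: "hterm \<Rightarrow> hterm \<Rightarrow> hterm \<Rightarrow> hterm \<Rightarrow> hterm" where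
  [hoas]: "preimage C D f y = (SIG x : C. hid D (f \<bullet> x) y)"

definition point_tel where
  [hoas]: "point_tel (Q :: quantifier) K = Q hU1 (\<lambda>C. Q hU1 (\<lambda>D. Q (C \<rightharpoonup> D) (\<lambda>f.
     Q (his_equiv C D f) (\<lambda>e. Q D (\<lambda>y. K C D f e y)))))"

definition [hoas]: "point_ty = point_tel hpi (\<lambda>C D f e y. preimage C D f y)"

text \<open>The right inverse, the first half of \<open>is_equiv\<close>, already supplies a point
  of each fibre. The types range over \<open>Univ 1\<close> because paths in \<open>Univ 0\<close>
  live there; small types are covered by cumulativity.\<close>

lemma point: "inhabited (point_ty 0)"
  by (rule inhabitedI[where t = "point_tel hlam (\<lambda>C D f e y.
        hsplit (\<lambda>_. preimage C D f y) (\<lambda>r l.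
          hsplit (\<lambda>_. preimage C D f y) (\<lambda>g h. \<langle>g \<bullet> y, h \<bullet> y\<rangle>) r) e) 0"])
    (simp only: hoas defs_eval eval_simps cong: eval_congs)

definition ua_tel where
  [hoas]: "ua_tel (Q :: quantifier) K = Q hU (\<lambda>A. Q hU (\<lambda>B. Q (hEquiv A B) (\<lambda>e. K A B e)))"

definition [hoas]: "ua_section_ty = ua_tel hpi (\<lambda>A B e. preimage (hid hU A B) (hEquiv A B) (hidtoeqv A B) e)"

text \<open>The fibre keeps, next to the path, the equation saying that it is sent to the given
  equivalence. Equivalence induction needs this equation to return from the path to that
  equivalence.\<close>

lemma ua_section: "inhabited (ua_section_ty 0)"
  by (rule inhabited_mp[OF inhabitedI[where t = "(LAM pt : point_ty. ua_tel hlam (\<lambda>A B e.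
        pt \<bullet> hid hU A B \<bullet> hEquiv A B \<bullet> hidtoeqv A B \<bullet> hua A B \<bullet> e)) 0"] point])
    (simp only: hoas defs_eval eval_simps cong: eval_congs)

definition [hoas]: "ua_ty = ua_tel hpi (\<lambda>A B e. hid hU A B)"

lemma ua: "inhabited (ua_ty 0)"
  by (rule inhabited_mp[OF inhabitedI[where t = "(LAM us : ua_section_ty. ua_tel hlam (\<lambda>A B e.
        hsplit (\<lambda>_. hid hU A B) (\<lambda>p q. p) (us \<bullet> A \<bullet> B \<bullet> e))) 0"] ua_section])
    (simp only: hoas defs_eval eval_simps cong: eval_congs)

definition funext_tel where
  [hoas]: "funext_tel (Q :: quantifier) K = Q hU (\<lambda>A. Q hU (\<lambda>B. Q (A \<rightharpoonup> B) (\<lambda>f. Q (A \<rightharpoonup> B) (\<lambda>g.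
     Q (hhomotopy A B f g) (\<lambda>h. K A B f g h)))))"

definition [hoas]: "funext_section_ty = funext_tel hpi (\<lambda>A B f g h.
     preimage (hid (A \<rightharpoonup> B) f g) (hhomotopy A B f g) (hhapply A B f g) h)"

lemma funext_section: "inhabited (funext_section_ty 0)"
  by (rule inhabited_mp[OF inhabitedI[where t = "(LAM pt : point_ty. funext_tel hlam (\<lambda>A B f g h.
        pt \<bullet> hid (A \<rightharpoonup> B) f g \<bullet> hhomotopy A B f g \<bullet> hhapply A B f g \<bullet> hfunext f g \<bullet> h)) 0"] point])
    (simp only: hoas defs_eval eval_simps cong: eval_congs)

definition [hoas]: "funext_map_ty = funext_tel hpi (\<lambda>A B f g h. hid (A \<rightharpoonup> B) f g)"

lemma funext_map: "inhabited (funext_map_ty 0)"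
  by (rule inhabited_mp[OF inhabitedI[where t = "(LAM fs : funext_section_ty. funext_tel hlam (\<lambda>A B f g h.
        hsplit (\<lambda>_. hid (A \<rightharpoonup> B) f g) (\<lambda>p q. p) (fs \<bullet> A \<bullet> B \<bullet> f \<bullet> g \<bullet> h))) 0"] funext_section])
    (simp only: hoas defs_eval eval_simps cong: eval_congs)

subsection \<open>Being an equivalence is a proposition\<close>

text \<open>
  By univalence only the identity map needs to be considered. A one-sided inverse of the identity
  is a map together with a homotopy to the identity, and such pairs form a singleton by function
  extensionality.
\<close>

definition [hoas]: "to_identity X = (SIG g : X \<rightharpoonup> X. PI y : X. hid X (g \<bullet> y) y)"

definition [hoas]: "to_identity_center X = \<langle>hid_map X, LAM y : X. hrefl y\<rangle>"

definition [hoas]: "homotopic_maps X g = (SIG h : X \<rightharpoonup> X. PI y : X. hid X (h \<bullet> y) (g \<bullet> y))"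

definition [hoas]: "contraction X f g p =
     hid (homotopic_maps X g) \<langle>f, hhapply X X f g \<bullet> p\<rangle> \<langle>g, LAM y : X. hrefl (g \<bullet> y)\<rangle>"

definition singleton_tel where
  [hoas]: "singleton_tel (Q :: quantifier) K =
     Q hU (\<lambda>X. Q (X \<rightharpoonup> X) (\<lambda>f. Q (X \<rightharpoonup> X) (\<lambda>g. Q (hid (X \<rightharpoonup> X) f g) (\<lambda>p. K X f g p))))"

definition [hoas]: "singleton_ty = singleton_tel hpi contraction"

text \<open>Both functions are left free so that path induction applies to the path between them. At
  reflexivity \<open>happly\<close> computes to the pointwise reflexivities, and the two pairs
  become the same term.\<close>

lemma singleton: "inhabited (singleton_ty 0)"
  by (rule inhabitedI[where t = "(singleton_tel hlam (\<lambda>X f g p. hJ (contraction X)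
        (\<lambda>f. hrefl (hasc (homotopic_maps X f) \<langle>f, LAM y : X. hrefl (f \<bullet> y)\<rangle>)) f g p)) 0"])
    (simp only: hoas defs_eval eval_simps cong: eval_congs)

definition [hoas]: "to_identity_contr_ty = (PI X : hU. PI q : to_identity X. hid (to_identity X) q (to_identity_center X))"

text \<open>Function extensionality exhibits the homotopy \<open>H\<close> as \<open>happly\<close>
  of a path \<open>p\<close>. Transport along that equation reduces the claim to
  \<open>singleton\<close> with the identity as second function.\<close>

lemma to_identity_contr: "inhabited (to_identity_contr_ty 0)"
  by (rule inhabited_mp[OF inhabited_mp[OF inhabitedI[where t = "(LAM si : singleton_ty. LAM fs : funext_section_ty. LAM X : hU. LAM q : to_identity X.
        hsplit (\<lambda>q. hid (to_identity X) q (to_identity_center X)) (\<lambda>g H.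
          hsplit (\<lambda>_. hid (to_identity X) \<langle>g, H\<rangle> (to_identity_center X)) (\<lambda>p e.
            htransport (\<lambda>H'. hid (to_identity X) \<langle>g, H'\<rangle> (to_identity_center X))
              (hhapply X X g (hid_map X) \<bullet> p) H e (si \<bullet> X \<bullet> g \<bullet> hid_map X \<bullet> p))
            (fs \<bullet> X \<bullet> X \<bullet> g \<bullet> hid_map X \<bullet> H)) q) 0"] singleton] funext_section])
    (simp only: hoas defs_eval eval_simps cong: eval_congs)

definition [hoas]: "to_identity_prop_ty = (PI X : hU. his_prop (to_identity X))"

lemma to_identity_prop: "inhabited (to_identity_prop_ty 0)"
  by (rule inhabited_mp[OF inhabitedI[where t = "(LAM c : to_identity_contr_ty. LAM X : hU. LAM p : to_identity X. LAM q : to_identity X.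
        htrans (to_identity X) p (to_identity_center X) q (c \<bullet> X \<bullet> p)
          (hsym (to_identity X) q (to_identity_center X) (c \<bullet> X \<bullet> q))) 0"] to_identity_contr])
    (simp only: hoas defs_eval eval_simps cong: eval_congs)

definition [hoas]: "prod_prop_ty = (PI A : hU. PI B : hU. his_prop A \<rightharpoonup> his_prop B \<rightharpoonup> his_prop (A \<otimes>\<^sub>h B))"

lemma prod_prop: "inhabited (prod_prop_ty 0)"
  by (rule inhabitedI[where t = "(LAM A : hU. LAM B : hU. LAM hA : his_prop A. LAM hB : his_prop B.
        LAM p : A \<otimes>\<^sub>h B. LAM q : A \<otimes>\<^sub>h B.
          hsplit (\<lambda>p. hid (A \<otimes>\<^sub>h B) p q) (\<lambda>a b. hsplit (\<lambda>q. hid (A \<otimes>\<^sub>h B) \<langle>a, b\<rangle> q) (\<lambda>c d.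
            htrans (A \<otimes>\<^sub>h B) \<langle>a, b\<rangle> \<langle>c, b\<rangle> \<langle>c, d\<rangle>
              (hap (A \<otimes>\<^sub>h B) (\<lambda>z. hasc (A \<otimes>\<^sub>h B) \<langle>z, b\<rangle>) a c (hA \<bullet> a \<bullet> c))
              (hap (A \<otimes>\<^sub>h B) (\<lambda>z. hasc (A \<otimes>\<^sub>h B) \<langle>c, z\<rangle>) b d (hB \<bullet> b \<bullet> d))) q) p) 0"])
    (simp only: hoas defs_eval eval_simps cong: eval_congs)

definition [hoas]: "id_equiv_prop_ty = (PI X : hU. his_prop (his_equiv X X (hid_map X)))"

lemma id_equiv_prop: "inhabited (id_equiv_prop_ty 0)"
  by (rule inhabited_mp[OF inhabited_mp[OF inhabitedI[where t = "(LAM pp : prod_prop_ty. LAM ip : to_identity_prop_ty. LAM X : hU.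
        pp \<bullet> to_identity X \<bullet> to_identity X \<bullet> (ip \<bullet> X) \<bullet> (ip \<bullet> X)) 0"] prod_prop] to_identity_prop])
    (simp only: hoas defs_eval eval_simps cong: eval_congs)

definition [hoas]: "map_predicate = (PI X : hU. PI Y : hU. (X \<rightharpoonup> Y) \<rightharpoonup> hU)"

definition equiv_ind_tel where
  [hoas]: "equiv_ind_tel (Q :: quantifier) K = Q map_predicate (\<lambda>R. Q (PI X : hU. R \<bullet> X \<bullet> X \<bullet> hid_map X) (\<lambda>h.
     Q hU (\<lambda>A. Q hU (\<lambda>B. K R h A B))))"

definition [hoas]: "Equiv_ind_ty = equiv_ind_tel hpi (\<lambda>R h A B. PI y : hEquiv A B. R \<bullet> A \<bullet> B \<bullet> hfst (A \<rightharpoonup> B) y)"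

text \<open>Univalence writes the equivalence as the image of a path, and path induction leaves the
  identity equivalence, whose underlying map reduces to \<open>hid_map X\<close>. The predicate
  depends on the map alone, but transport runs over packaged equivalences, since that is where the
  equation from univalence lives.\<close>

lemma Equiv_ind: "inhabited (Equiv_ind_ty 0)"
  by (rule inhabited_mp[OF inhabitedI[where t = "(LAM us : ua_section_ty. equiv_ind_tel hlam (\<lambda>R h A B. LAM y : hEquiv A B.
        hsplit (\<lambda>_. R \<bullet> A \<bullet> B \<bullet> hfst (A \<rightharpoonup> B) y) (\<lambda>p e.
          htransport (\<lambda>q. R \<bullet> A \<bullet> B \<bullet> hfst (A \<rightharpoonup> B) q) (hidtoeqv A B \<bullet> p) y e
            (hJ (\<lambda>X Y p. R \<bullet> X \<bullet> Y \<bullet> hfst (X \<rightharpoonup> Y) (hidtoeqv X Y \<bullet> p)) (\<lambda>X. h \<bullet> X) A B p))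
          (us \<bullet> A \<bullet> B \<bullet> y))) 0"] ua_section])
    (simp only: hoas defs_eval eval_simps cong: eval_congs)

definition [hoas]: "equiv_ind_ty = equiv_ind_tel hpi (\<lambda>R h A B. PI f : A \<rightharpoonup> B. his_equiv A B f \<rightharpoonup> R \<bullet> A \<bullet> B \<bullet> f)"

lemma equiv_ind: "inhabited (equiv_ind_ty 0)"
  by (rule inhabited_mp[OF inhabitedI[where t = "(LAM ei : Equiv_ind_ty. equiv_ind_tel hlam (\<lambda>R h A B. LAM f : A \<rightharpoonup> B. LAM e : his_equiv A B f.
        ei \<bullet> R \<bullet> h \<bullet> A \<bullet> B \<bullet> hasc (hEquiv A B) \<langle>f, e\<rangle>)) 0"] Equiv_ind])
    (simp only: hoas defs_eval eval_simps cong: eval_congs)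

definition [hoas]: "equiv_prop_ty = (PI A : hU. PI B : hU. PI f : A \<rightharpoonup> B. his_prop (his_equiv A B f))"

text \<open>In proving that a type is a proposition an element of it may be assumed. The first
  \<open>e\<close> is that element: it makes \<open>f\<close> an equivalence, so equivalence
  induction applies to the predicate saying that being an equivalence is a proposition, with
  \<open>id_equiv_prop\<close> as base. The last two arguments \<open>e\<close> and
  \<open>e'\<close> are the ones compared.\<close>

lemma equiv_prop: "inhabited (equiv_prop_ty 0)"
  by (rule inhabited_mp[OF inhabited_mp[OF inhabitedI[where t = "(LAM ip : id_equiv_prop_ty. LAM ei : equiv_ind_ty.
        LAM A : hU. LAM B : hU. LAM f : A \<rightharpoonup> B. LAM e : his_equiv A B f. LAM e' : his_equiv A B f.
          ei \<bullet> (LAM X : hU. LAM Y : hU. LAM f : X \<rightharpoonup> Y. his_prop (his_equiv X Y f)) \<bullet> ip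
            \<bullet> A \<bullet> B \<bullet> f \<bullet> e \<bullet> e \<bullet> e' ) 0"] id_equiv_prop] equiv_ind])
    (simp only: hoas defs_eval eval_simps cong: eval_congs)

subsection \<open>Descent along a surjection, and the empty type\<close>

definition descend_tel where
  [hoas]: "descend_tel (Q :: quantifier) K = Q hU (\<lambda>I. Q hU (\<lambda>S. Q (S \<rightharpoonup> I) (\<lambda>e. Q (hconn S I e) (\<lambda>c.
     Q (I \<rightharpoonup> hU) (\<lambda>P. Q (PI i : I. his_prop (P \<bullet> i)) (\<lambda>hP. Q (PI s : S. P \<bullet> (e \<bullet> s)) (\<lambda>h.
       Q I (\<lambda>i. K I S e c P hP h i))))))))"

definition [hoas]: "descend_ty = descend_tel hpi (\<lambda>I S e c P hP h i. P \<bullet> i)"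

text \<open>The centre of the contractible truncated fibre over \<open>i\<close> can be eliminated
  because \<open>P i\<close> is a proposition; an actual point of the fibre transports the given
  element to \<open>i\<close>.\<close>

lemma descend: "inhabited (descend_ty 0)"
  by (rule inhabitedI[where t = "(descend_tel hlam (\<lambda>I S e c P hP h i. htrec (P \<bullet> i) (hP \<bullet> i)
        (LAM w : hfibre S I e i. hsplit (\<lambda>_. P \<bullet> i) (\<lambda>s p. htransport (\<lambda>j. P \<bullet> j) (e \<bullet> s) i p (h \<bullet> s)) w)
        (hfst (htrunc (hfibre S I e i)) (c \<bullet> i)))) 0"])
    (simp only: hoas defs_eval eval_simps cong: eval_congs)

definition empty_tel where
  [hoas]: "empty_tel (Q :: quantifier) K =
     Q hU (\<lambda>X. Q (hnot X) (\<lambda>h. Q (hU \<rightharpoonup> hU) (\<lambda>P. Q (P \<bullet> hempty) (\<lambda>e. K X h P e))))"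

definition [hoas]: "empty_transfer_ty = empty_tel hpi (\<lambda>X h P e. P \<bullet> X)"

text \<open>The given map \<open>h\<close> to the empty type serves as inverse on both sides of the
  map out of the empty type; all homotopies hold by absurdity, and univalence turns the equivalence
  into a path.\<close>

lemma empty_transfer: "inhabited (empty_transfer_ty 0)"
  by (rule inhabited_mp[OF inhabitedI[where t = "(LAM u : ua_ty. empty_tel hlam (\<lambda>X h P e. htransport (\<lambda>Y. P \<bullet> Y) hempty X
        (u \<bullet> hempty \<bullet> X \<bullet> \<langle>LAM z : hempty. habsurd (\<lambda>_. X) z,
          \<langle>\<langle>h, LAM x : X. habsurd (\<lambda>_. hid X (habsurd (\<lambda>_. X) (h \<bullet> x)) x) (h \<bullet> x)\<rangle>,
            \<langle>h, LAM z : hempty. habsurd (\<lambda>z. hid hempty (h \<bullet> habsurd (\<lambda>_. X) z) z) z\<rangle>\<rangle>\<rangle>) e)) 0"] ua])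
    (simp only: hoas defs_eval eval_simps cong: eval_congs)

subsection \<open>Retracts of a sum of maps\<close>

text \<open>This is the value, at \<open>a\<close> over \<open>s\<close>, of the extension of
  \<open>q\<close> from the fibre over \<open>s'\<close> to the whole sum with default value
  \<open>x\<close>. The decision \<open>d\<close> is a separate argument, so that case analysis can
  run over a variable.\<close>

definition [hoas]: "extend_case S C X x s s' q a d =
     hcase (\<lambda>_. X) (\<lambda>e. q \<bullet> htransport (\<lambda>z. C \<bullet> z) s s' e a) (\<lambda>n. x) d"

definition case_refl_tel where
  [hoas]: "case_refl_tel (Q :: quantifier) K = Q hU (\<lambda>S. Q (his_set S) (\<lambda>h. Q (S \<rightharpoonup> hU) (\<lambda>C. Q hU (\<lambda>X. Q X (\<lambda>x.
     Q S (\<lambda>s. Q (C \<bullet> s \<rightharpoonup> X) (\<lambda>q. Q (C \<bullet> s) (\<lambda>a. Q (hdec (hid S s s)) (\<lambda>d. K S h C X x s q a d)))))))))"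

definition [hoas]: "case_refl_ty =
     case_refl_tel hpi (\<lambda>S h C X x s q a d. hid X (extend_case S C X x s s q a d) (q \<bullet> a))"

text \<open>A positive decision may return any loop at \<open>s\<close>, and transport along it
  could move \<open>a\<close>. As \<open>S\<close> is a set, the loop equals reflexivity and the
  transport is trivial; a negative decision is refuted by reflexivity.\<close>

lemma case_refl: "inhabited (case_refl_ty 0)"
  by (rule inhabitedI[where t = "(case_refl_tel hlam (\<lambda>S h C X x s q a d.
        hcase (\<lambda>d. hid X (extend_case S C X x s s q a d) (q \<bullet> a))
          (\<lambda>e. htransport (\<lambda>e. hid X (q \<bullet> htransport (\<lambda>z. C \<bullet> z) s s e a) (q \<bullet> a)) (hrefl s) e
            (h \<bullet> s \<bullet> s \<bullet> hrefl s \<bullet> e) (hrefl (q \<bullet> a)))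
          (\<lambda>n. habsurd (\<lambda>_. hid X x (q \<bullet> a)) (n \<bullet> hrefl s)) d)) 0"])
    (simp only: hoas defs_eval eval_simps cong: eval_congs)

definition [hoas]: "hpullback A f s p = (LAM a : A \<bullet> s. p \<bullet> (f \<bullet> s \<bullet> a))"

definition family_tel where
  [hoas]: "family_tel S (Q :: quantifier) K =
     Q (S \<rightharpoonup> hU) (\<lambda>A. Q (S \<rightharpoonup> hU) (\<lambda>B. Q (PI s : S. A \<bullet> s \<rightharpoonup> B \<bullet> s) (\<lambda>f. K A B f)))"

definition [hoas]: "case_natural_eq S A B f X x s s' p a d =
     hid X (extend_case S A X x s s' (hpullback A f s' p) a d) (extend_case S B X x s s' p (f \<bullet> s \<bullet> a) d)"

definition case_natural_tel where
  [hoas]: "case_natural_tel (Q :: quantifier) K = Q hU (\<lambda>S. family_tel S Q (\<lambda>A B f. Q hU (\<lambda>X. Q X (\<lambda>x.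
     Q S (\<lambda>s. Q S (\<lambda>s'. Q (B \<bullet> s' \<rightharpoonup> X) (\<lambda>p. Q (A \<bullet> s) (\<lambda>a. Q (hdec (hid S s s')) (\<lambda>d.
       K S A B f X x s s' p a d)))))))))"

definition [hoas]: "case_natural_ty = case_natural_tel hpi case_natural_eq"

text \<open>On a positive decision this is naturality of transport with respect to \<open>f\<close>,
  proved by path induction with \<open>p\<close> and \<open>a\<close> generalised, since their types
  depend on the endpoints. On a negative decision both sides are \<open>x\<close>.\<close>

lemma case_natural: "inhabited (case_natural_ty 0)"
  by (rule inhabitedI[where t = "(case_natural_tel hlam (\<lambda>S A B f X x s s' p a d.
        hcase (case_natural_eq S A B f X x s s' p a)
          (\<lambda>e. hJ (\<lambda>y z q. PI p : B \<bullet> z \<rightharpoonup> X. PI a : A \<bullet> y.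
                hid X (p \<bullet> (f \<bullet> z \<bullet> htransport (\<lambda>t. A \<bullet> t) y z q a)) (p \<bullet> htransport (\<lambda>t. B \<bullet> t) y z q (f \<bullet> y \<bullet> a)))
              (\<lambda>y. LAM p : B \<bullet> y \<rightharpoonup> X. LAM a : A \<bullet> y. hrefl (p \<bullet> (f \<bullet> y \<bullet> a))) s s' e \<bullet> p \<bullet> a)
          (\<lambda>n. hrefl x) d)) 0"])
    (simp only: hoas defs_eval eval_simps cong: eval_congs)

definition [hoas]: "total_space S A = (SIG s : S. A \<bullet> s)"

definition [hoas]: "total_map S A B f = (LAM z : total_space S A. hsplit (\<lambda>_. total_space S B) (\<lambda>s a. \<langle>s, f \<bullet> s \<bullet> a\<rangle>) z)"

definition [hoas]: "total_precomp S A B f X = hprecomp (total_space S A) (total_space S B) (total_map S A B f) X"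

definition [hoas]: "fibre_precomp A B f X s = hprecomp (A \<bullet> s) (B \<bullet> s) (f \<bullet> s) X"

definition [hoas]: "total_local S A B f X = hmap_local (total_space S A) (total_space S B) (total_map S A B f) X"

definition [hoas]: "fibre_local A B f X s = hmap_local (A \<bullet> s) (B \<bullet> s) (f \<bullet> s) X"

definition [hoas]: "extension S d C X x s q =
     (LAM z : total_space S C. hsplit (\<lambda>_. X) (\<lambda>s' a. extend_case S C X x s' s q a (d \<bullet> s' \<bullet> s)) z)"

definition retract_tel where
  [hoas]: "retract_tel (Q :: quantifier) K = Q hU (\<lambda>S. Q (his_set S) (\<lambda>h. Q (PI s : S. PI t : S. hdec (hid S s t)) (\<lambda>d.
     family_tel S Q (\<lambda>A B f. Q hU (\<lambda>X. Q X (\<lambda>x. Q S (\<lambda>s. K S h d A B f X x s)))))))"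

definition [hoas]: "total_right_inv S A B f X = hright_inv (total_space S B \<rightharpoonup> X) (total_space S A \<rightharpoonup> X) (total_precomp S A B f X)"

definition [hoas]: "fibre_right_inv A B f X s = hright_inv (B \<bullet> s \<rightharpoonup> X) (A \<bullet> s \<rightharpoonup> X) (fibre_precomp A B f X s)"

definition [hoas]: "retract_right_ty =
     retract_tel hpi (\<lambda>S h d A B f X x s. total_right_inv S A B f X \<rightharpoonup> fibre_right_inv A B f X s)"

definition [hoas]: "total_left_inv S A B f X = hleft_inv (total_space S B \<rightharpoonup> X) (total_space S A \<rightharpoonup> X) (total_precomp S A B f X)"

definition [hoas]: "fibre_left_inv A B f X s = hleft_inv (B \<bullet> s \<rightharpoonup> X) (A \<bullet> s \<rightharpoonup> X) (fibre_precomp A B f X s)"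

definition [hoas]: "retract_left_ty =
     retract_tel hpi (\<lambda>S h d A B f X x s. total_left_inv S A B f X \<rightharpoonup> fibre_left_inv A B f X s)"

text \<open>Extension by \<open>x\<close> and restriction to the fibre over \<open>s\<close> are the
  section and retraction of the retract. Conjugating the one-sided inverse \<open>r\<close> of the
  total precomposition with them gives the candidate inverse over \<open>s\<close>.\<close>

definition [hoas]: "restricted_inverse S d A B X x s r =
     (LAM q : A \<bullet> s \<rightharpoonup> X. LAM b : B \<bullet> s. r \<bullet> extension S d A X x s q \<bullet> hasc (total_space S B) \<langle>s, b\<rangle>)"

text \<open>Precomposing the restriction of a function on the sum with \<open>f s\<close> is,
  judgmentally, restricting its precomposition with the total map. The hypothesis \<open>al\<close>
  then cancels \<open>r\<close> on the extension of \<open>q\<close>, and \<open>case_refl\<close>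
  says that the restriction of this extension is \<open>q\<close>.\<close>

lemma retract_right: "inhabited (retract_right_ty 0)"
  by (rule inhabited_mp[OF inhabited_mp[OF inhabitedI[where t = "(LAM fe : funext_map_ty. LAM cr : case_refl_ty.
        retract_tel hlam (\<lambda>S h d A B f X x s. LAM w : total_right_inv S A B f X.
          hsplit (\<lambda>_. fibre_right_inv A B f X s) (\<lambda>r al.
            \<langle>restricted_inverse S d A B X x s r, LAM q : A \<bullet> s \<rightharpoonup> X.
              fe \<bullet> (A \<bullet> s) \<bullet> X \<bullet> (fibre_precomp A B f X s \<bullet> (restricted_inverse S d A B X x s r \<bullet> q)) \<bullet> q
              \<bullet> (LAM a : A \<bullet> s. htrans X
                (fibre_precomp A B f X s \<bullet> (restricted_inverse S d A B X x s r \<bullet> q) \<bullet> a)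
                (extension S d A X x s q \<bullet> hasc (total_space S A) \<langle>s, a\<rangle>)
                (q \<bullet> a)
                (hap X (\<lambda>v. v \<bullet> hasc (total_space S A) \<langle>s, a\<rangle>)
                  (total_precomp S A B f X \<bullet> (r \<bullet> extension S d A X x s q)) (extension S d A X x s q)
                  (al \<bullet> extension S d A X x s q))
                (cr \<bullet> S \<bullet> h \<bullet> A \<bullet> X \<bullet> x \<bullet> s \<bullet> q \<bullet> a \<bullet> (d \<bullet> s \<bullet> s)))\<rangle>) w)) 0"] funext_map] case_refl])
    (simp only: hoas defs_eval eval_simps cong: eval_congs)

text \<open>By \<open>case_natural\<close> and function extensionality, the extension of the
  pulled-back map is the total precomposition of the extension of \<open>p\<close>. Then
  \<open>be\<close> cancels \<open>r\<close>, and \<open>case_refl\<close> restricts the extension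
  back to \<open>p\<close>.\<close>

lemma retract_left: "inhabited (retract_left_ty 0)"
  by (rule inhabited_mp[OF inhabited_mp[OF inhabited_mp[OF inhabitedI[where t = "(LAM fe : funext_map_ty. LAM cr : case_refl_ty. LAM cn : case_natural_ty.
        retract_tel hlam (\<lambda>S h d A B f X x s. LAM w : total_left_inv S A B f X.
          hsplit (\<lambda>_. fibre_left_inv A B f X s) (\<lambda>r be.
            \<langle>restricted_inverse S d A B X x s r, LAM p : B \<bullet> s \<rightharpoonup> X.
              fe \<bullet> (B \<bullet> s) \<bullet> X \<bullet> (restricted_inverse S d A B X x s r \<bullet> (fibre_precomp A B f X s \<bullet> p)) \<bullet> p
              \<bullet> (LAM b : B \<bullet> s. htrans X
                (r \<bullet> extension S d A X x s (hpullback A f s p) \<bullet> hasc (total_space S B) \<langle>s, b\<rangle>)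
                (r \<bullet> (total_precomp S A B f X \<bullet> extension S d B X x s p) \<bullet> hasc (total_space S B) \<langle>s, b\<rangle>)
                (p \<bullet> b)
                (hap X (\<lambda>v. r \<bullet> v \<bullet> hasc (total_space S B) \<langle>s, b\<rangle>)
                  (extension S d A X x s (hpullback A f s p)) (total_precomp S A B f X \<bullet> extension S d B X x s p)
                  (fe \<bullet> total_space S A \<bullet> X \<bullet> extension S d A X x s (hpullback A f s p)
                    \<bullet> (total_precomp S A B f X \<bullet> extension S d B X x s p)
                    \<bullet> (LAM z : total_space S A. hsplit
                      (\<lambda>z. hid X (extension S d A X x s (hpullback A f s p) \<bullet> z)
                        (total_precomp S A B f X \<bullet> extension S d B X x s p \<bullet> z))
                      (\<lambda>s' a. cn \<bullet> S \<bullet> A \<bullet> B \<bullet> f \<bullet> X \<bullet> x \<bullet> s' \<bullet> s \<bullet> p \<bullet> a \<bullet> (d \<bullet> s' \<bullet> s)) z)))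
                (htrans X
                  (r \<bullet> (total_precomp S A B f X \<bullet> extension S d B X x s p) \<bullet> hasc (total_space S B) \<langle>s, b\<rangle>)
                  (extension S d B X x s p \<bullet> hasc (total_space S B) \<langle>s, b\<rangle>)
                  (p \<bullet> b)
                  (hap X (\<lambda>u. u \<bullet> hasc (total_space S B) \<langle>s, b\<rangle>)
                    (r \<bullet> (total_precomp S A B f X \<bullet> extension S d B X x s p)) (extension S d B X x s p)
                    (be \<bullet> extension S d B X x s p))
                  (cr \<bullet> S \<bullet> h \<bullet> B \<bullet> X \<bullet> x \<bullet> s \<bullet> p \<bullet> b \<bullet> (d \<bullet> s \<bullet> s))))\<rangle>) w)) 0"] funext_map] case_refl] case_natural])
    (simp only: hoas defs_eval eval_simps cong: eval_congs)

definition [hoas]: "retract_ty =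
     retract_tel hpi (\<lambda>S h d A B f X x s. total_local S A B f X \<rightharpoonup> fibre_local A B f X s)"

lemma retract: "inhabited (retract_ty 0)"
  by (rule inhabited_mp[OF inhabited_mp[OF inhabitedI[where t = "(LAM rr : retract_right_ty. LAM rl : retract_left_ty.
        retract_tel hlam (\<lambda>S h d A B f X x s. LAM w : total_local S A B f X.
          hsplit (\<lambda>_. fibre_local A B f X s) (\<lambda>u v.
            \<langle>rr \<bullet> S \<bullet> h \<bullet> d \<bullet> A \<bullet> B \<bullet> f \<bullet> X \<bullet> x \<bullet> s \<bullet> u, rl \<bullet> S \<bullet> h \<bullet> d \<bullet> A \<bullet> B \<bullet> f \<bullet> X \<bullet> x \<bullet> s \<bullet> v\<rangle>) w)) 0"] retract_right] retract_left])
    (simp only: hoas defs_eval eval_simps cong: eval_congs)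

subsection \<open>Products of equivalences\<close>

definition product_tel where
  [hoas]: "product_tel (Q :: quantifier) K = Q hU (\<lambda>S. family_tel S Q (\<lambda>A B f. Q hU (\<lambda>X. K S A B f X)))"

definition [hoas]: "product_right_ty = product_tel hpi (\<lambda>S A B f X.
     (PI s : S. fibre_right_inv A B f X s) \<rightharpoonup> total_right_inv S A B f X)"

definition [hoas]: "product_left_ty = product_tel hpi (\<lambda>S A B f X.
     (PI s : S. fibre_left_inv A B f X s) \<rightharpoonup> total_left_inv S A B f X)"

definition [hoas]: "restriction S C s v = (LAM a : C \<bullet> s. v \<bullet> hasc (total_space S C) \<langle>s, a\<rangle>)"

definition [hoas]: "fibre_inverse A B X w s = hfst ((A \<bullet> s \<rightharpoonup> X) \<rightharpoonup> B \<bullet> s \<rightharpoonup> X) (w \<bullet> s)"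

text \<open>A function on the sum is restricted to each fibre and inverted there. The formula uses
  only the underlying maps of the fibrewise inverses, so it serves for right and left inverses
  alike.\<close>

definition [hoas]: "product_inverse S A B X w = (LAM v : total_space S A \<rightharpoonup> X. LAM z : total_space S B.
     hsplit (\<lambda>_. X) (\<lambda>s b. fibre_inverse A B X w s \<bullet> restriction S A s v \<bullet> b) z)"

text \<open>At a pair both sides reduce to values of functions on a single fibre, so the fibrewise
  equation, evaluated at \<open>a\<close>, is what remains.\<close>

lemma product_right: "inhabited (product_right_ty 0)"
  by (rule inhabited_mp[OF inhabitedI[where t = "(LAM fe : funext_map_ty.
        product_tel hlam (\<lambda>S A B f X. LAM w : (PI s : S. fibre_right_inv A B f X s).
          \<langle>product_inverse S A B X w, LAM v : total_space S A \<rightharpoonup> X.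
            fe \<bullet> total_space S A \<bullet> X \<bullet> (total_precomp S A B f X \<bullet> (product_inverse S A B X w \<bullet> v)) \<bullet> v
            \<bullet> (LAM z : total_space S A. hsplit
              (\<lambda>z. hid X (total_precomp S A B f X \<bullet> (product_inverse S A B X w \<bullet> v) \<bullet> z) (v \<bullet> z))
              (\<lambda>s a. hap X (\<lambda>u. u \<bullet> a)
                (fibre_precomp A B f X s \<bullet> (fibre_inverse A B X w s \<bullet> restriction S A s v)) (restriction S A s v)
                (hsnd ((A \<bullet> s \<rightharpoonup> X) \<rightharpoonup> B \<bullet> s \<rightharpoonup> X)
                  (\<lambda>g. PI y : A \<bullet> s \<rightharpoonup> X. hid (A \<bullet> s \<rightharpoonup> X) (fibre_precomp A B f X s \<bullet> (g \<bullet> y)) y)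
                  (w \<bullet> s) \<bullet> restriction S A s v)) z)\<rangle>)) 0"] funext_map])
    (simp only: hoas defs_eval eval_simps cong: eval_congs)

text \<open>Restricting a total precomposition agrees judgmentally with the fibre precomposition of
  the restriction. At each pair this leaves the fibrewise left inverse law, evaluated at
  \<open>b\<close>.\<close>

lemma product_left: "inhabited (product_left_ty 0)"
  by (rule inhabited_mp[OF inhabitedI[where t = "(LAM fe : funext_map_ty.
        product_tel hlam (\<lambda>S A B f X. LAM w : (PI s : S. fibre_left_inv A B f X s).
          \<langle>product_inverse S A B X w, LAM u : total_space S B \<rightharpoonup> X.
            fe \<bullet> total_space S B \<bullet> X \<bullet> (product_inverse S A B X w \<bullet> (total_precomp S A B f X \<bullet> u)) \<bullet> u
            \<bullet> (LAM z : total_space S B. hsplit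
              (\<lambda>z. hid X (product_inverse S A B X w \<bullet> (total_precomp S A B f X \<bullet> u) \<bullet> z) (u \<bullet> z))
              (\<lambda>s b. hap X (\<lambda>v. v \<bullet> b)
                (fibre_inverse A B X w s \<bullet> (fibre_precomp A B f X s \<bullet> restriction S B s u)) (restriction S B s u)
                (hsnd ((A \<bullet> s \<rightharpoonup> X) \<rightharpoonup> B \<bullet> s \<rightharpoonup> X)
                  (\<lambda>g. PI y : B \<bullet> s \<rightharpoonup> X. hid (B \<bullet> s \<rightharpoonup> X) (g \<bullet> (fibre_precomp A B f X s \<bullet> y)) y)
                  (w \<bullet> s) \<bullet> restriction S B s u)) z)\<rangle>)) 0"] funext_map])
    (simp only: hoas defs_eval eval_simps cong: eval_congs)

definition [hoas]: "product_ty = product_tel hpi (\<lambda>S A B f X. (PI s : S. fibre_local A B f X s) \<rightharpoonup> total_local S A B f X)"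

lemma product: "inhabited (product_ty 0)"
  by (rule inhabited_mp[OF inhabited_mp[OF inhabitedI[where t = "(LAM pr : product_right_ty. LAM pl : product_left_ty.
        product_tel hlam (\<lambda>S A B f X. LAM w : (PI s : S. fibre_local A B f X s).
          \<langle>pr \<bullet> S \<bullet> A \<bullet> B \<bullet> f \<bullet> X \<bullet> (LAM s : S. hfst (fibre_right_inv A B f X s) (w \<bullet> s)),
           pl \<bullet> S \<bullet> A \<bullet> B \<bullet> f \<bullet> X \<bullet> (LAM s : S.
             hsnd (fibre_right_inv A B f X s) (\<lambda>_. fibre_left_inv A B f X s) (w \<bullet> s))\<rangle>)) 0"] product_right] product_left])
    (simp only: hoas defs_eval eval_simps cong: eval_congs)

subsection \<open>Presentation by a single map\<close>

text \<open>The predicate of local types is abstracted to a variable \<open>P\<close> with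
  propositional values, which keeps projections out of \<open>L\<close> away from the terms to be
  checked.\<close>

definition predicate_tel where
  [hoas]: "predicate_tel (Q :: quantifier) K = Q hLEM (\<lambda>lem. Q (hU \<rightharpoonup> hU) (\<lambda>P. Q (PI X : hU. his_prop (P \<bullet> X)) (\<lambda>hP.
     Q (P \<bullet> hempty) (\<lambda>e. Q hU (\<lambda>S. Q (his_set S) (\<lambda>h. family_tel S Q (\<lambda>A B f. K lem P hP e S h A B f)))))))"

definition [hoas]: "backward_ty = predicate_tel hpi (\<lambda>lem P hP e S h A B f. PI X : hU.
     (hfamily_local S A B f X \<rightharpoonup> P \<bullet> X) \<rightharpoonup> total_local S A B f X \<rightharpoonup> P \<bullet> X)"

text \<open>Excluded middle is applied to two propositions: to \<open>hid S s t\<close>, where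
  \<open>h\<close> says that it is one, and to \<open>htrunc X\<close>, where \<open>htpath\<close>
  does. The truncated point may be eliminated because \<open>P X\<close> is a proposition, and only
  then is a default value for the extensions available.\<close>

lemma backward: "inhabited (backward_ty 0)"
  by (rule inhabited_mp[OF inhabited_mp[OF inhabitedI[where t = "(LAM em : empty_transfer_ty. LAM re : retract_ty.
        predicate_tel hlam (\<lambda>lem P hP e S h A B f. LAM X : hU.
          LAM k : hfamily_local S A B f X \<rightharpoonup> P \<bullet> X. LAM w : total_local S A B f X.
            hcase (\<lambda>_. P \<bullet> X)
              (\<lambda>t. htrec (P \<bullet> X) (hP \<bullet> X) (LAM x : X. k \<bullet> (LAM s : S.
                re \<bullet> S \<bullet> h \<bullet> (LAM s : S. LAM t : S. lem \<bullet> hid S s t \<bullet> (h \<bullet> s \<bullet> t)) \<bullet> A \<bullet> B \<bullet> f \<bullet> X \<bullet> x \<bullet> s \<bullet> w)) t)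
              (\<lambda>n. em \<bullet> X \<bullet> (LAM x : X. n \<bullet> htin x) \<bullet> P \<bullet> e)
              (lem \<bullet> htrunc X \<bullet> (LAM x : htrunc X. LAM y : htrunc X. htpath x y)))) 0"] empty_transfer] retract])
    (simp only: hoas defs_eval eval_simps cong: eval_congs)

definition [hoas]: "family_presents P I A B f = (PI X : hU. hIff (P \<bullet> X) (hfamily_local I A B f X))"

definition [hoas]: "single_map P = (SIG A : hU. SIG B : hU. SIG g : A \<rightharpoonup> B.
     PI X : hU. hIff (P \<bullet> X) (hmap_local A B g X))"

definition [hoas]: "set_indexed_ty = predicate_tel hpi (\<lambda>lem P hP e S h A B f. family_presents P S A B f \<rightharpoonup> single_map P)"

lemma set_indexed: "inhabited (set_indexed_ty 0)"
  by (rule inhabited_mp[OF inhabited_mp[OF inhabitedI[where t = "(LAM pr : product_ty. LAM bw : backward_ty.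
        predicate_tel hlam (\<lambda>lem P hP e S h A B f. LAM loc : family_presents P S A B f.
          \<langle>total_space S A, \<langle>total_space S B, \<langle>total_map S A B f, LAM X : hU.
            hsplit (\<lambda>_. hIff (P \<bullet> X) (total_local S A B f X)) (\<lambda>to from.
              \<langle>LAM l : P \<bullet> X. pr \<bullet> S \<bullet> A \<bullet> B \<bullet> f \<bullet> X \<bullet> (to \<bullet> l),
               LAM w : total_local S A B f X. bw \<bullet> lem \<bullet> P \<bullet> hP \<bullet> e \<bullet> S \<bullet> h \<bullet> A \<bullet> B \<bullet> f \<bullet> X \<bullet> from \<bullet> w\<rangle>)
              (loc \<bullet> X)\<rangle>\<rangle>\<rangle>)) 0"] product] backward])
    (simp only: hoas defs_eval eval_simps cong: eval_congs)

section \<open>Replacing the index type by its set cover\<close>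

definition reindex_tel where
  [hoas]: "reindex_tel (Q :: quantifier) K = Q (hU \<rightharpoonup> hU) (\<lambda>P. Q hU (\<lambda>I. family_tel I Q (\<lambda>A B f.
     Q (family_presents P I A B f) (\<lambda>loc. Q hU (\<lambda>S. Q (S \<rightharpoonup> I) (\<lambda>e. Q (hconn S I e) (\<lambda>c. Q hU (\<lambda>X.
       K P I A B f loc S e c X))))))))"

definition [hoas]: "reindex_ty = reindex_tel hpi (\<lambda>P I A B f loc S e c X.
     hIff (P \<bullet> X) (PI s : S. fibre_local A B f X (e \<bullet> s)))"

text \<open>One direction evaluates the family at \<open>e s\<close>. The other descends along the
  surjection \<open>e\<close>, with \<open>equiv_prop\<close> showing that locality at each index is
  a proposition.\<close>

lemma reindex: "inhabited (reindex_ty 0)"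
  by (rule inhabited_mp[OF inhabited_mp[OF inhabitedI[where t = "(LAM de : descend_ty. LAM ep : equiv_prop_ty.
        reindex_tel hlam (\<lambda>P I A B f loc S e c X.
          hsplit (\<lambda>_. hIff (P \<bullet> X) (PI s : S. fibre_local A B f X (e \<bullet> s))) (\<lambda>to from.
            \<langle>LAM l : P \<bullet> X. LAM s : S. to \<bullet> l \<bullet> (e \<bullet> s),
             LAM w : (PI s : S. fibre_local A B f X (e \<bullet> s)). from \<bullet> (de \<bullet> I \<bullet> S \<bullet> e \<bullet> c
               \<bullet> (LAM i : I. fibre_local A B f X i)
               \<bullet> (LAM i : I. ep \<bullet> (B \<bullet> i \<rightharpoonup> X) \<bullet> (A \<bullet> i \<rightharpoonup> X) \<bullet> fibre_precomp A B f X i) \<bullet> w)\<rangle>) (loc \<bullet> X))) 0"] descend] equiv_prop])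
    (simp only: hoas defs_eval eval_simps cong: eval_congs)

definition [hoas]: "accessible_predicate P =
     (SIG I : hU. SIG A : I \<rightharpoonup> hU. SIG B : I \<rightharpoonup> hU. SIG f : (PI i : I. A \<bullet> i \<rightharpoonup> B \<bullet> i). family_presents P I A B f)"

definition unpack_tel where
  [hoas]: "unpack_tel (Q :: quantifier) P K = Q hU (\<lambda>I. family_tel I Q (\<lambda>A B f.
     Q (family_presents P I A B f) (\<lambda>loc. K I A B f loc)))"

definition [hoas]: "unpack_ty = (PI P : hU \<rightharpoonup> hU. PI G : hU1.
     unpack_tel hpi P (\<lambda>I A B f loc. G) \<rightharpoonup> accessible_predicate P \<rightharpoonup> G)"

text \<open>The nested sums are opened once, in continuation form. The result type \<open>G\<close>
  ranges over \<open>Univ 1\<close> because a presentation quantifies over all types in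
  \<open>Univ 0\<close>.\<close>

lemma unpack: "inhabited (unpack_ty 0)"
  by (rule inhabitedI[where t = "(LAM P : hU \<rightharpoonup> hU. LAM G : hU1. LAM k : unpack_tel hpi P (\<lambda>I A B f loc. G).
        LAM a : accessible_predicate P.
          hsplit (\<lambda>_. G) (\<lambda>I r. hsplit (\<lambda>_. G) (\<lambda>A r. hsplit (\<lambda>_. G) (\<lambda>B r. hsplit (\<lambda>_. G) (\<lambda>f loc.
            k \<bullet> I \<bullet> A \<bullet> B \<bullet> f \<bullet> loc) r) r) r) a) 0"])
    (simp only: hoas defs_eval eval_simps cong: eval_congs)

definition [hoas]: "set_cover I = (SIG S : hU. his_set S \<otimes>\<^sub>h (SIG e : S \<rightharpoonup> I. hconn S I e))"

definition cover_tel where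
  [hoas]: "cover_tel (Q :: quantifier) I K =
     Q hU (\<lambda>S. Q (his_set S) (\<lambda>h. Q (S \<rightharpoonup> I) (\<lambda>e. Q (hconn S I e) (\<lambda>c. K S h e c))))"

definition [hoas]: "cover_ty = (PI I : hU. PI G : hU1.
     his_prop G \<rightharpoonup> cover_tel hpi I (\<lambda>S h e c. G) \<rightharpoonup> htrunc (set_cover I) \<rightharpoonup> G)"

text \<open>The cover is given under a truncation, so the continuation has to end in a
  proposition.\<close>

lemma cover: "inhabited (cover_ty 0)"
  by (rule inhabitedI[where t = "(LAM I : hU. LAM G : hU1. LAM hG : his_prop G. LAM k : cover_tel hpi I (\<lambda>S h e c. G).
        LAM t : htrunc (set_cover I). htrec G hG (LAM z : set_cover I.
          hsplit (\<lambda>_. G) (\<lambda>S r. hsplit (\<lambda>_. G) (\<lambda>h r. hsplit (\<lambda>_. G) (\<lambda>e c. k \<bullet> S \<bullet> h \<bullet> e \<bullet> c) r) r) z) t) 0"])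
    (simp only: hoas defs_eval eval_simps cong: eval_congs)

definition presented_tel where
  [hoas]: "presented_tel (Q :: quantifier) K = Q hsets_cover (\<lambda>sc. Q hLEM (\<lambda>lem. Q (hU \<rightharpoonup> hU) (\<lambda>P.
     Q (PI X : hU. his_prop (P \<bullet> X)) (\<lambda>hP. Q (accessible_predicate P) (\<lambda>ac. Q (P \<bullet> hempty) (\<lambda>em.
       K sc lem P hP ac em))))))"

definition [hoas]: "presented_ty = presented_tel hpi (\<lambda>sc lem P hP ac em. htrunc (single_map P))"

text \<open>The truncated goal is itself a proposition by \<open>htpath\<close>, which permits the
  choice of a cover. The family handed on is the composite with \<open>e\<close>, and
  \<open>reindex\<close> has the type required of its presentation up to beta reduction.\<close>

lemma presented: "inhabited (presented_ty 0)"
  by (rule inhabited_mp[OF inhabited_mp[OF inhabited_mp[OF inhabited_mp[OF inhabitedI[where t = "(LAM si : set_indexed_ty. LAM ri : reindex_ty. LAM un : unpack_ty. LAM co : cover_ty.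
        presented_tel hlam (\<lambda>sc lem P hP ac em. un \<bullet> P \<bullet> htrunc (single_map P)
          \<bullet> unpack_tel hlam P (\<lambda>I A B f loc. co \<bullet> I \<bullet> htrunc (single_map P)
            \<bullet> (LAM x : htrunc (single_map P). LAM y : htrunc (single_map P). htpath x y)
            \<bullet> cover_tel hlam I (\<lambda>S h e c. htin (si \<bullet> lem \<bullet> P \<bullet> hP \<bullet> em \<bullet> S \<bullet> h
                \<bullet> (LAM s : S. A \<bullet> (e \<bullet> s)) \<bullet> (LAM s : S. B \<bullet> (e \<bullet> s)) \<bullet> (LAM s : S. f \<bullet> (e \<bullet> s))
                \<bullet> (ri \<bullet> P \<bullet> I \<bullet> A \<bullet> B \<bullet> f \<bullet> loc \<bullet> S \<bullet> e \<bullet> c)))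
            \<bullet> (sc \<bullet> I))
          \<bullet> ac)) 0"] set_indexed] reindex] unpack] cover])
    (simp only: hoas defs_eval eval_simps cong: eval_congs)

definition [hoas]: "main_ty = (hsets_cover \<rightharpoonup> hLEM \<rightharpoonup> (PI L : hsubuniverse.
     haccessible L \<rightharpoonup> his_local L hempty \<rightharpoonup> htrunc (hpresentation L)))"

text \<open>The predicate is \<open>is_local\<close> at \<open>L\<close>; its propositional values
  come from the second projection of \<open>PropU\<close>. The accessibility of \<open>L\<close>
  has, up to conversion, the form expected by \<open>presented\<close>.\<close>

lemma main: "inhabited (main_ty 0)"
  by (rule inhabited_mp[OF inhabitedI[where t = "(LAM pr : presented_ty. LAM sc : hsets_cover. LAM lem : hLEM. LAM L : hsubuniverse.
        LAM ac : haccessible L. LAM em : his_local L hempty.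
          pr \<bullet> sc \<bullet> lem \<bullet> (LAM X : hU. his_local L X)
            \<bullet> (LAM X : hU. hsnd hU his_prop (hfst (hU \<rightharpoonup> hPropU) L \<bullet> X)) \<bullet> ac \<bullet> em) 0"] presented])
    (simp only: hoas defs_eval eval_simps cong: eval_congs)

section \<open>From the lowest universe to an arbitrary one\<close>

lemma ushift_subuniverse_defs [simp]:
  "ushift n (sets_cover i) = sets_cover (i + n)"
  "ushift n (LEM i) = LEM (i + n)"
  "ushift n (PropU i) = PropU (i + n)"
  "ushift n (fst_tm A p) = fst_tm (ushift n A) (ushift n p)"
  "ushift n (holds i P X) = holds (i + n) (ushift n P) (ushift n X)"
  "ushift n (map_local A B g X) = map_local (ushift n A) (ushift n B) (ushift n g) (ushift n X)"
  "ushift n (refl_subuniverse i) = refl_subuniverse (i + n)"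
  "ushift n (is_local i L X) = is_local (i + n) (ushift n L) (ushift n X)"
  "ushift n (accessible i L) = accessible (i + n) (ushift n L)"
  "ushift n (single_map_presentation i L) = single_map_presentation (i + n) (ushift n L)"
  by (simp_all add: defs_eval)

lemma inhabited_ushift: "inhabited T \<Longrightarrow> inhabited (ushift n T)"
  unfolding inhabited_def using ushift_derivation(2)[of "[]" _ T n] by auto

theorem theorem5p6:
  fixes n :: nat
  shows "inhabited
    (sets_cover n \<rightarrow>
     LEM n \<rightarrow>
     Pi (refl_subuniverse n)
       (accessible n (Var 0) \<rightarrow>
        is_local n (Var 0) Empty \<rightarrow>
        Trunc (single_map_presentation n (Var 0))))"
proof -
  \<comment> \<open>At depth 0 the term with named variables unfolds to the same raw term as the de
    Bruijn statement, so this is a syntactic identity.\<close>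
  have "main_ty 0 = sets_cover 0 \<rightarrow> LEM 0 \<rightarrow> Pi (refl_subuniverse 0)
       (accessible 0 (Var 0) \<rightarrow> is_local 0 (Var 0) Empty \<rightarrow> Trunc (single_map_presentation 0 (Var 0)))"
    by (simp only: hoas defs_eval eval_simps cong: eval_congs)
  with inhabited_ushift[OF main, of n] show ?thesis by simp
qed

end
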